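(* Deciding whether a given 0-C1PVASS $\mathcal{A}$ (with all counter updates in $\{-1,0,+1\}$) is bounded can be done in polynomial time. Moreover, if $\mathcal{A}$ is bounded, then $b=\inf\{k\in\mathbb{R}\mid\mathcal{A}\text{ has no }k\text{-covering run}\}\le 2^{(4|\mathcal{A}|)^9}$, where $|\mathcal{A}|$ is the size of the encoding of $\mathcal{A}$.
   Context: A 0-C1PVASS is a tuple $\mathcal{A}=(S,\Gamma,\delta,\bot,s_0,f)$: finite state set $S$, finite stack alphabet $\Gamma\ni\bot$, initial state $s_0$, accepting state $f$, and a partial function $\delta:S\times S\rightharpoonup\mathbb{Z}\times(\{a,\overline{a}\mid a\in\Gamma\setminus\{\bot\}\}\cup\{\epsilon\})$ giving a counter update and a stack operation (push $a$, pop $a$, or none). Configurations are $(s,\alpha,c)$ with $\alpha\in\Gamma^*$ (top on the right) and $c\in\mathbb{R}_{\ge0}$; the initial configuration is $(s_0,\bot,0)$. A run is a sequence of configurations starting in the initial configuration where consecutive states are linked by a defined transition $(z,op)$, the stack is updated by $op$, and $c_{i+1}=c_i+\gamma_i z$ for some $\gamma_i\in(0,1]$, with all counter values $\ge 0$. A run is $k$-covering if it ends in state $f$ with counter value $\ge k$. $\mathcal{A}$ is bounded if there is $k\in\mathbb{R}_{\ge0}$ such that $\mathcal{A}$ has no $k$-covering run. *)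

theory Defs
  imports Complex_Main "HOL-Library.Extended_Real"
begin

section \<open>0-C1PVASS\<close>

datatype 'g stack_op = Eps | Push 'g | Pop 'g

record ('s, 'g) c1pvass =
  states :: "'s set"
  stack_syms :: "'g set"
  delta :: "'s \<times> 's \<rightharpoonup> int \<times> 'g stack_op"
  bottom :: 'g
  initial :: 's
  accepting :: 's

definition c1pvass :: "('s, 'g) c1pvass \<Rightarrow> bool" where
  "c1pvass A \<longleftrightarrow>
     finite (states A) \<and> finite (stack_syms A) \<and> bottom A \<in> stack_syms A \<and>
     initial A \<in> states A \<and> accepting A \<in> states A \<and>
     dom (delta A) \<subseteq> states A \<times> states A \<and>
     (\<forall>(z, op) \<in> ran (delta A). set_stack_op op \<subseteq> stack_syms A - {bottom A})"

definition unit_updates :: "('s, 'g) c1pvass \<Rightarrow> bool" where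
  "unit_updates A \<longleftrightarrow> (\<forall>(z, op) \<in> ran (delta A). z \<in> {-1, 0, 1})"

text \<open>The top of the stack is the last element of the list.\<close>
type_synonym ('s, 'g) conf = "'s \<times> 'g list \<times> real"

fun stack_update :: "'g stack_op \<Rightarrow> 'g list \<Rightarrow> 'g list \<Rightarrow> bool" where
  "stack_update Eps \<alpha> \<alpha>' \<longleftrightarrow> \<alpha>' = \<alpha>"
| "stack_update (Push a) \<alpha> \<alpha>' \<longleftrightarrow> \<alpha>' = \<alpha> @ [a]"
| "stack_update (Pop a) \<alpha> \<alpha>' \<longleftrightarrow> \<alpha> = \<alpha>' @ [a]"

definition conf_step :: "('s, 'g) c1pvass \<Rightarrow> ('s, 'g) conf \<Rightarrow> ('s, 'g) conf \<Rightarrow> bool" where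
  "conf_step A = (\<lambda>(s, \<alpha>, c) (s', \<alpha>', c').
     \<exists>z op \<gamma>. delta A (s, s') = Some (z, op) \<and> stack_update op \<alpha> \<alpha>' \<and>
       0 < \<gamma> \<and> \<gamma> \<le> 1 \<and> c' = c + \<gamma> * real_of_int z)"

definition is_run :: "('s, 'g) c1pvass \<Rightarrow> ('s, 'g) conf list \<Rightarrow> bool" where
  "is_run A \<rho> \<longleftrightarrow>
     \<rho> \<noteq> [] \<and> hd \<rho> = (initial A, [bottom A], 0) \<and>
     successively (conf_step A) \<rho> \<and>
     (\<forall>(s, \<alpha>, c) \<in> set \<rho>. s \<in> states A \<and> set \<alpha> \<subseteq> stack_syms A \<and> 0 \<le> c)"

definition covering_run :: "('s, 'g) c1pvass \<Rightarrow> real \<Rightarrow> ('s, 'g) conf list \<Rightarrow> bool" where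
  "covering_run A k \<rho> \<longleftrightarrow>
     is_run A \<rho> \<and> (case last \<rho> of (s, \<alpha>, c) \<Rightarrow> s = accepting A \<and> k \<le> c)"

definition is_bounded :: "('s, 'g) c1pvass \<Rightarrow> bool" where
  "is_bounded A \<longleftrightarrow> (\<exists>k\<ge>0. \<nexists>\<rho>. covering_run A k \<rho>)"

text \<open>
  The infimum is taken in the extended reals: if the accepting state is unreachable, then there is
  no \<open>k\<close>-covering run for any real \<open>k\<close>, and the infimum is \<open>-\<infinity>\<close>. (On type \<^typ>\<open>real\<close>, \<open>Inf\<close> of a
  set that is unbounded below would be an unspecified number.)
\<close>
definition cover_bound :: "('s, 'g) c1pvass \<Rightarrow> ereal" where
  "cover_bound A = Inf {ereal k |k. \<nexists>\<rho>. covering_run A k \<rho>}"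


section \<open>Encoding\<close>

text \<open>
  States and stack symbols are named by natural numbers, and all numbers are written in binary
  (least significant bit first, without leading zeros, so 0 is the empty word).
  The sections of the encoding are terminated by semicolons, the items in them by commas. A
  transition is written as its source, target, counter update and stack operation.
\<close>

datatype letter = Digit0 | Digit1 | MinusSign | PushSign | PopSign | Comma | Semicolon

fun bin :: "nat \<Rightarrow> letter list" where
  "bin n = (if n = 0 then [] else (if odd n then Digit1 else Digit0) # bin (n div 2))"

declare bin.simps [simp del]

definition enc_int :: "int \<Rightarrow> letter list" where
  "enc_int z = (if z < 0 then [MinusSign] else []) @ bin (nat \<bar>z\<bar>)"

fun enc_op :: "nat stack_op \<Rightarrow> letter list" where
  "enc_op Eps = []"
| "enc_op (Push a) = PushSign # bin a"
| "enc_op (Pop a) = PopSign # bin a"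

definition items :: "letter list list \<Rightarrow> letter list" where
  "items ws = concat (map (\<lambda>w. w @ [Comma]) ws)"

definition enc_trans :: "(nat, nat) c1pvass \<Rightarrow> nat \<times> nat \<Rightarrow> letter list" where
  "enc_trans A = (\<lambda>(p, q). case delta A (p, q) of
       None \<Rightarrow> []
     | Some (z, op) \<Rightarrow> items [bin p, bin q, enc_int z, enc_op op])"

definition encode :: "(nat, nat) c1pvass \<Rightarrow> letter list" where
  "encode A =
     (let S = sorted_list_of_set (states A); \<Gamma> = sorted_list_of_set (stack_syms A) in
        items (map bin S) @ [Semicolon] @
        items (map bin \<Gamma>) @ [Semicolon] @
        concat (map (enc_trans A) (List.product S S)) @ [Semicolon] @
        items [bin (bottom A), bin (initial A), bin (accepting A)])"

definition enc_size :: "(nat, nat) c1pvass \<Rightarrow> nat" where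
  "enc_size A = length (encode A)"

fun symbol_of :: "letter \<Rightarrow> nat" where
  "symbol_of Digit0 = 1"
| "symbol_of Digit1 = 2"
| "symbol_of MinusSign = 3"
| "symbol_of PushSign = 4"
| "symbol_of PopSign = 5"
| "symbol_of Comma = 6"
| "symbol_of Semicolon = 7"


section \<open>Polynomial-time decidability\<close>

text \<open>
  Deterministic multi-tape Turing machines. The states are \<open>{..<tm_states M}\<close> and the tape symbols
  \<open>{..<tm_symbols M}\<close>, with 0 as the blank; the transition function is only relevant on this finite
  domain, on which it has to stay within the machine. Tapes are infinite in both directions.
\<close>

datatype move = MoveLeft | Stay | MoveRight

record tm =
  tm_tapes :: nat
  tm_states :: nat
  tm_symbols :: nat
  tm_trans :: "nat \<Rightarrow> nat list \<Rightarrow> nat \<times> (nat \<times> move) list"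
  tm_start :: nat
  tm_accept :: nat
  tm_reject :: nat

definition turing_machine :: "tm \<Rightarrow> bool" where
  "turing_machine M \<longleftrightarrow>
     1 \<le> tm_tapes M \<and> 1 \<le> tm_symbols M \<and>
     tm_start M < tm_states M \<and> tm_accept M < tm_states M \<and> tm_reject M < tm_states M \<and>
     tm_accept M \<noteq> tm_reject M \<and>
     (\<forall>q < tm_states M. \<forall>xs. length xs = tm_tapes M \<and> set xs \<subseteq> {..<tm_symbols M} \<longrightarrow>
        (case tm_trans M q xs of (q', acts) \<Rightarrow>
           q' < tm_states M \<and> length acts = tm_tapes M \<and> fst ` set acts \<subseteq> {..<tm_symbols M}))"

text \<open>A tape consists of its contents and the position of its head.\<close>
type_synonym tape = "(int \<Rightarrow> nat) \<times> int"

fun tape_read :: "tape \<Rightarrow> nat" where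
  "tape_read (t, h) = t h"

fun head_shift :: "move \<Rightarrow> int" where
  "head_shift MoveLeft = -1"
| "head_shift Stay = 0"
| "head_shift MoveRight = 1"

fun tape_act :: "nat \<times> move \<Rightarrow> tape \<Rightarrow> tape" where
  "tape_act (x, m) (t, h) = (t(h := x), h + head_shift m)"

definition tm_step :: "tm \<Rightarrow> nat \<times> tape list \<Rightarrow> nat \<times> tape list" where
  "tm_step M = (\<lambda>(q, ts).
     if q \<in> {tm_accept M, tm_reject M} then (q, ts)
     else case tm_trans M q (map tape_read ts) of
       (q', acts) \<Rightarrow> (q', map2 tape_act acts ts))"

definition input_tape :: "nat list \<Rightarrow> tape" where
  "input_tape w = ((\<lambda>i. if 0 \<le> i \<and> i < int (length w) then w ! nat i else 0), 0)"

definition tm_init :: "tm \<Rightarrow> nat list \<Rightarrow> nat \<times> tape list" where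
  "tm_init M w = (tm_start M, input_tape w # replicate (tm_tapes M - 1) (input_tape []))"

text \<open>
  The problem ``given \<open>x \<in> X\<close>, does \<open>P x\<close> hold?'', where the instances are given to the machine as
  the words \<open>enc x\<close>. As accepting and rejecting configurations are fixed points of the step
  function, being in such a state after \<open>t\<close> steps means having halted within \<open>t\<close> steps.
\<close>
definition polytime_decidable :: "'x set \<Rightarrow> ('x \<Rightarrow> nat list) \<Rightarrow> ('x \<Rightarrow> bool) \<Rightarrow> bool" where
  "polytime_decidable X enc P \<longleftrightarrow>
     (\<exists>M c d. turing_machine M \<and>
        (\<forall>x \<in> X. set (enc x) \<subseteq> {0<..<tm_symbols M} \<and>
           (\<exists>t \<le> c * length (enc x) ^ d + c.
              fst ((tm_step M ^^ t) (tm_init M (enc x))) =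
                (if P x then tm_accept M else tm_reject M))))"

end

theory Submission
  imports Defs
begin

text \<open>
  Before the counter is positive no decrement is possible, and afterwards decrements can be made
  arbitrarily small. So the values at the accepting state are governed by the number of increments
  on paths of the underlying pushdown automaton whose first nonzero update is an increment. These
  paths are derived by a context-free grammar with a quadratic number of nonterminals. The number of
  increments is unbounded iff the grammar graph has a reachable cycle through an edge along which
  an increment is produced; otherwise it at most doubles (up to a constant) each time a strongly
  connected component is left, which gives the exponential bound. The existence of such a cycle is
  expressed by a fixed Datalog program over the positions of the encoding, and the least fixed
  point of a Datalog program is computed by nested loops on a Turing machine in polynomial time.
\<close>

section \<open>Pushdown systems with marked transitions\<close>

text \<open>The grammar graph alone does not tell whether a cycle gains increments: a production may
  contain a second nonterminal, of which it only matters whether it can produce an increment at all.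
  Hence counts are shadowed by Booleans (\<open>genb\<close>); the edges with their flags then form
  a finite object, and unboundedness becomes a reachability question. Real-valued counters enter
  through two effects only: a flag for positivity, which doubles the states, and a total loss by
  decrements that can be kept below any chosen budget.

  On the machine side, Datalog separates the logic from the tapes: reading the encoding, the grammar
  and its graph are all rules over positions, and a single evaluator has to be verified. With
  positions as constants there are polynomially many atoms, whose table addresses are numerals in
  base n + 2, and head positions used as unary registers suffice for the arithmetic. The evaluator
  never tests for stabilisation; it makes more sweeps than there are addresses. What gets derived is
  unboundedness, so the machine rejects when it finds the goal.\<close>

locale pds =
  fixes tr :: "'q \<Rightarrow> 'q \<Rightarrow> bool \<Rightarrow> 'g stack_op \<Rightarrow> bool"
    and fin :: "'q \<Rightarrow> bool"
begin

text \<open>The goal \<open>Some q\<close> stands for paths that return to their initial stack in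
  \<open>q\<close>, the goal \<open>None\<close> for paths that end in a final state, possibly with
  a larger stack; neither kind goes below its initial stack. In \<open>gen_push\<close> the pushed
  symbol stays forever, in \<open>gen_match\<close> it is popped by the matching transition.\<close>

inductive gen :: "'q \<Rightarrow> 'q option \<Rightarrow> nat \<Rightarrow> bool" where
  gen_refl: "gen p (Some p) 0"
| gen_fin: "fin p \<Longrightarrow> gen p None 0"
| gen_eps: "tr p r b Eps \<Longrightarrow> gen r X k \<Longrightarrow> gen p X (of_bool b + k)"
| gen_push: "tr p r b (Push a) \<Longrightarrow> gen r None k \<Longrightarrow> gen p None (of_bool b + k)"
| gen_match: "tr p r b (Push a) \<Longrightarrow> gen r (Some r') k \<Longrightarrow> tr r' s b' (Pop a) \<Longrightarrow> gen s X l \<Longrightarrow>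
    gen p X (of_bool b + k + of_bool b' + l)"

text \<open>Only the positivity of the count is kept. This is a finite relation over finitely many
  states, and it is all that the flags of \<open>edge\<close> have to know about a sibling
  nonterminal.\<close>

inductive genb :: "bool \<Rightarrow> 'q \<Rightarrow> 'q option \<Rightarrow> bool" where
  genb_refl: "genb False p (Some p)"
| genb_fin: "fin p \<Longrightarrow> genb False p None"
| genb_eps: "tr p r b Eps \<Longrightarrow> genb g r X \<Longrightarrow> genb (b \<or> g) p X"
| genb_push: "tr p r b (Push a) \<Longrightarrow> genb g r None \<Longrightarrow> genb (b \<or> g) p None"
| genb_match: "tr p r b (Push a) \<Longrightarrow> genb g r (Some r') \<Longrightarrow> tr r' s b' (Pop a) \<Longrightarrow> genb h s X \<Longrightarrow>
    genb (b \<or> g \<or> b' \<or> h) p X"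

lemma gen_imp_genb: "gen p X k \<Longrightarrow> genb (k > 0) p X"
proof (induction rule: gen.induct)
  case (gen_eps p r b X k)
  from genb_eps[OF this(1,3)] show ?case by (cases b) auto
next
  case (gen_push p r b a k)
  from genb_push[OF this(1,3)] show ?case by (cases b) auto
next
  case (gen_match p r b a r' k s b' X l)
  from genb_match[OF this(1,5,3,6)] show ?case by (cases b; cases b') auto
qed (simp_all add: genb.intros)

lemma genb_imp_gen: "genb g p X \<Longrightarrow> \<exists>k. gen p X k \<and> g = (k > 0)"
proof (induction rule: genb.induct)
  case (genb_eps p r b g X)
  then show ?case using gen_eps[OF genb_eps(1)] by fastforce
next
  case (genb_push p r b a g)
  then show ?case using gen_push[OF genb_push(1)] by fastforce
next
  case (genb_match p r b a g r' s b' h X)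
  then obtain k l where "gen r (Some r') k" "g = (k > 0)" "gen s X l" "h = (l > 0)" by blast
  from gen_match[OF genb_match(1) this(1) genb_match(3) this(3)] this(2,4) show ?case
    by fastforce
qed (blast intro: gen.intros)+

section \<open>The graph of the grammar and pumping along its cycles\<close>

text \<open>An edge leads from the left-hand side of a production to one nonterminal of its
  right-hand side. Its flag records whether the rest of the production, that is, its transitions and
  a derivation of the sibling, yields a mark. The \<open>genb\<close> premises make sibling and
  target productive, so that every edge extends to a derivation.\<close>

inductive edge :: "bool \<Rightarrow> 'q \<times> 'q option \<Rightarrow> 'q \<times> 'q option \<Rightarrow> bool" where
  edge_eps: "tr p r b Eps \<Longrightarrow> genb g r X \<Longrightarrow> edge b (p, X) (r, X)"
| edge_push: "tr p r b (Push a) \<Longrightarrow> genb g r None \<Longrightarrow> edge b (p, None) (r, None)"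
| edge_inner: "tr p r b (Push a) \<Longrightarrow> genb g r (Some r') \<Longrightarrow> tr r' s b' (Pop a) \<Longrightarrow> genb h s X \<Longrightarrow>
    edge (b \<or> b' \<or> h) (p, X) (r, Some r')"
| edge_after: "tr p r b (Push a) \<Longrightarrow> genb g r (Some r') \<Longrightarrow> tr r' s b' (Pop a) \<Longrightarrow> genb h s X \<Longrightarrow>
    edge (b \<or> b' \<or> g) (p, X) (s, X)"

inductive reach :: "bool \<Rightarrow> 'q \<times> 'q option \<Rightarrow> 'q \<times> 'q option \<Rightarrow> bool" where
  reach_refl: "reach False N N"
| reach_step: "reach f N M \<Longrightarrow> edge g M M' \<Longrightarrow> reach (f \<or> g) N M'"

definition pumpable :: "'q \<times> 'q option \<Rightarrow> bool" where
  "pumpable N \<longleftrightarrow> (\<exists>f M. reach f N M \<and> reach True M M)"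

lemma reach_trans: "reach g M L \<Longrightarrow> reach f N M \<Longrightarrow> reach (f \<or> g) N L"
proof (induction rule: reach.induct)
  case (reach_step f' N' M' g M'')
  from reach.reach_step[OF reach_step(3)[OF reach_step(4)] reach_step(2)]
  show ?case by (simp add: disj_assoc)
qed simp

text \<open>A derivation from the target is completed by one of the sibling; a set flag contributes
  at least one further mark, be it from a transition or from the sibling.\<close>

lemma edge_pump:
  "edge g N M \<Longrightarrow> gen (fst M) (snd M) k \<Longrightarrow> \<exists>l \<ge> k + of_bool g. gen (fst N) (snd N) l"
proof (induction rule: edge.induct)
  case (edge_eps p r b g X)
  then show ?case using gen_eps by fastforce
next
  case (edge_push p r b a g)
  then show ?case using gen_push by fastforce
next
  case (edge_inner p r b a g r' s b' h X)
  from genb_imp_gen[OF edge_inner(4)] obtain l where "gen s X l" "h = (l > 0)" by blast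
  with gen_match[OF edge_inner(1) _ edge_inner(3), of k X l] edge_inner(5) show ?case
    by (intro exI[of _ "of_bool b + k + of_bool b' + l"]) auto
next
  case (edge_after p r b a g r' s b' h X)
  from genb_imp_gen[OF edge_after(2)] obtain l where "gen r (Some r') l" "g = (l > 0)" by blast
  with gen_match[OF edge_after(1) _ edge_after(3), of l X k] edge_after(5) show ?case
    by (intro exI[of _ "of_bool b + l + of_bool b' + k"]) auto
qed

lemma reach_pump:
  "reach f N M \<Longrightarrow> gen (fst M) (snd M) k \<Longrightarrow> \<exists>l \<ge> k + of_bool f. gen (fst N) (snd N) l"
proof (induction arbitrary: k rule: reach.induct)
  case (reach_step f N M g M')
  from edge_pump[OF reach_step(2,4)] obtain l
    where l: "l \<ge> k + of_bool g" "gen (fst M) (snd M) l" by blast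
  from reach_step(3)[OF l(2)] obtain l' where "l' \<ge> l + of_bool f" "gen (fst N) (snd N) l'"
    by blast
  with l(1) show ?case by (intro exI[of _ l']) auto
qed auto

lemma edge_target_gen: "edge g N M \<Longrightarrow> \<exists>k. gen (fst M) (snd M) k"
  by (induction rule: edge.induct) (auto dest: genb_imp_gen)

text \<open>Each turn around the marked cycle adds a mark to a derivation from \<open>M\<close>, and
  the walk from \<open>N\<close> to \<open>M\<close> loses none.\<close>

lemma pumpable_gen:
  assumes "pumpable N"
  shows "\<exists>k \<ge> K. gen (fst N) (snd N) k"
proof -
  from assms obtain f M where M: "reach f N M" "reach True M M"
    unfolding pumpable_def by blast
  have "\<exists>k \<ge> K. gen (fst M) (snd M) k" for K
  proof (induction K)
    case 0
    \<comment> \<open>The flag \<open>True\<close> excludes the empty walk, and the last edge of the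
      cycle has a productive target.\<close>
    from M(2) show ?case by (cases rule: reach.cases) (auto dest: edge_target_gen)
  next
    case (Suc K)
    then obtain k where "k \<ge> K" "gen (fst M) (snd M) k" by blast
    with reach_pump[OF M(2), of k] obtain l where "l \<ge> k + 1" "gen (fst M) (snd M) l" by auto
    with \<open>k \<ge> K\<close> show ?case by (intro exI[of _ l]) auto
  qed
  then obtain k where "k \<ge> K" "gen (fst M) (snd M) k" by blast
  with reach_pump[OF M(1), of k] show ?thesis by (meson le_trans le_add1)
qed

section \<open>Exponential bound for nonterminals that cannot be pumped\<close>

abbreviation nodes :: "'q \<times> 'q option \<Rightarrow> ('q \<times> 'q option) set" where
  "nodes N \<equiv> {M. \<exists>f. reach f N M}"

lemma edge_reach: "edge g N M \<Longrightarrow> reach g N M"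
  using reach_step[OF reach_refl, of g N M] by simp

lemma nodes_edge:
  assumes "edge g N M"
  shows "nodes M \<subseteq> nodes N"
  using reach_trans[OF _ edge_reach[OF assms]] by blast

text \<open>If there is no way back to \<open>N\<close>, then \<open>N\<close> itself drops out of
  the reachable set. The number of reachable nodes thus is a rank that falls whenever a component is
  left.\<close>

lemma nodes_edge_strict:
  assumes "edge g N M" "\<And>f. \<not> reach f M N" "finite (nodes N)"
  shows "card (nodes M) < card (nodes N)"
proof (rule psubset_card_mono[OF assms(3)])
  have "N \<in> nodes N - nodes M" using assms(2) reach_refl by blast
  with nodes_edge[OF assms(1)] show "nodes M \<subset> nodes N" by blast
qed

text \<open>
  Within a strongly connected component no transition is marked and no sibling produces marks, so
  the number of marks only changes when the component is left, and there it at most doubles.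
\<close>
lemma not_pumpable_gen_bound:
  assumes "\<not> pumpable N0" and "finite (nodes N0)"
  shows "gen p X k \<Longrightarrow> (p, X) \<in> nodes N0 \<Longrightarrow> k + 2 \<le> 2 * 2 ^ card (nodes (p, X))"
proof (induction rule: gen.induct)
  have sub: "nodes N \<subseteq> nodes N0" "finite (nodes N)" if "N \<in> nodes N0" for N
  proof -
    show "nodes N \<subseteq> nodes N0" using that reach_trans by blast
    with assms(2) show "finite (nodes N)" by (rule finite_subset[rotated])
  qed
  \<comment> \<open>An edge on a cycle is unmarked, for otherwise the cycle would pump.\<close>
  have cyc: "\<not> g" if "N \<in> nodes N0" "edge g N M" "reach f M N" for N M f g
  proof
    assume g
    with reach_trans[OF that(3) edge_reach[OF that(2)]] have "reach True N N" by simp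
    with that(1) assms(1) show False unfolding pumpable_def by blast
  qed
  have edge_in: "M \<in> nodes N0" if "N \<in> nodes N0" "edge g N M" for N M g
    using that reach_step by blast
  have card_le: "card (nodes M) \<le> card (nodes N)" if "N \<in> nodes N0" "edge g N M" for N M g
    using that nodes_edge sub by (intro card_mono) auto
  have lin: "of_bool b + k + 2 \<le> 2 * 2 ^ card (nodes N)"
    if "N \<in> nodes N0" "edge b N M" "k + 2 \<le> 2 * 2 ^ card (nodes M)" for N M b and k :: nat
  proof (cases "\<exists>f. reach f M N")
    case True
    then obtain f where "reach f M N" ..
    from cyc[OF that(1,2) this] have "\<not> b" .
    moreover have "2 * 2 ^ card (nodes M) \<le> (2 * 2 ^ card (nodes N) :: nat)"
      using card_le[OF that(1,2)] by simp
    ultimately show ?thesis using that(3) by (simp only: of_bool_eq add_0)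
  next
    case False
    then have "card (nodes M) < card (nodes N)"
      using nodes_edge_strict[OF that(2)] sub(2)[OF that(1)] by blast
    then have "2 ^ Suc (card (nodes M)) \<le> (2 ^ card (nodes N) :: nat)"
      by (intro power_increasing) auto
    then show ?thesis using that(3) by (cases b) auto
  qed
  {
    case (gen_refl p)
    show ?case using one_le_power[of "2::nat" "card (nodes (p, Some p))"] by linarith
  next
    case (gen_fin p)
    show ?case using one_le_power[of "2::nat" "card (nodes (p, None))"] by linarith
  next
    case (gen_eps p r b X k)
    have e: "edge b (p, X) (r, X)"
      by (rule edge_eps[OF gen_eps(1) gen_imp_genb[OF gen_eps(2)]])
    from lin[OF gen_eps(4) e gen_eps(3)[OF edge_in[OF gen_eps(4) e]]] show ?case .
  next
    case (gen_push p r b a k)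
    have e: "edge b (p, None) (r, None)"
      by (rule edge_push[OF gen_push(1) gen_imp_genb[OF gen_push(2)]])
    from lin[OF gen_push(4) e gen_push(3)[OF edge_in[OF gen_push(4) e]]] show ?case .
  next
    case (gen_match p r b a r' k s b' X l)
    let ?c = "card (nodes (p, X))"
    have e1: "edge (b \<or> b' \<or> l > 0) (p, X) (r, Some r')"
      and e2: "edge (b \<or> b' \<or> k > 0) (p, X) (s, X)"
      using edge_inner[OF gen_match(1) gen_imp_genb[OF gen_match(2)] gen_match(3)
          gen_imp_genb[OF gen_match(4)]]
        edge_after[OF gen_match(1) gen_imp_genb[OF gen_match(2)] gen_match(3)
          gen_imp_genb[OF gen_match(4)]] by auto
    note k = gen_match(5)[OF edge_in[OF gen_match(7) e1]]
    note l = gen_match(6)[OF edge_in[OF gen_match(7) e2]]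
    consider f where "reach f (r, Some r') (p, X)" | f where "reach f (s, X) (p, X)"
      | "\<And>f. \<not> reach f (r, Some r') (p, X)" "\<And>f. \<not> reach f (s, X) (p, X)" by blast
    then show ?case
    proof cases
      \<comment> \<open>The first child lies in the component of the head, so the edge to it is
        unmarked: transitions and sibling contribute nothing.\<close>
      case 1
      from cyc[OF gen_match(7) e1 1] have "of_bool b + k + of_bool b' + l = k" by auto
      with lin[OF gen_match(7) e1 k] show ?thesis by auto
    next
      case 2
      from cyc[OF gen_match(7) e2 2] have "of_bool b + k + of_bool b' + l = l" by auto
      with lin[OF gen_match(7) e2 l] show ?thesis by auto
    next
      \<comment> \<open>Both children have smaller rank. The summand 2 in the claim absorbs the at
        most two marks of the transitions, as \<open>k + l + 4\<close> is at most
        \<open>2 ^ ?c + 2 ^ ?c\<close>.\<close>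
      case 3
      have "card (nodes (r, Some r')) < ?c" "card (nodes (s, X)) < ?c"
        using nodes_edge_strict[OF e1] nodes_edge_strict[OF e2] 3 sub(2)[OF gen_match(7)] by blast+
      then have "2 ^ Suc (card (nodes (r, Some r'))) \<le> (2 ^ ?c :: nat)"
        "2 ^ Suc (card (nodes (s, X))) \<le> (2 ^ ?c :: nat)"
        by (intro power_increasing; simp)+
      moreover have "of_bool b \<le> (1::nat)" "of_bool b' \<le> (1::nat)" by auto
      ultimately show ?thesis using k l by simp
    qed
  }
qed

lemma edge_carrier:
  assumes "\<And>p r b op. tr p r b op \<Longrightarrow> p \<in> Q \<and> r \<in> Q"
  shows "edge g N M \<Longrightarrow> N \<in> Q \<times> insert None (Some ` Q) \<Longrightarrow> M \<in> Q \<times> insert None (Some ` Q)"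
  by (induction rule: edge.induct) (use assms in blast)+

lemma nodes_carrier:
  assumes "\<And>p r b op. tr p r b op \<Longrightarrow> p \<in> Q \<and> r \<in> Q" and "N \<in> Q \<times> insert None (Some ` Q)"
  shows "nodes N \<subseteq> Q \<times> insert None (Some ` Q)"
proof -
  have "M \<in> Q \<times> insert None (Some ` Q)" if "reach f N M" for f M
    using that assms(2) by (induction rule: reach.induct) (use edge_carrier assms(1) in blast)+
  then show ?thesis by blast
qed

section \<open>Equivalence of stack paths and derivations\<close>

inductive path :: "'q \<times> 'g list \<Rightarrow> nat \<Rightarrow> 'q \<times> 'g list \<Rightarrow> bool" where
  path_refl: "path x 0 x"
| path_step: "tr p r b op \<Longrightarrow> stack_update op \<alpha> \<beta> \<Longrightarrow> path (r, \<beta>) k y \<Longrightarrow>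
    path (p, \<alpha>) (of_bool b + k) y"

lemma path_trans: "path x k y \<Longrightarrow> path y l z \<Longrightarrow> path x (k + l) z"
proof (induction rule: path.induct)
  case (path_step p r b op \<alpha> \<beta> k y)
  from path.path_step[OF path_step(1,2) path_step(4)[OF path_step(5)]] show ?case
    by (simp add: add.assoc)
qed simp

lemma path_single: "tr p r b op \<Longrightarrow> stack_update op \<alpha> \<beta> \<Longrightarrow> path (p, \<alpha>) (of_bool b) (r, \<beta>)"
  using path_step[OF _ _ path_refl] by force

lemma gen_imp_path:
  "gen p X k \<Longrightarrow> (case X of Some q \<Rightarrow> path (p, \<alpha>) k (q, \<alpha>)
     | None \<Rightarrow> \<exists>q \<beta>. fin q \<and> path (p, \<alpha>) k (q, \<beta>))"
proof (induction arbitrary: \<alpha> rule: gen.induct)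
  case (gen_refl p)
  show ?case by (simp add: path_refl)
next
  case (gen_fin p)
  then show ?case by (auto intro: path_refl)
next
  case (gen_eps p r b X k)
  then show ?case using path_step[OF gen_eps(1), of \<alpha> \<alpha>] by (fastforce split: option.splits)
next
  case (gen_push p r b a k)
  then show ?case using path_step[OF gen_push(1), of \<alpha> "\<alpha> @ [a]"] by fastforce
next
  case (gen_match p r b a r' k s b' X l)
  have 1: "path (r, \<alpha> @ [a]) k (r', \<alpha> @ [a])" using gen_match(5)[of "\<alpha> @ [a]"] by simp
  have "path (p, \<alpha>) (of_bool b + k + of_bool b') (s, \<alpha>)"
    by (rule path_trans[OF path_step[OF gen_match(1) _ 1] path_single[OF gen_match(3)]]) simp_all
  from path_trans[OF this] gen_match(6)[of \<alpha>] show ?case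
    by (fastforce split: option.splits)
qed

text \<open>An accepting path, decomposed by the stack it starts with: either it never pops a symbol
  of that stack, or it first stays above the topmost symbol, then pops it and is decomposed again.
  Prefixing a transition preserves this form, which permits an induction over single steps.\<close>

inductive dec :: "'q \<Rightarrow> 'g list \<Rightarrow> nat \<Rightarrow> bool" where
  dec_stay: "gen p None k \<Longrightarrow> dec p \<alpha> k"
| dec_pop: "gen p (Some q) k \<Longrightarrow> tr q s b (Pop a) \<Longrightarrow> dec s \<beta> l \<Longrightarrow>
    dec p (\<beta> @ [a]) (k + of_bool b + l)"

lemma dec_step:
  assumes "tr p r b op" "stack_update op \<alpha> \<beta>" "dec r \<beta> k"
  shows "dec p \<alpha> (of_bool b + k)"
proof (cases op)
  case Eps
  from assms(3) show ?thesis
  proof cases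
    case dec_stay
    with gen_eps[of p r b None k] assms(1) Eps show ?thesis by (simp add: dec.dec_stay)
  next
    case (dec_pop q k' s b' a \<beta>' l)
    with dec.dec_pop[OF gen_eps[of p r b "Some q" k'], of s b' a \<beta>' l] assms(1,2) Eps show ?thesis
      by (simp add: add.assoc)
  qed
next
  case (Push a)
  from assms(3) show ?thesis
  proof cases
    case dec_stay
    with gen_push[of p r b a k] assms(1) Push show ?thesis by (simp add: dec.dec_stay)
  next
    case (dec_pop q k' s b' a' \<beta>' l)
    \<comment> \<open>The symbol popped first is the one just pushed, so the two transitions match
      and can be put in front of whatever follows the pop.\<close>
    have m: "gen s X l' \<Longrightarrow> gen p X (of_bool b + k' + of_bool b' + l')" for X l'
      using gen_match[of p r b a q k' s b' X l'] dec_pop assms(1,2) Push by simp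
    from dec_pop(5) show ?thesis
    proof cases
      case dec_stay
      from m[OF this] dec_pop(2) show ?thesis by (simp add: dec.dec_stay add.assoc)
    next
      case (dec_pop q2 k2 s2 b2 a2 \<beta>2 l2)
      with dec.dec_pop[OF m[OF this(3)] this(4,5)] \<open>k = k' + of_bool b' + l\<close>
        \<open>\<beta> = \<beta>' @ [a']\<close> assms(2) Push
      show ?thesis by (simp add: add.assoc)
    qed
  qed
next
  case (Pop a)
  with dec_pop[OF gen_refl[of p], of r b a \<beta> k] assms show ?thesis by simp
qed

text \<open>As the only initial stack symbol is never popped, just the first form of the
  decomposition remains.\<close>

lemma path_imp_gen:
  assumes "path (p, [a]) k (q, \<beta>)" "fin q" "\<And>r s b. \<not> tr r s b (Pop a)"
  shows "gen p None k"
proof -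
  have "dec (fst x) (snd x) k" if "path x k y" "fin (fst y)" for x k y
    using that
  proof (induction rule: path.induct)
    case (path_refl x)
    then show ?case by (simp add: dec_stay gen_fin)
  next
    case (path_step p r b op \<alpha> \<beta> k y)
    then show ?case using dec_step by fastforce
  qed
  from this[OF assms(1)] assms(2) have "dec p [a] k" by simp
  then show ?thesis
  proof cases
    case (dec_pop q' k' s b a' \<beta>' l)
    with assms(3) show ?thesis by simp
  qed
qed

end


section \<open>Boundedness of a 0-C1PVASS\<close>

text \<open>
  The Boolean in a state tells whether the counter has become positive. Before that, a decrement is
  impossible; afterwards decrements can be made arbitrarily small, so that only the number of
  increments (the marked transitions) matters.
\<close>

fun ptr :: "('s, 'g) c1pvass \<Rightarrow> 's \<times> bool \<Rightarrow> 's \<times> bool \<Rightarrow> bool \<Rightarrow> 'g stack_op \<Rightarrow> bool" where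
  "ptr A (p, c) (q, d) b op \<longleftrightarrow> (\<exists>z. delta A (p, q) = Some (z, op) \<and>
     (z = 0 \<and> d = c \<and> \<not> b \<or> z = 1 \<and> d \<and> b \<or> z = -1 \<and> c \<and> d \<and> \<not> b))"

section \<open>Runs of the automaton and marked paths\<close>

locale unit_c1pvass =
  fixes A :: "('s, 'g) c1pvass"
  assumes c1pvass: "c1pvass A" and unit_updates: "unit_updates A"
begin

sublocale pds "ptr A" "\<lambda>(p, c). p = accepting A" .

lemma delta_props:
  assumes "delta A (p, q) = Some (z, op)"
  shows "p \<in> states A" "q \<in> states A" "z \<in> {-1, 0, 1}"
    "set_stack_op op \<subseteq> stack_syms A - {bottom A}"
proof -
  from assms have "(p, q) \<in> dom (delta A)" "(z, op) \<in> ran (delta A)" by (auto simp: ran_def)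
  with c1pvass unit_updates show "p \<in> states A" "q \<in> states A" "z \<in> {-1, 0, 1}"
    "set_stack_op op \<subseteq> stack_syms A - {bottom A}"
    unfolding c1pvass_def unit_updates_def by fast+
qed

definition start :: "'s \<times> bool" where "start = (initial A, False)"

lemma is_run_snoc:
  assumes "\<rho> \<noteq> []"
  shows "is_run A (\<rho> @ [(s, \<alpha>, c)]) \<longleftrightarrow> is_run A \<rho> \<and> conf_step A (last \<rho>) (s, \<alpha>, c) \<and>
    s \<in> states A \<and> set \<alpha> \<subseteq> stack_syms A \<and> 0 \<le> c"
  using assms unfolding is_run_def by (auto simp: successively_append_iff)

text \<open>Fractions are at most 1, so an increment adds at most 1. The clause on the flag supplies
  the guard of decrements in \<open>ptr\<close>: while the counter is 0, a decrement by a positive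
  fraction would make it negative.\<close>

lemma is_run_imp_path:
  "is_run A \<rho> \<Longrightarrow> last \<rho> = (s, \<alpha>, c) \<Longrightarrow>
     \<exists>k b. path (start, [bottom A]) k ((s, b), \<alpha>) \<and> c \<le> real k \<and> (\<not> b \<longrightarrow> c = 0)"
proof (induction \<rho> arbitrary: s \<alpha> c rule: rev_induct)
  case Nil
  then show ?case by (simp add: is_run_def)
next
  case (snoc x \<rho>)
  show ?case
  proof (cases "\<rho> = []")
    case True
    with snoc.prems show ?thesis by (auto simp: is_run_def start_def intro!: path_refl exI[of _ 0])
  next
    case False
    obtain s' \<alpha>' c' where l: "last \<rho> = (s', \<alpha>', c')" by (cases "last \<rho>")
    from snoc.prems False l have r: "is_run A \<rho>" and st: "conf_step A (s', \<alpha>', c') (s, \<alpha>, c)"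
      and c: "0 \<le> c" by (auto simp: is_run_snoc)
    from snoc.IH[OF r l] obtain k b where kb: "path (start, [bottom A]) k ((s', b), \<alpha>')"
      "c' \<le> real k" "\<not> b \<longrightarrow> c' = 0" by blast
    from st obtain z op \<gamma> where z: "delta A (s', s) = Some (z, op)" "stack_update op \<alpha>' \<alpha>"
      "0 < \<gamma>" "\<gamma> \<le> 1" "c = c' + \<gamma> * real_of_int z" by (auto simp: conf_step_def)
    define d where "d \<longleftrightarrow> b \<or> z = 1"
    from delta_props(3)[OF z(1)] kb(3) z(3,5) c have "z = -1 \<longrightarrow> b" by auto
    with delta_props(3)[OF z(1)] z(1) have "ptr A (s', b) (s, d) (z = 1) op"
      by (auto simp: d_def)
    from path_trans[OF kb(1) path_single[OF this z(2)]]
    have "path (start, [bottom A]) (k + of_bool (z = 1)) ((s, d), \<alpha>)" .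
    moreover have "c \<le> real (k + of_bool (z = 1))" "\<not> d \<longrightarrow> c = 0"
      using kb(2,3) z(3,4,5) delta_props(3)[OF z(1)] \<open>z = -1 \<longrightarrow> b\<close> by (auto simp: d_def)
    ultimately show ?thesis by blast
  qed
qed

text \<open>Increments are taken with fraction 1. A decrement may cost half of the remaining budget
  \<open>\<epsilon>\<close>, and the rest of the path gets the other half; hence the generalisation
  over \<open>\<epsilon>\<close>.\<close>

lemma path_imp_is_run:
  "path x k y \<Longrightarrow> is_run A \<rho> \<Longrightarrow> last \<rho> = (fst (fst x), snd x, c) \<Longrightarrow>
     (if snd (fst x) then c > 0 else c = 0) \<Longrightarrow> \<epsilon> > 0 \<Longrightarrow>
     \<exists>\<rho>' c'. is_run A \<rho>' \<and> last \<rho>' = (fst (fst y), snd y, c') \<and> c' \<ge> c + real k - \<epsilon>"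
proof (induction arbitrary: \<rho> c \<epsilon> rule: path.induct)
  case (path_refl x)
  then show ?case by (intro exI[of _ \<rho>] exI[of _ c]) auto
next
  case (path_step p' r' b op \<alpha> \<beta> k y)
  obtain p d r e where [simp]: "p' = (p, d)" "r' = (r, e)" by (cases p'; cases r')
  from path_step(1) obtain z where z: "delta A (p, r) = Some (z, op)"
    "z = 0 \<and> e = d \<and> \<not> b \<or> z = 1 \<and> e \<and> b \<or> z = -1 \<and> d \<and> e \<and> \<not> b" by auto
  \<comment> \<open>\<open>c / 2\<close> keeps the counter positive, \<open>\<epsilon> / 2\<close>
    keeps the loss within its half of the budget.\<close>
  define \<gamma> where "\<gamma> = (if z = -1 then Min {1, c / 2, \<epsilon> / 2} else 1)"
  define c' where "c' = c + \<gamma> * real_of_int z"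
  have \<gamma>: "0 < \<gamma>" "\<gamma> \<le> 1" using path_step z(2) by (auto simp: \<gamma>_def)
  have "0 \<le> c" using path_step(7) by (auto split: if_splits)
  then have c': "if e then c' > 0 else c' = 0" "c' \<ge> c + of_bool b - \<epsilon> / 2"
    using path_step z(2) by (auto simp: c'_def \<gamma>_def min_def)
  have c0: "0 \<le> c'" using c'(1) by (auto split: if_splits)
  have stk: "set \<alpha> \<subseteq> stack_syms A"
    using path_step(5,6) last_in_set[of \<rho>] by (fastforce simp: is_run_def)
  have "set \<beta> \<subseteq> stack_syms A"
    using path_step(2) stk delta_props(4)[OF z(1)] by (cases op) auto
  moreover have "conf_step A (p, \<alpha>, c) (r, \<beta>, c')"
    using z(1) path_step(2) \<gamma> by (auto simp: conf_step_def c'_def)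
  moreover have "\<rho> \<noteq> []" using path_step(5) by (auto simp: is_run_def)
  ultimately have run: "is_run A (\<rho> @ [(r, \<beta>, c')])"
    using path_step(5,6) c0 delta_props(2)[OF z(1)] by (simp add: is_run_snoc)
  have "\<exists>\<rho>' c''. is_run A \<rho>' \<and> last \<rho>' = (fst (fst y), snd y, c'') \<and> c'' \<ge> c' + real k - \<epsilon> / 2"
    by (rule path_step(4)[OF run]) (use c'(1) path_step(8) in auto)
  then show ?case using c'(2) by fastforce
qed

text \<open>The subtracted 1 is the budget granted to all decrements together.\<close>

lemma gen_imp_covering_run:
  assumes "gen start None k"
  shows "\<exists>\<rho>. covering_run A (real k - 1) \<rho>"
proof -
  from gen_imp_path[OF assms, of "[bottom A]"] obtain c \<beta>
    where p: "path (start, [bottom A]) k ((accepting A, c), \<beta>)" by auto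
  have "is_run A [(initial A, [bottom A], 0)]" using c1pvass by (simp add: is_run_def c1pvass_def)
  from path_imp_is_run[OF p this, of 0 1] show ?thesis
    by (fastforce simp: start_def covering_run_def)
qed

text \<open>Stack operations exclude the bottom symbol, so it is never popped and
  \<open>path_imp_gen\<close> applies.\<close>

lemma covering_run_imp_gen:
  assumes "covering_run A k \<rho>"
  shows "\<exists>l. gen start None l \<and> k \<le> real l"
proof -
  from assms obtain \<alpha> c where r: "is_run A \<rho>" "last \<rho> = (accepting A, \<alpha>, c)" "k \<le> c"
    by (auto simp: covering_run_def split: prod.splits)
  from is_run_imp_path[OF r(1,2)] obtain l b
    where l: "path (start, [bottom A]) l ((accepting A, b), \<alpha>)" "c \<le> real l" by blast
  have "\<not> ptr A u v d (Pop (bottom A))" for u v d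
    using delta_props(4) by (cases u; cases v) fastforce
  from path_imp_gen[OF l(1) _ this] l(2) r(3) show ?thesis by (intro exI[of _ l]) auto
qed

text \<open>The factors 2 are the positivity flags, the summand 1 is the goal
  \<open>None\<close>.\<close>

lemma start_nodes:
  shows "finite (nodes (start, None))"
    and "card (nodes (start, None)) \<le> 2 * card (states A) * (2 * card (states A) + 1)"
proof -
  let ?Q = "states A \<times> (UNIV :: bool set)"
  have Q: "p \<in> ?Q \<and> r \<in> ?Q" if "ptr A p r b op" for p r b op
    using that delta_props(1,2) by (cases p; cases r) fastforce
  have start: "(start, None) \<in> ?Q \<times> insert None (Some ` ?Q)"
    using c1pvass by (simp add: start_def c1pvass_def)
  note sub = nodes_carrier[of ?Q, OF Q start]
  have fin: "finite ?Q" using c1pvass by (simp add: c1pvass_def)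
  then have fin': "finite (?Q \<times> insert None (Some ` ?Q))" by blast
  show "finite (nodes (start, None))" using finite_subset[OF sub fin'] .
  have "card (nodes (start, None)) \<le> card (?Q \<times> insert None (Some ` ?Q))"
    by (rule card_mono[OF fin' sub])
  also have "\<dots> = card ?Q * Suc (card ?Q)"
    using fin by (simp add: card_cartesian_product card_image card.insert_remove image_iff)
  finally show "card (nodes (start, None)) \<le> 2 * card (states A) * (2 * card (states A) + 1)"
    by (simp add: card_cartesian_product mult.commute)
qed

lemma not_covering_run:
  assumes "\<not> pumpable (start, None)"
  shows "\<not> covering_run A (2 * 2 ^ card (nodes (start, None))) \<rho>"
proof
  assume "covering_run A (2 * 2 ^ card (nodes (start, None))) \<rho>"
  from covering_run_imp_gen[OF this] obtain l
    where l: "gen start None l" "2 * 2 ^ card (nodes (start, None)) \<le> real l" by blast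
  have "l + 2 \<le> 2 * 2 ^ card (nodes (start, None))"
    by (rule not_pumpable_gen_bound[OF assms start_nodes(1) l(1)]) (auto intro: reach_refl)
  then have "real (l + 2) \<le> real (2 * 2 ^ card (nodes (start, None)))" by (rule of_nat_mono)
  with l(2) show False by simp
qed

lemma is_bounded_iff: "is_bounded A \<longleftrightarrow> \<not> pumpable (start, None)"
proof
  assume "is_bounded A"
  then obtain k where k: "\<And>\<rho>. \<not> covering_run A k \<rho>" by (auto simp: is_bounded_def)
  show "\<not> pumpable (start, None)"
  proof
    assume "pumpable (start, None)"
    \<comment> \<open>The additional 1 makes up for the loss in
      \<open>gen_imp_covering_run\<close>.\<close>
    from pumpable_gen[OF this, of "nat \<lceil>k\<rceil> + 1"] obtain l
      where "l \<ge> nat \<lceil>k\<rceil> + 1" "gen start None l" by auto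
    moreover from this(1) have "k \<le> real l - 1" by linarith
    moreover obtain \<rho> where "covering_run A (real l - 1) \<rho>"
      using gen_imp_covering_run[OF calculation(2)] by blast
    ultimately have "covering_run A k \<rho>" by (auto simp: covering_run_def split: prod.splits)
    with k show False by blast
  qed
next
  assume "\<not> pumpable (start, None)"
  from not_covering_run[OF this] show "is_bounded A"
    unfolding is_bounded_def by (intro exI[of _ "2 * 2 ^ card (nodes (start, None))"]) auto
qed

lemma cover_bound_le:
  assumes "is_bounded A"
  shows "cover_bound A \<le> ereal (2 * 2 ^ (2 * card (states A) * (2 * card (states A) + 1)))"
proof -
  have "cover_bound A \<le> ereal (2 * 2 ^ card (nodes (start, None)))"
    unfolding cover_bound_def
    by (rule Inf_lower) (use not_covering_run assms is_bounded_iff in blast)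
  also have "\<dots> \<le> ereal (2 * 2 ^ (2 * card (states A) * (2 * card (states A) + 1)))"
    using start_nodes(2) by (simp add: power_increasing)
  finally show ?thesis .
qed

end

text \<open>Every state contributes at least a comma to the first section, and the semicolons make
  the inequality strict.\<close>

lemma card_states_less_enc_size:
  assumes "finite (states A)"
  shows "card (states A) < enc_size A"
proof -
  have "length (ws :: letter list list) \<le> length (items ws)" for ws
    by (induction ws) (auto simp: items_def)
  from this[of "map bin (sorted_list_of_set (states A))"] assms show ?thesis
    by (auto simp: enc_size_def encode_def Let_def)
qed

text \<open>The number of nonterminals is quadratic in the number of states, so the exponent is
  already below the square of \<open>4 * enc_size A\<close>.\<close>

lemma cover_bound_le_enc_size:
  assumes "c1pvass A" "unit_updates A" "is_bounded A"
  shows "cover_bound A \<le> ereal (2 ^ ((4 * enc_size A) ^ 9))"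
proof -
  interpret unit_c1pvass A using assms by unfold_locales
  let ?s = "card (states A)" and ?n = "enc_size A"
  have s: "?s < ?n" using assms(1) by (intro card_states_less_enc_size) (simp add: c1pvass_def)
  have "2 * ?s * (2 * ?s + 1) + 1 \<le> 4 * ?n * (4 * ?n)"
  proof -
    have "2 * ?s * (2 * ?s + 1) \<le> 2 * ?n * (2 * ?n)" using s by (intro mult_mono) auto
    moreover have "1 \<le> ?n * ?n" using s by (cases ?n) auto
    ultimately have "2 * ?s * (2 * ?s + 1) + 1 \<le> 4 * (?n * ?n) + ?n * ?n" by linarith
    then show ?thesis by simp
  qed
  also have "\<dots> \<le> (4 * ?n) ^ 9"
    using power_increasing[of 2 9 "4 * ?n"] s by (simp add: power2_eq_square)
  finally have "(2::real) ^ Suc (2 * ?s * (2 * ?s + 1)) \<le> 2 ^ ((4 * ?n) ^ 9)"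
    by (intro power_increasing) auto
  with cover_bound_le[OF assms(3)] show ?thesis
    by (metis ereal_less_eq(3) order_trans power_Suc)
qed


section \<open>Structured tape programs\<close>

datatype com = Skip | Mv nat move | Wr nat nat | Cp nat nat | Seq com com
  | IfS nat nat com com | Until nat nat com

text \<open>The counts are exactly those of the machine, one step for each command or test taken up,
  so that the simulation can be stated as an equation between iterates.\<close>

inductive exec :: "com \<Rightarrow> (nat \<Rightarrow> tape) \<Rightarrow> nat \<Rightarrow> (nat \<Rightarrow> tape) \<Rightarrow> bool" where
  exec_Skip: "exec Skip \<sigma> 1 \<sigma>"
| exec_Mv: "exec (Mv i d) \<sigma> 1 (\<sigma>(i := tape_act (tape_read (\<sigma> i), d) (\<sigma> i)))"
| exec_Wr: "exec (Wr i s) \<sigma> 1 (\<sigma>(i := tape_act (s, Stay) (\<sigma> i)))"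
| exec_Cp: "exec (Cp i j) \<sigma> 1 (\<sigma>(i := tape_act (tape_read (\<sigma> j), Stay) (\<sigma> i)))"
| exec_Seq: "exec a \<sigma> s \<sigma>1 \<Longrightarrow> exec b \<sigma>1 t \<sigma>2 \<Longrightarrow> exec (Seq a b) \<sigma> (Suc (s + t)) \<sigma>2"
| exec_IfT: "tape_read (\<sigma> i) = s \<Longrightarrow> exec a \<sigma> t \<sigma>1 \<Longrightarrow> exec (IfS i s a b) \<sigma> (Suc t) \<sigma>1"
| exec_IfF: "tape_read (\<sigma> i) \<noteq> s \<Longrightarrow> exec b \<sigma> t \<sigma>1 \<Longrightarrow> exec (IfS i s a b) \<sigma> (Suc t) \<sigma>1"
| exec_Until0: "tape_read (\<sigma> i) = s \<Longrightarrow> exec (Until i s c) \<sigma> 1 \<sigma>"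
| exec_Until: "tape_read (\<sigma> i) \<noteq> s \<Longrightarrow> exec c \<sigma> t \<sigma>1 \<Longrightarrow> exec (Until i s c) \<sigma>1 t' \<sigma>2 \<Longrightarrow>
    exec (Until i s c) \<sigma> (Suc (t + t')) \<sigma>2"

text \<open>
  The Turing machine for a program has the lists of commands that remain to be executed as states.
\<close>

definition noop :: "(nat \<Rightarrow> nat) \<Rightarrow> nat \<Rightarrow> nat \<times> move" where
  "noop r = (\<lambda>i. (r i, Stay))"

fun next_cont :: "com \<Rightarrow> com list \<Rightarrow> (nat \<Rightarrow> nat) \<Rightarrow> com list \<times> (nat \<Rightarrow> nat \<times> move)" where
  "next_cont Skip K r = (K, noop r)"
| "next_cont (Mv i d) K r = (K, (noop r)(i := (r i, d)))"
| "next_cont (Wr i s) K r = (K, (noop r)(i := (s, Stay)))"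
| "next_cont (Cp i j) K r = (K, (noop r)(i := (r j, Stay)))"
| "next_cont (Seq a b) K r = (a # b # K, noop r)"
| "next_cont (IfS i s a b) K r = ((if r i = s then a else b) # K, noop r)"
| "next_cont (Until i s c) K r = (if r i = s then K else c # Until i s c # K, noop r)"

text \<open>A syntactic superset of the continuations met while \<open>c\<close> runs in front of
  \<open>K\<close>, without \<open>K\<close> itself. It is finite because a loop puts itself back
  into the list from which it came.\<close>

fun conts :: "com \<Rightarrow> com list \<Rightarrow> com list set" where
  "conts (Seq a b) K = insert (Seq a b # K) (conts a (b # K) \<union> conts b K)"
| "conts (IfS i s a b) K = insert (IfS i s a b # K) (conts a K \<union> conts b K)"
| "conts (Until i s c) K = insert (Until i s c # K) (conts c (Until i s c # K))"
| "conts c K = {c # K}"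

fun wf_com :: "nat \<Rightarrow> nat \<Rightarrow> com \<Rightarrow> bool" where
  "wf_com k S Skip \<longleftrightarrow> True"
| "wf_com k S (Mv i d) \<longleftrightarrow> i < k"
| "wf_com k S (Wr i s) \<longleftrightarrow> i < k \<and> s < S"
| "wf_com k S (Cp i j) \<longleftrightarrow> i < k \<and> j < k"
| "wf_com k S (Seq a b) \<longleftrightarrow> wf_com k S a \<and> wf_com k S b"
| "wf_com k S (IfS i s a b) \<longleftrightarrow> i < k \<and> wf_com k S a \<and> wf_com k S b"
| "wf_com k S (Until i s c) \<longleftrightarrow> i < k \<and> wf_com k S c"

lemma finite_conts: "finite (conts c K)"
  by (induction c arbitrary: K) auto

lemma conts_self: "c # K \<in> conts c K"
  by (cases c) auto

lemma conts_wf: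
  "L \<in> conts c K \<Longrightarrow> wf_com k S c \<Longrightarrow> \<forall>d \<in> set K. wf_com k S d \<Longrightarrow> \<forall>d \<in> set L. wf_com k S d"
proof (induction c arbitrary: K L)
  case (Seq a b)
  from Seq.prems(1) consider "L = Seq a b # K" | "L \<in> conts a (b # K)" | "L \<in> conts b K" by auto
  then show ?case
  proof cases
    case 2
    show ?thesis by (rule Seq.IH(1)[OF 2]) (use Seq.prems in auto)
  next
    case 3
    show ?thesis by (rule Seq.IH(2)[OF 3]) (use Seq.prems in auto)
  qed (use Seq.prems in auto)
next
  case (IfS i s a b)
  from IfS.prems(1) consider "L = IfS i s a b # K" | "L \<in> conts a K" | "L \<in> conts b K" by auto
  then show ?case
  proof cases
    case 2
    show ?thesis by (rule IfS.IH(1)[OF 2]) (use IfS.prems in auto)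
  next
    case 3
    show ?thesis by (rule IfS.IH(2)[OF 3]) (use IfS.prems in auto)
  qed (use IfS.prems in auto)
next
  case (Until i s c)
  from Until.prems(1) consider "L = Until i s c # K" | "L \<in> conts c (Until i s c # K)" by auto
  then show ?case
  proof cases
    case 2
    show ?thesis by (rule Until.IH[OF 2]) (use Until.prems in auto)
  qed (use Until.prems in auto)
qed auto

text \<open>Closure under steps: together with the final list \<open>K\<close>, these continuations
  can serve as the state set of a machine.\<close>

lemma conts_step:
  "d # L \<in> conts c K \<Longrightarrow> fst (next_cont d L r) \<in> insert K (conts c K)"
proof (induction c arbitrary: K)
  case (Seq a b)
  from Seq.prems consider "d # L = Seq a b # K" | "d # L \<in> conts a (b # K)" | "d # L \<in> conts b K"
    by auto
  then show ?case
  proof cases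
    case 1
    then show ?thesis using conts_self[of a "b # K"] by auto
  next
    case 2
    from Seq.IH(1)[OF 2] show ?thesis using conts_self[of b K] by auto
  next
    case 3
    from Seq.IH(2)[OF 3] show ?thesis by auto
  qed
next
  case (IfS i s a b)
  from IfS.prems consider "d # L = IfS i s a b # K" | "d # L \<in> conts a K" | "d # L \<in> conts b K"
    by auto
  then show ?case
  proof cases
    case 1
    then show ?thesis using conts_self[of a K] conts_self[of b K] by auto
  next
    case 2
    from IfS.IH(1)[OF 2] show ?thesis by auto
  next
    case 3
    from IfS.IH(2)[OF 3] show ?thesis by auto
  qed
next
  case (Until i s c)
  from Until.prems consider "d # L = Until i s c # K" | "d # L \<in> conts c (Until i s c # K)"
    by auto
  then show ?case
  proof cases
    case 1
    then show ?thesis using conts_self[of c "Until i s c # K"] by auto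
  next
    case 2
    from Until.IH[OF 2] show ?thesis by auto
  qed
qed auto

lemma next_cont_acts:
  assumes "wf_com k S d" "\<And>i. i < k \<Longrightarrow> r i < S" "i < k"
  shows "fst (snd (next_cont d L r) i) < S"
  using assms by (cases d) (auto simp: noop_def)

text \<open>The machine sees a list of \<open>k\<close> symbols, whose indexing is arbitrary beyond
  \<open>k\<close>, whereas programs see a function on all tapes; only the values below
  \<open>k\<close> have an effect.\<close>

lemma next_cont_cong:
  assumes "wf_com k S d" "\<And>i. i < k \<Longrightarrow> r i = r' i"
  shows "fst (next_cont d L r) = fst (next_cont d L r')"
    and "i < k \<Longrightarrow> snd (next_cont d L r) i = snd (next_cont d L r') i"
  using assms by (cases d; auto simp: noop_def)+

section \<open>The Turing machine of a program\<close>

locale program =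
  fixes c :: com and k S out :: nat and h :: "com list \<Rightarrow> nat"
  assumes wf: "wf_com k S c" and out: "out < k"
    and h: "bij_betw h (insert [] (conts c [])) {0..<card (insert [] (conts c []))}"
begin

definition Q :: "com list set" where "Q = insert [] (conts c [])"

text \<open>Continuations are numbered below \<open>card Q\<close>, and the two halting states come
  after them. The empty continuation makes one last step that reads the answer from tape
  \<open>out\<close>, where the symbol 1 leads to rejection.\<close>

definition trans :: "nat \<Rightarrow> nat list \<Rightarrow> nat \<times> (nat \<times> move) list" where
  "trans q xs = (if card Q \<le> q then (q, map (\<lambda>x. (x, Stay)) xs)
     else case inv_into Q h q of
       [] \<Rightarrow> (if xs ! out = 1 then Suc (card Q) else card Q, map (\<lambda>x. (x, Stay)) xs)
     | d # L \<Rightarrow> (case next_cont d L ((!) xs) of (L', a) \<Rightarrow> (h L', map a [0..<k])))"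

definition machine :: tm where
  "machine = \<lparr>tm_tapes = k, tm_states = card Q + 2, tm_symbols = S, tm_trans = trans,
     tm_start = h [c], tm_accept = card Q, tm_reject = Suc (card Q)\<rparr>"

lemma h_less: "L \<in> Q \<Longrightarrow> h L < card Q"
  using h by (auto simp: Q_def bij_betw_def)

lemma inv_h: "L \<in> Q \<Longrightarrow> inv_into Q h (h L) = L"
  using h by (simp add: Q_def bij_betw_def)

lemma inv_h_in: "q < card Q \<Longrightarrow> inv_into Q h q \<in> Q"
  using h by (metis Q_def atLeastLessThan_iff bij_betw_def inv_into_into le0)

lemma Q_wf: "L \<in> Q \<Longrightarrow> d \<in> set L \<Longrightarrow> wf_com k S d"
  using conts_wf[of L c "[]" k S] wf by (auto simp: Q_def)

lemma Q_step: "d # L \<in> Q \<Longrightarrow> fst (next_cont d L r) \<in> Q"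
  using conts_step[of d L c "[]" r] by (auto simp: Q_def)

lemma start_Q: "[c] \<in> Q"
  using conts_self by (auto simp: Q_def)

lemma turing_machine:
  assumes "1 \<le> S"
  shows "turing_machine machine"
proof -
  have "case trans q xs of (q', acts) \<Rightarrow>
     q' < card Q + 2 \<and> length acts = k \<and> fst ` set acts \<subseteq> {..<S}"
    if q: "q < card Q + 2" and xs: "length xs = k" "set xs \<subseteq> {..<S}" for q xs
  proof (cases "card Q \<le> q \<or> inv_into Q h q = []")
    case True
    with q xs show ?thesis by (auto simp: trans_def)
  next
    case False
    then obtain d L where dL: "inv_into Q h q = d # L" by (auto simp: neq_Nil_conv)
    from False have "inv_into Q h q \<in> Q" by (intro inv_h_in) auto
    with dL have in_Q: "d # L \<in> Q" by simp
    from Q_wf[OF this, of d] have wf_d: "wf_com k S d" by simp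
    have lt: "xs ! i < S" if "i < k" for i using xs that by (metis lessThan_iff nth_mem subsetD)
    show ?thesis
      using False dL h_less[OF Q_step[OF in_Q, of "(!) xs"]] next_cont_acts[OF wf_d, where r = "(!) xs" and L = L] lt
      by (auto simp: trans_def case_prod_beta)
  qed
  with assms out h_less[OF start_Q] show ?thesis
    unfolding turing_machine_def machine_def by simp
qed

definition config :: "com list \<Rightarrow> (nat \<Rightarrow> tape) \<Rightarrow> nat \<times> tape list" where
  "config L \<sigma> = (h L, map \<sigma> [0..<k])"

lemma step:
  assumes "d # L \<in> Q"
  shows "tm_step machine (config (d # L) \<sigma>) =
    (case next_cont d L (\<lambda>i. tape_read (\<sigma> i)) of (L', a) \<Rightarrow>
       config L' (\<lambda>i. tape_act (a i) (\<sigma> i)))"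
proof -
  have "wf_com k S d" using Q_wf[OF assms, of d] by simp
  note cong = next_cont_cong[OF this, where r' = "\<lambda>i. tape_read (\<sigma> i)" and L = L]
  define r where "r = (!) (map (tape_read \<circ> \<sigma>) [0..<k])"
  have r: "r i = tape_read (\<sigma> i)" if "i < k" for i using that by (simp add: r_def)
  have "fst (next_cont d L r) = fst (next_cont d L (\<lambda>i. tape_read (\<sigma> i)))"
    by (rule cong(1)[OF r])
  moreover have "map2 tape_act (map (snd (next_cont d L r)) [0..<k]) (map \<sigma> [0..<k]) =
      map (\<lambda>i. tape_act (snd (next_cont d L (\<lambda>i. tape_read (\<sigma> i))) i) (\<sigma> i)) [0..<k]"
    by (rule nth_equalityI) (auto simp: cong(2)[OF r])
  ultimately show ?thesis using h_less[OF assms]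
    by (simp add: tm_step_def machine_def trans_def config_def inv_h[OF assms] r_def[symmetric]
        case_prod_beta)
qed

lemma tape_act_read [simp]: "tape_act (tape_read x, Stay) x = x"
  by (cases x) auto

lemma tape_act_noop [simp]: "tape_act (noop (\<lambda>i. tape_read (\<sigma> i)) i) (\<sigma> i) = \<sigma> i"
  by (simp add: noop_def)

lemma funpow_Suc_add: "(f ^^ Suc (s + t)) x = (f ^^ t) ((f ^^ s) (f x))"
  by (simp add: funpow_Suc_right add.commute[of s t] funpow_add del: funpow.simps)

text \<open>The continuation \<open>L\<close> is arbitrary because the parts of a command run in
  front of what remains of it.\<close>

lemma exec_steps:
  "exec d \<sigma> t \<sigma>' \<Longrightarrow> conts d L \<subseteq> Q \<Longrightarrow> L \<in> Q \<Longrightarrow>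
     (tm_step machine ^^ t) (config (d # L) \<sigma>) = config L \<sigma>'"
proof (induction arbitrary: L rule: exec.induct)
  case (exec_Skip \<sigma>)
  then show ?case by (simp add: step)
next
  case (exec_Mv i d \<sigma>)
  then show ?case by (auto simp: step intro!: arg_cong[where f = "config L"])
next
  case (exec_Wr i s \<sigma>)
  then show ?case by (auto simp: step intro!: arg_cong[where f = "config L"])
next
  case (exec_Cp i j \<sigma>)
  then show ?case by (auto simp: step intro!: arg_cong[where f = "config L"])
next
  case (exec_Seq a \<sigma> s \<sigma>1 b t \<sigma>2)
  have "(tm_step machine ^^ s) (config (a # b # L) \<sigma>) = config (b # L) \<sigma>1"
    using exec_Seq(5,6) conts_self by (intro exec_Seq(3)) auto
  moreover have "(tm_step machine ^^ t) (config (b # L) \<sigma>1) = config L \<sigma>2"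
    using exec_Seq(5,6) by (intro exec_Seq(4)) auto
  moreover have "Seq a b # L \<in> Q" using exec_Seq(5) by simp
  ultimately show ?case
    by (simp add: funpow_Suc_add step del: funpow.simps)
next
  case (exec_IfT \<sigma> i s a t \<sigma>1 b)
  then have "(tm_step machine ^^ t) (config (a # L) \<sigma>) = config L \<sigma>1" by simp
  moreover have "IfS i s a b # L \<in> Q" using exec_IfT(4) by simp
  ultimately show ?case using exec_IfT(1) by (simp add: funpow_Suc_right step del: funpow.simps)
next
  case (exec_IfF \<sigma> i s b t \<sigma>1 a)
  then have "(tm_step machine ^^ t) (config (b # L) \<sigma>) = config L \<sigma>1" by simp
  moreover have "IfS i s a b # L \<in> Q" using exec_IfF(4) by simp
  ultimately show ?case using exec_IfF(1) by (simp add: funpow_Suc_right step del: funpow.simps)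
next
  case (exec_Until0 \<sigma> i s c)
  then show ?case by (simp add: step)
next
  case (exec_Until \<sigma> i s c t \<sigma>1 t' \<sigma>2)
  have Q: "Until i s c # L \<in> Q" using exec_Until(6) by simp
  have "(tm_step machine ^^ t) (config (c # Until i s c # L) \<sigma>) = config (Until i s c # L) \<sigma>1"
    using exec_Until(6) Q by (intro exec_Until(4)) auto
  moreover note exec_Until(5)[OF exec_Until(6,7)]
  ultimately show ?case using exec_Until(1) Q
    by (simp add: funpow_Suc_add step del: funpow.simps)
qed

lemma run:
  assumes "exec c \<sigma> t \<sigma>'"
  shows "fst ((tm_step machine ^^ Suc t) (h [c], map \<sigma> [0..<k])) =
    (if tape_read (\<sigma>' out) = 1 then tm_reject machine else tm_accept machine)"
proof -
  have Q: "conts c [] \<subseteq> Q" "[] \<in> Q" by (auto simp: Q_def)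
  have "(tm_step machine ^^ t) (h [c], map \<sigma> [0..<k]) = (h [], map \<sigma>' [0..<k])"
    using exec_steps[OF assms Q] by (simp add: config_def)
  then show ?thesis
    using h_less[OF Q(2)] out by (simp add: tm_step_def machine_def trans_def inv_h[OF Q(2)])
qed

end

section \<open>Executions with upper bounds on the time\<close>

definition runs :: "com \<Rightarrow> (nat \<Rightarrow> tape) \<Rightarrow> nat \<Rightarrow> (nat \<Rightarrow> tape) \<Rightarrow> bool" where
  "runs c \<sigma> T \<sigma>' \<longleftrightarrow> (\<exists>t \<le> T. exec c \<sigma> t \<sigma>')"

lemma runs_exec: "exec c \<sigma> t \<sigma>' \<Longrightarrow> t \<le> T \<Longrightarrow> runs c \<sigma> T \<sigma>'"
  by (auto simp: runs_def)

lemma runs_mono: "runs c \<sigma> T \<sigma>' \<Longrightarrow> T \<le> T' \<Longrightarrow> runs c \<sigma> T' \<sigma>'"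
  unfolding runs_def by (meson order_trans)

lemma runs_Skip: "runs Skip \<sigma> 1 \<sigma>"
  using exec_Skip runs_exec by blast

lemma runs_Seq:
  "runs a \<sigma> s \<sigma>1 \<Longrightarrow> runs b \<sigma>1 t \<sigma>2 \<Longrightarrow> runs (Seq a b) \<sigma> (s + t + 1) \<sigma>2"
  unfolding runs_def by (metis add_le_mono exec_Seq Suc_eq_plus1 Suc_le_mono)

lemma runs_IfT:
  "tape_read (\<sigma> i) = s \<Longrightarrow> runs a \<sigma> t \<sigma>1 \<Longrightarrow> runs (IfS i s a b) \<sigma> (t + 1) \<sigma>1"
  unfolding runs_def by (metis exec_IfT Suc_eq_plus1 Suc_le_mono)

lemma runs_IfF:
  "tape_read (\<sigma> i) \<noteq> s \<Longrightarrow> runs b \<sigma> t \<sigma>1 \<Longrightarrow> runs (IfS i s a b) \<sigma> (t + 1) \<sigma>1"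
  unfolding runs_def by (metis exec_IfF Suc_eq_plus1 Suc_le_mono)

text \<open>\<open>f\<close> is the trajectory of the loop; it takes the place of an invariant and
  fixes the number \<open>k\<close> of rounds.\<close>

lemma runs_Until:
  assumes "\<And>j. j < k \<Longrightarrow> tape_read (f j i) \<noteq> s" "\<And>j. j < k \<Longrightarrow> runs c (f j) T (f (Suc j))"
    and "tape_read (f k i) = s"
  shows "runs (Until i s c) (f 0) (k * (T + 1) + 1) (f k)"
  using assms
proof (induction k arbitrary: f)
  case 0
  then show ?case by (auto intro: runs_exec exec_Until0)
next
  case (Suc k)
  from Suc.IH[of "\<lambda>j. f (Suc j)"] Suc.prems
  have "runs (Until i s c) (f (Suc 0)) (k * (T + 1) + 1) (f (Suc k))" by auto
  then obtain t' where t': "t' \<le> k * (T + 1) + 1" "exec (Until i s c) (f (Suc 0)) t' (f (Suc k))"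
    unfolding runs_def by blast
  from Suc.prems(2)[of 0] obtain t where t: "t \<le> T" "exec c (f 0) t (f (Suc 0))"
    unfolding runs_def by auto
  from exec_Until[OF Suc.prems(1)[of 0] t(2) t'(2)]
  have "exec (Until i s c) (f 0) (Suc (t + t')) (f (Suc k))" by simp
  then show ?case using t(1) t'(1) by (rule_tac runs_exec) auto
qed

fun seqs :: "com list \<Rightarrow> com" where
  "seqs [] = Skip"
| "seqs (c # cs) = Seq c (seqs cs)"

lemma wf_seqs: "wf_com k S (seqs cs) \<longleftrightarrow> (\<forall>c \<in> set cs. wf_com k S c)"
  by (induction cs) auto

text \<open>The operation may depend on tape 0 because the input is copied from there.\<close>
lemma runs_seqs_tapes:
  assumes "\<And>\<sigma> i. i \<in> set is \<Longrightarrow> runs (c i) \<sigma> T (\<sigma>(i := g (\<sigma> 0) (\<sigma> i)))"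
    and "distinct is" "0 \<notin> set is"
  shows "runs (seqs (map c is)) \<sigma> (length is * (T + 1) + 1)
    (\<lambda>i. if i \<in> set is then g (\<sigma> 0) (\<sigma> i) else \<sigma> i)"
  using assms
proof (induction "is" arbitrary: \<sigma>)
  case Nil
  show ?case using runs_Skip by simp
next
  case (Cons i "is")
  let ?\<sigma> = "\<sigma>(i := g (\<sigma> 0) (\<sigma> i))"
  have "runs (seqs (map c is)) ?\<sigma> (length is * (T + 1) + 1)
    (\<lambda>i. if i \<in> set is then g (?\<sigma> 0) (?\<sigma> i) else ?\<sigma> i)"
    using Cons.prems by (intro Cons.IH) auto
  also have "(\<lambda>i. if i \<in> set is then g (?\<sigma> 0) (?\<sigma> i) else ?\<sigma> i) =
    (\<lambda>j. if j \<in> set (i # is) then g (\<sigma> 0) (\<sigma> j) else \<sigma> j)"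
    using Cons.prems by auto
  finally have "runs (Seq (c i) (seqs (map c is))) \<sigma> (T + (length is * (T + 1) + 1) + 1)
    (\<lambda>j. if j \<in> set (i # is) then g (\<sigma> 0) (\<sigma> j) else \<sigma> j)"
    by (intro runs_Seq[OF Cons.prems(1)]) auto
  then show ?case by (simp add: algebra_simps)
qed


section \<open>Polynomial bounds\<close>

text \<open>The base \<open>Suc n\<close> is at least 1, so that powers are monotone in the exponent
  even for \<open>n = 0\<close>, and sums and products stay within this form.\<close>

definition poly_bounded :: "(nat \<Rightarrow> nat) \<Rightarrow> bool" where
  "poly_bounded f \<longleftrightarrow> (\<exists>c d. \<forall>n. f n \<le> c * Suc n ^ d)"

lemma poly_bounded_const: "poly_bounded (\<lambda>n. c)"
  unfolding poly_bounded_def by (rule exI[of _ c], rule exI[of _ 0]) simp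

lemma poly_bounded_id: "poly_bounded (\<lambda>n. n)"
  unfolding poly_bounded_def by (rule exI[of _ 1], rule exI[of _ 1]) simp

lemma poly_bounded_add:
  assumes "poly_bounded f" "poly_bounded g"
  shows "poly_bounded (\<lambda>n. f n + g n)"
proof -
  from assms obtain c d c' d' where f: "\<And>n. f n \<le> c * Suc n ^ d" and g: "\<And>n. g n \<le> c' * Suc n ^ d'"
    unfolding poly_bounded_def by blast
  have "f n + g n \<le> (c + c') * Suc n ^ (d + d')" for n
  proof -
    have "c * Suc n ^ d \<le> c * Suc n ^ (d + d')" "c' * Suc n ^ d' \<le> c' * Suc n ^ (d + d')"
      by (intro mult_le_mono2 power_increasing; simp)+
    with f[of n] g[of n] show ?thesis unfolding add_mult_distrib by linarith
  qed
  then show ?thesis unfolding poly_bounded_def by blast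
qed

lemma poly_bounded_mult:
  assumes "poly_bounded f" "poly_bounded g"
  shows "poly_bounded (\<lambda>n. f n * g n)"
proof -
  from assms obtain c d c' d' where f: "\<And>n. f n \<le> c * Suc n ^ d" and g: "\<And>n. g n \<le> c' * Suc n ^ d'"
    unfolding poly_bounded_def by blast
  have "f n * g n \<le> (c * c') * Suc n ^ (d + d')" for n
    using mult_le_mono[OF f[of n] g[of n]] by (simp add: power_add mult_ac)
  then show ?thesis unfolding poly_bounded_def by blast
qed

lemma poly_bounded_Suc: "poly_bounded f \<Longrightarrow> poly_bounded (\<lambda>n. Suc (f n))"
  using poly_bounded_add[OF poly_bounded_const[of 1]] by simp

lemma poly_bounded_power: "poly_bounded f \<Longrightarrow> poly_bounded (\<lambda>n. f n ^ k)"
  by (induction k) (auto intro: poly_bounded_const poly_bounded_mult)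

lemmas poly_bounded_intros = poly_bounded_const poly_bounded_id poly_bounded_add
  poly_bounded_mult poly_bounded_Suc poly_bounded_power

lemma poly_bounded_iff_monom:
  assumes "poly_bounded f"
  shows "\<exists>c d. \<forall>n. f n \<le> c * n ^ d + c"
proof -
  from assms obtain c d where f: "\<And>n. f n \<le> c * Suc n ^ d" unfolding poly_bounded_def by blast
  \<comment> \<open>For positive \<open>n\<close>, \<open>Suc n\<close> is at most
    \<open>2 * n\<close>, which costs the factor \<open>2 ^ d\<close>; the constant summand covers
    \<open>n = 0\<close>.\<close>
  have "f n \<le> (c * 2 ^ d) * n ^ d + c * 2 ^ d" for n
  proof (cases n)
    case 0
    with f[of n] have "f n \<le> c * 1" by simp
    also have "\<dots> \<le> c * 2 ^ d" by (intro mult_le_mono2) simp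
    finally show ?thesis by simp
  next
    case (Suc m)
    then have "Suc n ^ d \<le> (2 * n) ^ d" by (intro power_mono) auto
    then have "c * Suc n ^ d \<le> c * (2 * n) ^ d" by (rule mult_le_mono2)
    with f[of n] have "f n \<le> c * (2 * n) ^ d" by (rule order_trans)
    then show ?thesis by (simp add: power_mult_distrib mult.assoc)
  qed
  then show ?thesis by blast
qed


section \<open>Datalog over the positions of a word\<close>

text \<open>
  An argument of an atom is a variable together with an offset. A rule consists of letters
  required at the positions given by variables, the body and the head.
\<close>

type_synonym 'p atm = "'p \<times> (nat \<times> nat) list"
type_synonym 'p rule = "(nat \<times> nat) list \<times> 'p atm list \<times> 'p atm"

definition inst :: "(nat \<Rightarrow> nat) \<Rightarrow> 'p atm \<Rightarrow> 'p \<times> nat list" where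
  "inst x a = (fst a, map (\<lambda>(i, d). x i + d) (snd a))"

text \<open>All variables, also those that occur only in the head, range over the positions of
  \<open>u\<close>; only an offset can lead beyond the end.\<close>

inductive_set derives :: "'p rule set \<Rightarrow> nat list \<Rightarrow> ('p \<times> nat list) set"
  for Rs u where
  derives: "(cs, bs, a) \<in> Rs \<Longrightarrow> \<forall>i. x i < length u \<Longrightarrow> \<forall>(i, s) \<in> set cs. u ! x i = s \<Longrightarrow>
    \<forall>b \<in> set bs. inst x b \<in> derives Rs u \<Longrightarrow> inst x a \<in> derives Rs u"

definition fires :: "nat list \<Rightarrow> (nat \<Rightarrow> nat) \<Rightarrow> ('p \<times> nat list \<Rightarrow> nat) \<Rightarrow> nat set \<Rightarrow> 'p rule \<Rightarrow> bool"
  where "fires u x \<iota> F = (\<lambda>(cs, bs, a). (\<forall>(i, s) \<in> set cs. u ! x i = s) \<and>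
    (\<forall>b \<in> set bs. \<iota> (inst x b) \<in> F))"

definition apply_rule ::
  "nat list \<Rightarrow> ('p \<times> nat list \<Rightarrow> nat) \<Rightarrow> (nat \<Rightarrow> nat) \<Rightarrow> 'p rule \<Rightarrow> nat set \<Rightarrow> nat set" where
  "apply_rule u \<iota> x r F = (if fires u x \<iota> F r then insert (\<iota> (inst x (snd (snd r)))) F else F)"

text \<open>The table is updated in place: atoms found for one assignment are available to the
  next.\<close>

fun sweep :: "((nat \<Rightarrow> nat) \<Rightarrow> nat set \<Rightarrow> nat set) \<Rightarrow> nat \<Rightarrow> nat \<Rightarrow> (nat \<Rightarrow> nat) \<Rightarrow> nat set \<Rightarrow> nat set"
  where
  "sweep b n 0 x F = b x F"
| "sweep b n (Suc j) x F = foldl (\<lambda>F v. sweep b n j (x(j := v)) F) F [0..<Suc n]"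

locale datalog =
  fixes rs :: "'p rule list" and e :: "'p \<Rightarrow> nat" and Ps :: "'p set" and V ar R :: nat
  assumes wf_conds: "(cs, bs, a) \<in> set rs \<Longrightarrow> (i, s) \<in> set cs \<Longrightarrow> i < V"
    and wf_atoms: "(cs, bs, a) \<in> set rs \<Longrightarrow> b \<in> set (a # bs) \<Longrightarrow>
      fst b \<in> Ps \<and> length (snd b) = ar \<and> (\<forall>(i, d) \<in> set (snd b). i < V \<and> d \<le> 1)"
    and e_inj: "inj_on e Ps" and e_less: "p \<in> Ps \<Longrightarrow> e p < R"
begin

text \<open>
  The base will be \<open>n + 2\<close> for inputs of length \<open>n\<close>, which exceeds every position plus offset.
\<close>
definition pos :: "nat \<Rightarrow> 'p \<times> nat list \<Rightarrow> nat" where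
  "pos m a = foldl (\<lambda>v d. v * m + d) (Suc (e (fst a))) (snd a)"

definition valid :: "nat \<Rightarrow> 'p \<times> nat list \<Rightarrow> bool" where
  "valid m a \<longleftrightarrow> fst a \<in> Ps \<and> length (snd a) = ar \<and> (\<forall>d \<in> set (snd a). d < m)"

lemma foldl_base_less:
  "\<forall>d \<in> set ds. d < m \<Longrightarrow> v < c \<Longrightarrow> foldl (\<lambda>v d. v * m + d) v ds < c * (m::nat) ^ length ds"
proof (induction ds arbitrary: v c)
  case (Cons d ds)
  have "v * m + d < c * m"
  proof -
    have "v * m + d < Suc v * m" using Cons.prems by simp
    also have "\<dots> \<le> c * m" using Cons.prems by (intro mult_le_mono1) simp
    finally show ?thesis .
  qed
  with Cons.IH[of "v * m + d" "c * m"] Cons.prems show ?case by (simp add: mult.assoc)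
qed simp

lemma foldl_base_inj:
  "length ds = length ds' \<Longrightarrow> \<forall>d \<in> set ds. d < (m::nat) \<Longrightarrow> \<forall>d \<in> set ds'. d < m \<Longrightarrow>
    foldl (\<lambda>v d. v * m + d) v ds = foldl (\<lambda>v d. v * m + d) v' ds' \<Longrightarrow> v = v' \<and> ds = ds'"
proof (induction ds ds' arbitrary: v v' rule: list_induct2)
  case (Cons d ds d' ds')
  have eq: "v * m + d = v' * m + d' \<and> ds = ds'"
    by (rule Cons.IH) (use Cons.prems in simp_all)
  have "(v * m + d) div m = v" "(v * m + d) mod m = d" "(v' * m + d') div m = v'" "(v' * m + d') mod m = d'"
    using Cons.prems by simp_all
  with eq show ?case by metis
qed simp

text \<open>Applied with a successor as leading digit: no atom gets the address 0, which is the cell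
  of the end marker.\<close>

lemma foldl_base_pos: "0 < v \<Longrightarrow> 0 < m \<Longrightarrow> 0 < foldl (\<lambda>v d. v * m + d) v (ds :: nat list)"
  by (induction ds arbitrary: v) auto

lemma pos_less: "valid m a \<Longrightarrow> pos m a < Suc R * m ^ ar"
  using foldl_base_less[of "snd a" m "Suc (e (fst a))" "Suc R"] e_less
  by (auto simp: valid_def pos_def)

lemma pos_inj: "valid m a \<Longrightarrow> valid m b \<Longrightarrow> pos m a = pos m b \<Longrightarrow> a = b"
  using foldl_base_inj[of "snd a" "snd b" m "Suc (e (fst a))" "Suc (e (fst b))"] e_inj
  by (auto simp: valid_def pos_def prod_eq_iff dest: inj_onD)

lemma valid_inst:
  assumes "(cs, bs, a) \<in> set rs" "b \<in> set (a # bs)" "\<forall>i. x i \<le> n"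
  shows "valid (n + 2) (inst x b)"
proof -
  have "x i + d < n + 2" if "(i, d) \<in> set (snd b)" for i d
  proof -
    have "d \<le> 1" using wf_atoms[OF assms(1,2)] that by blast
    moreover have "x i \<le> n" using assms(3) by blast
    ultimately show ?thesis by linarith
  qed
  with wf_atoms[OF assms(1,2)] show ?thesis unfolding valid_def inst_def by auto
qed

definition apply_all :: "nat list \<Rightarrow> (nat \<Rightarrow> nat) \<Rightarrow> nat set \<Rightarrow> nat set" where
  "apply_all u x = fold (apply_rule u (pos (length u + 1)) x) rs"

end

section \<open>The nested loops compute the least fixed point\<close>

locale datalog_word = datalog rs e Ps V ar R
  for rs :: "'p rule list" and e :: "'p \<Rightarrow> nat" and Ps :: "'p set" and V ar R :: nat +
  fixes w :: "nat list"
begin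

definition u :: "nat list" where "u = 8 # w"
definition n :: nat where "n = length w"

definition \<iota> :: "'p \<times> nat list \<Rightarrow> nat" where "\<iota> = pos (n + 2)"
abbreviation "W \<equiv> \<iota> ` derives (set rs) u"

lemma length_u: "length u = n + 1"
  by (simp add: u_def n_def)

lemma derives_valid: "a \<in> derives (set rs) u \<Longrightarrow> valid (n + 2) a"
proof (induction rule: derives.induct)
  case (derives cs bs a x)
  then show ?case by (intro valid_inst) (auto simp: length_u less_Suc_eq_le)
qed

lemma W_subset: "W \<subseteq> {..<Suc R * (n + 2) ^ ar}"
  using derives_valid pos_less by (auto simp: \<iota>_def)

lemma W_finite: "finite W"
  using W_subset finite_subset by blast

lemma W_card: "card W \<le> Suc R * (n + 2) ^ ar"
  using card_mono[OF _ W_subset] by simp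

lemma fires_mono: "F \<subseteq> F' \<Longrightarrow> fires u x \<iota> F r \<Longrightarrow> fires u x \<iota> F' r"
  by (auto simp: fires_def)

lemma apply_rule_incr: "F \<subseteq> apply_rule u \<iota> x r F"
  by (auto simp: apply_rule_def)

lemma apply_rule_mono: "F \<subseteq> F' \<Longrightarrow> apply_rule u \<iota> x r F \<subseteq> apply_rule u \<iota> x r F'"
  using fires_mono by (auto simp: apply_rule_def)

text \<open>An address in \<open>W\<close> only says that some derivable atom has this address;
  injectivity of \<open>pos\<close> on valid atoms identifies it with the instance in the rule
  body.\<close>

lemma apply_rule_sound:
  assumes "r \<in> set rs" "\<forall>i. x i \<le> n" "F \<subseteq> W"
  shows "apply_rule u \<iota> x r F \<subseteq> W"
proof (cases "fires u x \<iota> F r")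
  case True
  obtain cs bs a where r: "r = (cs, bs, a)" by (cases r)
  have "inst x b \<in> derives (set rs) u" if "b \<in> set bs" for b
  proof -
    from True that r assms(3) have "\<iota> (inst x b) \<in> W" by (auto simp: fires_def)
    then obtain b' where b': "b' \<in> derives (set rs) u" "\<iota> (inst x b) = \<iota> b'" by blast
    from pos_inj[OF valid_inst derives_valid[OF b'(1)] b'(2)[unfolded \<iota>_def]] assms(1,2) r that
    have "inst x b = b'" by fastforce
    with b' show ?thesis by simp
  qed
  then have "inst x a \<in> derives (set rs) u"
    using True assms(1,2) r by (intro derives[of cs bs]) (auto simp: fires_def length_u less_Suc_eq_le)
  with assms(3) r show ?thesis by (auto simp: apply_rule_def)
next
  case False
  with assms(3) show ?thesis by (simp add: apply_rule_def)
qed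

lemma fold_apply_incr: "F \<subseteq> fold (apply_rule u \<iota> x) rs' F"
  by (induction rs' arbitrary: F) (use apply_rule_incr in fastforce)+

lemma fold_apply_rules:
  "r \<in> set rs' \<Longrightarrow> apply_rule u \<iota> x r F \<subseteq> fold (apply_rule u \<iota> x) rs' F"
proof (induction rs' arbitrary: F)
  case (Cons r' rs')
  show ?case
  proof (cases "r = r'")
    case True
    then show ?thesis using fold_apply_incr by simp
  next
    case False
    with Cons have "apply_rule u \<iota> x r (apply_rule u \<iota> x r' F) \<subseteq> fold (apply_rule u \<iota> x) (r' # rs') F"
      by simp
    then show ?thesis using apply_rule_mono[OF apply_rule_incr] by blast
  qed
qed simp

lemma fold_apply_sound:
  "set rs' \<subseteq> set rs \<Longrightarrow> \<forall>i. x i \<le> n \<Longrightarrow> F \<subseteq> W \<Longrightarrow> fold (apply_rule u \<iota> x) rs' F \<subseteq> W"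
proof (induction rs' arbitrary: F)
  case (Cons r rs')
  then have "apply_rule u \<iota> x r F \<subseteq> W" by (intro apply_rule_sound) auto
  from Cons.IH[OF _ Cons.prems(2) this] Cons.prems(1) show ?case by simp
qed simp

abbreviation "sweep_all \<equiv> sweep (apply_all u) n"

lemma apply_all_fold: "apply_all u x F = fold (apply_rule u \<iota> x) rs F"
  by (simp add: apply_all_def length_u \<iota>_def)

lemma foldl_incr: "(\<And>F v. F \<subseteq> g F v) \<Longrightarrow> F \<subseteq> foldl g F vs"
  for g :: "'x set \<Rightarrow> 'y \<Rightarrow> 'x set"
  by (induction vs arbitrary: F) (auto, blast)

lemma sweep_incr: "F \<subseteq> sweep_all j x F"
proof (induction j arbitrary: x F)
  case 0
  show ?case unfolding sweep.simps apply_all_fold by (rule fold_apply_incr)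
next
  case (Suc j)
  then show ?case by (simp only: sweep.simps) (rule foldl_incr)
qed

lemma sweep_sound: "\<forall>i. x i \<le> n \<Longrightarrow> F \<subseteq> W \<Longrightarrow> sweep_all j x F \<subseteq> W"
proof (induction j arbitrary: x F)
  case 0
  then show ?case unfolding sweep.simps apply_all_fold by (simp add: fold_apply_sound)
next
  case (Suc j)
  note IH = Suc.IH
  have "q \<le> Suc n \<Longrightarrow> foldl (\<lambda>F v. sweep_all j (x(j := v)) F) F [0..<q] \<subseteq> W" for q
  proof (induction q)
    case (Suc q)
    then have "\<forall>i. (x(j := q)) i \<le> n" using \<open>\<forall>i. x i \<le> n\<close> by auto
    with IH Suc show ?case by simp
  qed (simp add: \<open>F \<subseteq> W\<close>)
  then show ?case by (simp only: sweep.simps)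
qed

text \<open>The sweep passes the assignment \<open>y\<close> at some moment. The table has not
  shrunk until then, so the rule still fires, and it does not shrink afterwards either.\<close>

lemma sweep_rules:
  "r \<in> set rs \<Longrightarrow> \<forall>i \<ge> j. y i = x i \<Longrightarrow> \<forall>i. y i \<le> n \<Longrightarrow> apply_rule u \<iota> y r F \<subseteq> sweep_all j x F"
proof (induction j arbitrary: x F)
  case 0
  then have "y = x" by auto
  with 0 show ?case unfolding sweep.simps apply_all_fold \<open>y = x\<close> by (intro fold_apply_rules)
next
  case (Suc j)
  let ?g = "\<lambda>F v. sweep_all j (x(j := v)) F"
  let ?F = "foldl ?g F [0..<y j]"
  have split: "[0..<Suc n] = [0..<y j] @ y j # [Suc (y j)..<Suc n]"
  proof -
    from Suc.prems(3) have "y j \<le> n" by simp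
    then have "[0..<Suc n] = [0..<y j] @ [y j..<Suc n]"
      using upt_add_eq_append[of 0 "y j" "Suc n - y j"] by simp
    with \<open>y j \<le> n\<close> show ?thesis by (simp add: upt_conv_Cons)
  qed
  have "apply_rule u \<iota> y r F \<subseteq> apply_rule u \<iota> y r ?F"
    by (intro apply_rule_mono foldl_incr sweep_incr)
  also have "\<dots> \<subseteq> ?g ?F (y j)"
    by (rule Suc.IH) (use Suc.prems in auto)
  also have "\<dots> \<subseteq> foldl ?g (?g ?F (y j)) [Suc (y j)..<Suc n]"
    by (intro foldl_incr sweep_incr)
  also have "\<dots> = sweep_all (Suc j) x F"
    unfolding sweep.simps split by simp
  finally show ?case .
qed

text \<open>A full sweep without effect certifies that the table is closed under all rules.\<close>

lemma closed_W:
  assumes "sweep_all V x F = F" "F \<subseteq> W" "\<forall>i. x i \<le> n"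
  shows "F = W"
proof -
  have "\<iota> a \<in> F" if "a \<in> derives (set rs) u" for a
    using that
  proof (induction rule: derives.induct)
    case (derives cs bs a y)
    \<comment> \<open>\<open>sweep_rules\<close> demands agreement with \<open>x\<close> from
      \<open>V\<close> on; this change cannot be seen by the rule, whose variables are below
      \<open>V\<close>.\<close>
    let ?y = "\<lambda>i. if i < V then y i else x i"
    have inst: "inst ?y b = inst y b" if "b \<in> set (a # bs)" for b
      using wf_atoms[OF derives(1) that] by (auto simp: inst_def)
    have "fires u ?y \<iota> F (cs, bs, a)"
      using derives(1,3,4) wf_conds[OF derives(1)] inst by (auto simp: fires_def)
    then have "\<iota> (inst y a) \<in> apply_rule u \<iota> ?y (cs, bs, a) F"
      using inst[of a] by (simp add: apply_rule_def)
    also have "\<dots> \<subseteq> F"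
      using sweep_rules[OF derives(1), of V ?y x F] assms(1,3) derives(2)
      by (auto simp: length_u less_Suc_eq_le)
    finally show ?case .
  qed
  with assms(2) show ?thesis by auto
qed

text \<open>
  The variables from \<open>V\<close> on do not occur in the rules; looping over them only repeats the
  evaluation of the rules often enough to reach the fixed point.
\<close>
lemma sweep_progress:
  "\<forall>i. x i \<le> n \<Longrightarrow> F \<subseteq> W \<Longrightarrow>
     sweep_all (V + d) x F = W \<or> card F + (n + 1) ^ d \<le> card (sweep_all (V + d) x F)"
proof (induction d arbitrary: x F)
  case 0
  show ?case
  proof (cases "sweep_all V x F = F")
    case True
    with closed_W[OF this 0(2,1)] show ?thesis by simp
  next
    case False
    then have "F \<subset> sweep_all V x F" using sweep_incr by blast
    moreover have "finite (sweep_all V x F)" using sweep_sound[OF 0] W_finite finite_subset by blast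
    ultimately have "card F < card (sweep_all V x F)" by (simp add: psubset_card_mono)
    then show ?thesis by simp
  qed
next
  case (Suc d)
  let ?g = "\<lambda>F v. sweep_all (V + d) (x(V + d := v)) F"
  note progress = Suc.IH
  have "q \<le> n + 1 \<Longrightarrow> foldl ?g F [0..<q] \<subseteq> W \<and>
    (foldl ?g F [0..<q] = W \<or> card F + q * (n + 1) ^ d \<le> card (foldl ?g F [0..<q]))" for q
  proof (induction q)
    case 0
    with Suc.prems show ?case by simp
  next
    case (Suc q)
    let ?F = "foldl ?g F [0..<q]"
    have x: "\<forall>i. (x(V + d := q)) i \<le> n" using Suc.prems(1) \<open>\<forall>i. x i \<le> n\<close> by auto
    from Suc.IH[OF Suc_leD[OF Suc.prems(1)]]
    have F: "?F \<subseteq> W" "?F = W \<or> card F + q * (n + 1) ^ d \<le> card ?F" by blast+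
    have step: "foldl ?g F [0..<Suc q] = ?g ?F q" by simp
    have "?g ?F q = W \<or> card F + Suc q * (n + 1) ^ d \<le> card (?g ?F q)"
    proof (cases "?F = W")
      case True
      with sweep_sound[OF x F(1), of "V + d"] sweep_incr[of ?F "V + d" "x(V + d := q)"]
      show ?thesis by blast
    next
      case False
      with F(2) have "card F + q * (n + 1) ^ d \<le> card ?F" by blast
      with progress[OF x F(1)] show ?thesis unfolding mult_Suc by linarith
    qed
    with sweep_sound[OF x F(1), of "V + d"] show ?case unfolding step by blast
  qed
  from this[of "n + 1"] show ?case unfolding sweep.simps add_Suc_right power_Suc by simp
qed

lemma sweep_eq_W:
  assumes "n \<ge> 1" "\<forall>i. x i \<le> n"
  shows "sweep_all (V + (Suc R + 2 * ar)) x {} = W"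
proof -
  \<comment> \<open>Origin of the number of additional loops: two of them outweigh each argument, as
    \<open>n + 2\<close> is at most \<open>(n + 1) ^ 2\<close>, and \<open>Suc R\<close> further
    ones outweigh the predicates. A table that grew with each of these sweeps would exceed the
    number of addresses.\<close>
  have "Suc R * (n + 2) ^ ar < (n + 1) ^ (Suc R + 2 * ar)"
  proof -
    have "n + 2 \<le> (n + 1) ^ 2" using assms(1) by (simp add: power2_eq_square)
    then have "(n + 2) ^ ar \<le> (n + 1) ^ (2 * ar)" by (metis power_mono power_mult le0)
    moreover have "Suc R < (n + 1) ^ Suc R"
    proof -
      have "Suc R < 2 ^ Suc R" by (rule less_exp)
      also have "\<dots> \<le> (n + 1) ^ Suc R" using assms(1) by (intro power_mono) auto
      finally show ?thesis .
    qed
    ultimately show ?thesis unfolding power_add by (intro mult_less_le_imp_less) auto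
  qed
  then have "\<not> (n + 1) ^ (Suc R + 2 * ar) \<le> card (sweep_all (V + (Suc R + 2 * ar)) x {})"
    using W_card card_mono[OF W_finite sweep_sound[OF assms(2), of "{}" "V + (Suc R + 2 * ar)"]]
    by auto
  with sweep_progress[OF assms(2), of "{}" "Suc R + 2 * ar"] show ?thesis by simp
qed

end


section \<open>Evaluating Datalog on a Turing machine\<close>

text \<open>
  Tape 0 holds the input, tape 1 the table of derived atoms and tape 2 a counter; tape 3 and the
  tapes for the variables, from tape 4 on, hold copies of the input. On all tapes but the first,
  cell 0 carries the end marker 8, so that head positions serve as natural numbers.
\<close>

definition incs :: "nat list \<Rightarrow> com" where
  "incs bs = seqs (map (\<lambda>b. Mv b MoveRight) bs)"

text \<open>With head positions as unary registers, this adds register \<open>a\<close> to all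
  registers in \<open>bs\<close> and clears it; without targets it rewinds the head.\<close>

definition drain :: "nat \<Rightarrow> nat list \<Rightarrow> com" where
  "drain a bs = Until a 8 (Seq (Mv a MoveLeft) (incs bs))"

text \<open>Multiplies register 1 by \<open>n + 2\<close>. Its value is moved to register 2, and for
  each unit tape 3 is traversed: the marker and the \<open>n\<close> letters give
  \<open>n + 1\<close>, and one more move is added.\<close>

definition mul_base :: com where
  "mul_base = Seq (drain 1 [2]) (Until 2 8 (Seq (Mv 2 MoveLeft)
     (Seq (Until 3 0 (Seq (Mv 3 MoveRight) (Mv 1 MoveRight)))
       (Seq (Mv 1 MoveRight) (drain 3 [])))))"

text \<open>Reading a register means draining it, so tape 2 keeps a copy from which the variable is
  restored.\<close>

definition add_var :: "nat \<Rightarrow> com" where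
  "add_var i = Seq (drain (4 + i) [1, 2]) (drain 2 [4 + i])"

definition push_digit :: "nat \<times> nat \<Rightarrow> com" where
  "push_digit = (\<lambda>(i, d). Seq mul_base (Seq (add_var i) (seqs (replicate d (Mv 1 MoveRight)))))"

text \<open>Horner's scheme for the address \<open>pos\<close>, with \<open>Suc p\<close> as leading
  digit.\<close>

definition seek :: "nat \<Rightarrow> (nat \<times> nat) list \<Rightarrow> com" where
  "seek p args = Seq (drain 1 []) (Seq (seqs (replicate (Suc p) (Mv 1 MoveRight)))
     (seqs (map push_digit args)))"

fun check_conds :: "(nat \<times> nat) list \<Rightarrow> com \<Rightarrow> com" where
  "check_conds [] c = c"
| "check_conds ((i, s) # cs) c = IfS (4 + i) s (check_conds cs c) Skip"

fun check_body :: "('p \<Rightarrow> nat) \<Rightarrow> 'p atm list \<Rightarrow> com \<Rightarrow> com" where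
  "check_body e [] c = c"
| "check_body e (b # bs) c = Seq (seek (e (fst b)) (snd b)) (IfS 1 1 (check_body e bs c) Skip)"

definition rule_com :: "('p \<Rightarrow> nat) \<Rightarrow> 'p rule \<Rightarrow> com" where
  "rule_com e = (\<lambda>(cs, bs, a).
     check_conds cs (check_body e bs (Seq (seek (e (fst a)) (snd a)) (Wr 1 1))))"

text \<open>The head of a variable runs from the marker over the letters to the first blank, so the
  variable takes the values 0 to \<open>n\<close>; it is rewound for the next round of the enclosing
  loop.\<close>

fun nest :: "com \<Rightarrow> nat \<Rightarrow> com" where
  "nest c 0 = c"
| "nest c (Suc j) = Seq (Until (4 + j) 0 (Seq (nest c j) (Mv (4 + j) MoveRight))) (drain (4 + j) [])"

definition init :: "nat \<Rightarrow> com" where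
  "init k = seqs [Wr 1 8, Wr 2 8,
     seqs (map (\<lambda>i. Seq (Wr i 8) (Mv i MoveRight)) [3..<k]),
     Until 0 0 (Seq (seqs (map (\<lambda>i. Seq (Cp i 0) (Mv i MoveRight)) [3..<k])) (Mv 0 MoveRight)),
     seqs (map (\<lambda>i. drain i []) [3..<k])]"

text \<open>\<open>B\<close> bounds the addresses: \<open>4 * B\<close> pays for rewinding tape 1,
  \<open>2 * R\<close> for the leading digit, and each of the \<open>ar\<close> digits takes a
  multiplication and an addition.\<close>

definition seek_time :: "nat \<Rightarrow> nat \<Rightarrow> nat \<Rightarrow> nat \<Rightarrow> nat" where
  "seek_time B R ar n = 4 * B + 2 * R + ar * (B * (8 * n + 22) + 14 * n + 12) + 5"

definition rule_time :: "nat \<Rightarrow> 'p rule \<Rightarrow> nat" where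
  "rule_time T r = length (fst r) + length (fst (snd r)) * (T + 2) + T + 2"

fun nest_time :: "nat \<Rightarrow> nat \<Rightarrow> nat \<Rightarrow> nat" where
  "nest_time T n 0 = T"
| "nest_time T n (Suc j) = (n + 1) * (nest_time T n j + 3) + 1 + (4 * (n + 1) + 1) + 1"

definition init_time :: "nat \<Rightarrow> nat \<Rightarrow> nat" where
  "init_time k n = 12 + k * 4 + n * (k * 4 + 5) + k * (4 * n + 6)"

text \<open>Programs act on infinitely many tapes. Those from \<open>k\<close> on get their final
  contents in advance, so that after initialisation one formula describes all tapes.\<close>

definition start_tapes :: "nat \<Rightarrow> nat list \<Rightarrow> nat \<Rightarrow> tape" where
  "start_tapes k w = (\<lambda>i. if i = 0 then input_tape w else if i < k then input_tape []
     else (fst (input_tape (8 # w)), 0))"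

section \<open>Effect and running time in terms of registers and the table\<close>

locale input_word =
  fixes w :: "nat list"
  assumes letters: "set w \<subseteq> {0<..<8}"
begin

abbreviation (input) content :: "nat list \<Rightarrow> int \<Rightarrow> nat" where
  "content v \<equiv> fst (input_tape v)"

definition table :: "nat set \<Rightarrow> int \<Rightarrow> nat" where
  "table F p = (if p = 0 then 8 else if 0 < p \<and> nat p \<in> F then 1 else 0)"

text \<open>After initialisation a state is determined by the table \<open>F\<close> and the head
  positions \<open>P\<close>, since all tapes but tape 1 keep their contents.\<close>

definition tapes :: "nat set \<Rightarrow> (nat \<Rightarrow> nat) \<Rightarrow> nat \<Rightarrow> tape" where
  "tapes F P i = (if i = 0 then content w else if i = 1 then table F
     else if i = 2 then content [8] else content (8 # w), int (P i))"

lemma content_nth: "content v (int p) = (if p < length v then v ! p else 0)"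
  by (simp add: input_tape_def)

lemma nth_letter: "p < length w \<Longrightarrow> 0 < w ! p \<and> w ! p < 8"
  using subsetD[OF letters nth_mem[of p w]] by simp

lemma read_mark: "0 < i \<Longrightarrow> tape_read (tapes F P i) = 8 \<longleftrightarrow> P i = 0"
proof -
  have "(8 # w) ! p = 8 \<longleftrightarrow> p = 0" if "p < Suc (length w)" for p
    using that nth_letter[of "p - 1"] by (cases p) auto
  then show "0 < i \<Longrightarrow> tape_read (tapes F P i) = 8 \<longleftrightarrow> P i = 0"
    by (auto simp: tapes_def table_def content_nth simp del: nth_Cons_0; simp)
qed

lemma read_blank: "3 \<le> i \<Longrightarrow> tape_read (tapes F P i) = 0 \<longleftrightarrow> length w < P i"
proof -
  have "(8 # w) ! p \<noteq> 0" if "p < length (8 # w)" for p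
    using that nth_letter[of "p - 1"] by (cases p) auto
  then show "3 \<le> i \<Longrightarrow> tape_read (tapes F P i) = 0 \<longleftrightarrow> length w < P i"
    by (auto simp: tapes_def content_nth)
qed

lemma read_letter: "3 \<le> i \<Longrightarrow> P i \<le> length w \<Longrightarrow> tape_read (tapes F P i) = (8 # w) ! P i"
  by (auto simp: tapes_def content_nth)

lemma read_table: "0 < P 1 \<Longrightarrow> tape_read (tapes F P 1) = 1 \<longleftrightarrow> P 1 \<in> F"
  by (auto simp: tapes_def table_def)

lemma runs_right: "runs (Mv i MoveRight) (tapes F P) 1 (tapes F (P(i := Suc (P i))))"
proof -
  have "(tapes F P)(i := tape_act (tape_read (tapes F P i), MoveRight) (tapes F P i)) =
    tapes F (P(i := Suc (P i)))" by (auto simp: tapes_def)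
  then show ?thesis using exec_Mv runs_exec by (metis order_refl)
qed

lemma runs_left:
  assumes "0 < P i"
  shows "runs (Mv i MoveLeft) (tapes F P) 1 (tapes F (P(i := P i - 1)))"
proof -
  have "(tapes F P)(i := tape_act (tape_read (tapes F P i), MoveLeft) (tapes F P i)) =
    tapes F (P(i := P i - 1))" using assms by (auto simp: tapes_def)
  then show ?thesis using exec_Mv runs_exec by (metis order_refl)
qed

lemma runs_set:
  assumes "0 < P 1"
  shows "runs (Wr 1 1) (tapes F P) 1 (tapes (insert (P 1) F) P)"
proof -
  have "(table F)(int (P 1) := 1) = table (insert (P 1) F)"
    using assms by (auto simp: table_def fun_eq_iff)
  then have "(tapes F P)(1 := tape_act (1, Stay) (tapes F P 1)) = tapes (insert (P 1) F) P"
    by (auto simp: tapes_def)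
  then show ?thesis using exec_Wr runs_exec by (metis order_refl)
qed

lemma runs_tapes:
  "runs c (tapes F P) T (tapes F' P') \<Longrightarrow> T \<le> T' \<Longrightarrow> P' = P'' \<Longrightarrow> runs c (tapes F P) T' (tapes F' P'')"
  using runs_mono by blast

lemma runs_incs:
  "distinct bs \<Longrightarrow> runs (incs bs) (tapes F P) (2 * length bs + 1)
     (tapes F (\<lambda>i. if i \<in> set bs then Suc (P i) else P i))"
proof (induction bs arbitrary: P)
  case Nil
  show ?case using runs_Skip by (simp add: incs_def)
next
  case (Cons b bs)
  then have "runs (incs bs) (tapes F (P(b := Suc (P b)))) (2 * length bs + 1)
     (tapes F (\<lambda>i. if i \<in> set bs then Suc ((P(b := Suc (P b))) i) else (P(b := Suc (P b))) i))"
    by simp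
  from runs_Seq[OF runs_right this] show ?case
    unfolding incs_def list.map seqs.simps
    by (rule runs_tapes) (use Cons.prems in auto)
qed

lemma runs_drain:
  assumes "0 < a" "a \<notin> set bs" "distinct bs"
  shows "runs (drain a bs) (tapes F P) (P a * (2 * length bs + 4) + 1)
    (tapes F (\<lambda>i. if i = a then 0 else if i \<in> set bs then P i + P a else P i))"
proof -
  define f where "f j = tapes F (\<lambda>i. if i = a then P a - j else if i \<in> set bs then P i + j else P i)"
    for j
  have f0: "f 0 = tapes F P" unfolding f_def by (rule arg_cong[where f = "tapes F"]) auto
  have fe: "f (P a) = tapes F (\<lambda>i. if i = a then 0 else if i \<in> set bs then P i + P a else P i)"
    unfolding f_def by (rule arg_cong[where f = "tapes F"]) auto
  have "runs (drain a bs) (f 0) (P a * ((1 + (2 * length bs + 1) + 1) + 1) + 1) (f (P a))"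
    unfolding drain_def
  proof (rule runs_Until)
    fix j assume j: "j < P a"
    show "tape_read (f j a) \<noteq> 8" unfolding f_def read_mark[OF assms(1)] using j by simp
    show "runs (Seq (Mv a MoveLeft) (incs bs)) (f j) (1 + (2 * length bs + 1) + 1) (f (Suc j))"
      unfolding f_def
      by (rule runs_tapes[OF runs_Seq[OF runs_left runs_incs[OF assms(3)]]])
        (use j assms(2) in \<open>auto simp: fun_eq_iff\<close>)
  next
    show "tape_read (f (P a) a) = 8" unfolding f_def read_mark[OF assms(1)] by simp
  qed
  then show ?thesis unfolding f0 fe by (rule runs_mono) (simp add: algebra_simps)
qed

lemma runs_rewind:
  assumes "0 < a"
  shows "runs (drain a []) (tapes F P) (4 * P a + 1) (tapes F (P(a := 0)))"
  by (rule runs_tapes[OF runs_drain[OF assms]]) (auto simp: fun_eq_iff)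

lemma runs_mul_base:
  assumes "P 2 = 0" "P 3 = 0"
  shows "runs mul_base (tapes F P) (P 1 * (8 * length w + 22) + 3)
    (tapes F (P(1 := P 1 * (length w + 2))))"
proof -
  let ?n = "length w"
  have inner: "runs (Until 3 0 (Seq (Mv 3 MoveRight) (Mv 1 MoveRight))) (tapes F P')
      ((?n + 1) * (1 + 1 + 1 + 1) + 1) (tapes F (P'(1 := P' 1 + (?n + 1), 3 := ?n + 1)))"
    if "P' 3 = 0" for P'
  proof -
    define f where "f j = tapes F (P'(1 := P' 1 + j, 3 := j))" for j
    have f0: "f 0 = tapes F P'" using that unfolding f_def
      by (intro arg_cong[where f = "tapes F"]) auto
    have "runs (Until 3 0 (Seq (Mv 3 MoveRight) (Mv 1 MoveRight))) (f 0)
      ((?n + 1) * (1 + 1 + 1 + 1) + 1) (f (?n + 1))"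
    proof (rule runs_Until)
      fix j assume j: "j < ?n + 1"
      show "tape_read (f j 3) \<noteq> 0" using j by (simp add: f_def read_blank)
      show "runs (Seq (Mv 3 MoveRight) (Mv 1 MoveRight)) (f j) (1 + 1 + 1) (f (Suc j))"
        unfolding f_def
        by (rule runs_tapes[OF runs_Seq[OF runs_right runs_right]]) (auto simp: fun_eq_iff)
    next
      show "tape_read (f (?n + 1) 3) = 0" by (simp add: f_def read_blank)
    qed
    then show ?thesis unfolding f0 unfolding f_def .
  qed
  \<comment> \<open>After \<open>j\<close> rounds \<open>P 1 - j\<close> units remain on tape 2, and
    the others have been multiplied.\<close>
  define f where "f j = tapes F (P(1 := j * (?n + 2), 2 := P 1 - j))" for j
  have fe: "f (P 1) = tapes F (P(1 := P 1 * (?n + 2)))" using assms unfolding f_def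
    by (intro arg_cong[where f = "tapes F"]) auto
  have 1: "runs (drain 1 [2]) (tapes F P) (6 * P 1 + 1) (f 0)" unfolding f_def
    by (rule runs_tapes[OF runs_drain]) (use assms in \<open>auto simp: fun_eq_iff\<close>)
  have 2: "runs (Until 2 8 (Seq (Mv 2 MoveLeft)
     (Seq (Until 3 0 (Seq (Mv 3 MoveRight) (Mv 1 MoveRight)))
       (Seq (Mv 1 MoveRight) (drain 3 []))))) (f 0) (P 1 * ((8 * ?n + 15) + 1) + 1) (f (P 1))"
  proof (rule runs_Until)
    fix j assume j: "j < P 1"
    show "tape_read (f j 2) \<noteq> 8" using j by (simp add: f_def read_mark)
    show "runs (Seq (Mv 2 MoveLeft) (Seq (Until 3 0 (Seq (Mv 3 MoveRight) (Mv 1 MoveRight)))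
       (Seq (Mv 1 MoveRight) (drain 3 [])))) (f j) (8 * ?n + 15) (f (Suc j))"
      unfolding f_def
      by (rule runs_tapes[OF runs_Seq[OF runs_left runs_Seq[OF inner
                runs_Seq[OF runs_right runs_rewind]]]])
        (use j assms in \<open>auto simp: fun_eq_iff\<close>)
  next
    show "tape_read (f (P 1) 2) = 8" by (simp add: f_def read_mark)
  qed
  from runs_Seq[OF 1 2] show ?thesis unfolding mul_base_def fe
    by (rule runs_mono) (simp add: algebra_simps)
qed

lemma runs_add_var:
  assumes "P 2 = 0"
  shows "runs (add_var i) (tapes F P) (14 * P (4 + i) + 3) (tapes F (P(1 := P 1 + P (4 + i))))"
  unfolding add_var_def
  by (rule runs_tapes[OF runs_Seq[OF runs_drain runs_drain]])
    (use assms in \<open>auto simp: fun_eq_iff\<close>)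

lemma runs_incr:
  "runs (seqs (replicate d (Mv 1 MoveRight))) (tapes F P) (2 * d + 1) (tapes F (P(1 := P 1 + d)))"
proof (induction d arbitrary: P)
  case 0
  show ?case using runs_Skip by simp
next
  case (Suc d)
  from runs_Seq[OF runs_right[of 1] Suc] show ?case unfolding replicate_Suc seqs.simps
    by (rule runs_tapes) (auto simp: fun_eq_iff)
qed

lemma runs_push_digit:
  assumes "P 2 = 0" "P 3 = 0"
  shows "runs (push_digit (i, d)) (tapes F P)
    (P 1 * (8 * length w + 22) + 14 * P (4 + i) + 2 * d + 9)
    (tapes F (P(1 := P 1 * (length w + 2) + (P (4 + i) + d))))"
  unfolding push_digit_def prod.case
  by (rule runs_tapes[OF runs_Seq[OF runs_mul_base runs_Seq[OF runs_add_var runs_incr]]])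
    (use assms in \<open>auto simp: fun_eq_iff\<close>)

text \<open>\<open>c\<close> bounds the numeral read so far, and each further digit multiplies this
  bound by the base. So \<open>B\<close> bounds all intermediate values and thereby the cost of
  every multiplication.\<close>

lemma runs_push_digits:
  assumes "P 2 = 0" "P 3 = 0" "\<forall>i. P (4 + i) \<le> length w" "\<forall>(i, d) \<in> set args. d \<le> 1"
    and "P 1 < c" "c * (length w + 2) ^ length args \<le> B"
  shows "runs (seqs (map push_digit args)) (tapes F P)
    (length args * (B * (8 * length w + 22) + 14 * length w + 12) + 1)
    (tapes F (P(1 := foldl (\<lambda>v d. v * (length w + 2) + d) (P 1) (map (\<lambda>(i, d). P (4 + i) + d) args))))"
  using assms
proof (induction args arbitrary: P c)
  case Nil
  show ?case using runs_Skip by simp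
next
  case (Cons a args)
  let ?n = "length w"
  obtain i d where a: "a = (i, d)" by (cases a)
  let ?v = "P 1 * (?n + 2) + (P (4 + i) + d)"
  let ?P = "P(1 := ?v)"
  have id: "P (4 + i) \<le> ?n" "d \<le> 1" using Cons.prems a by auto
  then have "?v < Suc (P 1) * (?n + 2)" by simp
  also have "\<dots> \<le> c * (?n + 2)" using Cons.prems by (intro mult_le_mono1) simp
  finally have v: "?v < c * (?n + 2)" .
  have B: "P 1 \<le> B"
  proof -
    have "P 1 \<le> c * 1" using Cons.prems by simp
    also have "\<dots> \<le> c * (?n + 2) ^ length (a # args)" by (intro mult_le_mono2 one_le_power) simp
    finally show ?thesis using Cons.prems by simp
  qed
  have cB: "c * (?n + 2) * (?n + 2) ^ length args \<le> B"
    using Cons.prems(6) by (simp only: length_Cons power_Suc mult.assoc)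
  have args: "\<forall>(i, d) \<in> set args. d \<le> 1" using Cons.prems(4) by simp
  have "runs (seqs (map push_digit args)) (tapes F ?P)
    (length args * (B * (8 * ?n + 22) + 14 * ?n + 12) + 1)
    (tapes F (?P(1 := foldl (\<lambda>v d. v * (?n + 2) + d) (?P 1) (map (\<lambda>(i, d). ?P (4 + i) + d) args))))"
    by (rule Cons.IH[OF _ _ _ args _ cB]) (use Cons.prems(1-3) v in simp_all)
  from runs_Seq[OF runs_push_digit[OF Cons.prems(1,2), of i d] this]
  show ?case unfolding a list.map seqs.simps
  proof (rule runs_tapes)
    have "P 1 * (8 * ?n + 22) \<le> B * (8 * ?n + 22)" using B by (rule mult_le_mono1)
    then show "P 1 * (8 * ?n + 22) + 14 * P (4 + i) + 2 * d + 9 +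
      (length args * (B * (8 * ?n + 22) + 14 * ?n + 12) + 1) + 1
      \<le> length ((i, d) # args) * (B * (8 * ?n + 22) + 14 * ?n + 12) + 1"
      unfolding length_Cons mult_Suc using id by linarith
  qed (simp add: fun_eq_iff case_prod_beta)
qed

text \<open>The body has to restore all heads; then its effect is a function of the variables and
  the table, which is the form of the argument of \<open>sweep\<close>.\<close>

lemma runs_nest:
  assumes body: "\<And>F P. P 1 = 0 \<Longrightarrow> P 2 = 0 \<Longrightarrow> P 3 = 0 \<Longrightarrow> \<forall>i. P (4 + i) \<le> length w \<Longrightarrow>
      runs c (tapes F P) T (tapes (b (\<lambda>i. P (4 + i)) F) P)"
  shows "P 1 = 0 \<Longrightarrow> P 2 = 0 \<Longrightarrow> P 3 = 0 \<Longrightarrow> \<forall>i. P (4 + i) \<le> length w \<Longrightarrow>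
    \<forall>i < j. P (4 + i) = 0 \<Longrightarrow>
    runs (nest c j) (tapes F P) (nest_time T (length w) j)
      (tapes (sweep b (length w) j (\<lambda>i. P (4 + i)) F) P)"
proof (induction j arbitrary: F P)
  case 0
  then show ?case using body by simp
next
  case (Suc j)
  let ?n = "length w" and ?x = "\<lambda>i. P (4 + i)"
  define G where "G q = foldl (\<lambda>F v. sweep b ?n j (?x(j := v)) F) F [0..<q]" for q
  define f where "f q = tapes (G q) (P(4 + j := q))" for q
  have "P(4 + j := 0) = P" using Suc.prems(5) by (intro ext) auto
  then have f0: "f 0 = tapes F P" by (simp add: f_def G_def)
  have "runs (Until (4 + j) 0 (Seq (nest c j) (Mv (4 + j) MoveRight))) (f 0)
     ((?n + 1) * ((nest_time T ?n j + 1 + 1) + 1) + 1) (f (?n + 1))"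
  proof (rule runs_Until)
    fix q assume q: "q < ?n + 1"
    show "tape_read (f q (4 + j)) \<noteq> 0" using q by (simp add: f_def read_blank)
    have x: "(\<lambda>i. (P(4 + j := q)) (4 + i)) = ?x(j := q)" by (rule ext) auto
    have "runs (nest c j) (tapes (G q) (P(4 + j := q))) (nest_time T ?n j)
      (tapes (sweep b ?n j (\<lambda>i. (P(4 + j := q)) (4 + i)) (G q)) (P(4 + j := q)))"
      by (rule Suc.IH) (use Suc.prems q in auto)
    also have "sweep b ?n j (\<lambda>i. (P(4 + j := q)) (4 + i)) (G q) = G (Suc q)"
      unfolding x by (simp add: G_def)
    finally show "runs (Seq (nest c j) (Mv (4 + j) MoveRight)) (f q) (nest_time T ?n j + 1 + 1) (f (Suc q))"
      unfolding f_def by (rule runs_tapes[OF runs_Seq[OF _ runs_right]]) auto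
  next
    show "tape_read (f (?n + 1) (4 + j)) = 0" by (simp add: f_def read_blank)
  qed
  note loop = this[unfolded f0, unfolded f_def]
  have "sweep b ?n (Suc j) ?x F = G (?n + 1)" by (simp add: G_def)
  then show ?case unfolding nest.simps nest_time.simps
    by (simp only:) (rule runs_tapes[OF runs_Seq[OF loop runs_rewind]],
        use \<open>P(4 + j := 0) = P\<close> in \<open>auto simp: algebra_simps\<close>)
qed

lemma content_snoc: "(content v)(int (length v) := s) = content (v @ [s])"
  by (auto simp: input_tape_def fun_eq_iff nth_append)

lemma content_8: "content [8] = table {}"
  by (auto simp: input_tape_def table_def fun_eq_iff)

lemma runs_init:
  assumes "4 \<le> k"
  shows "runs (init k) (start_tapes k w) (init_time k (length w)) (tapes {} (\<lambda>i. if i = 0 then length w else 0))"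
proof -
  let ?n = "length w"
  let ?s = "start_tapes k w"
  define f where "f j = (\<lambda>i. if i = 0 then (content w, int j) else if i \<in> {1, 2} then (content [8], 0)
    else if i < k then (content (8 # take j w), int (Suc j)) else (content (8 # w), 0))" for j
  have mark: "tape_act (8, Stay) (input_tape []) = (content [8], 0)"
    using content_snoc[of "[]" 8] by (simp add: input_tape_def)
  have 1: "runs (Seq (Wr i 8) (Mv i MoveRight)) \<sigma> 3
      (\<sigma>(i := tape_act (8, MoveRight) (\<sigma> i)))" for \<sigma> i
  proof -
    have "runs (Wr i 8) \<sigma> 1 (\<sigma>(i := tape_act (8, Stay) (\<sigma> i)))"
      by (rule runs_exec[OF exec_Wr]) simp
    from runs_Seq[OF this runs_exec[OF exec_Mv[of i MoveRight] order_refl]] show ?thesis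
      by (cases "\<sigma> i") (simp add: numeral_3_eq_3)
  qed
  have 2: "runs (Seq (Cp i 0) (Mv i MoveRight)) \<sigma> 3
      (\<sigma>(i := tape_act (tape_read (\<sigma> 0), MoveRight) (\<sigma> i)))" for \<sigma> i
  proof -
    have "runs (Cp i 0) \<sigma> 1 (\<sigma>(i := tape_act (tape_read (\<sigma> 0), Stay) (\<sigma> i)))"
      by (rule runs_exec[OF exec_Cp]) simp
    from runs_Seq[OF this runs_exec[OF exec_Mv[of i MoveRight] order_refl]] show ?thesis
      by (cases "\<sigma> i") (simp add: numeral_3_eq_3)
  qed
  have w1: "runs (Wr 1 8) ?s 1 (?s(1 := (content [8], 0)))"
    using runs_exec[OF exec_Wr[of 1 8 ?s] order_refl] assms mark by (simp add: start_tapes_def)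
  have w2: "runs (Wr 2 8) (?s(1 := (content [8], 0))) 1
      (?s(1 := (content [8], 0), 2 := (content [8], 0)))" (is "runs _ _ _ ?s2")
    using runs_exec[OF exec_Wr[of 2 8 "?s(1 := (content [8], 0))"] order_refl] assms mark
    by (simp add: start_tapes_def)
  have w3: "runs (seqs (map (\<lambda>i. Seq (Wr i 8) (Mv i MoveRight)) [3..<k])) ?s2 (length [3..<k] * (3 + 1) + 1) (f 0)"
  proof -
    have "(\<lambda>i. if i \<in> set [3..<k] then tape_act (8, MoveRight) (?s2 i) else ?s2 i) = f 0"
      using mark assms by (auto simp: fun_eq_iff f_def start_tapes_def input_tape_def)
    moreover have "runs (seqs (map (\<lambda>i. Seq (Wr i 8) (Mv i MoveRight)) [3..<k])) ?s2
      (length [3..<k] * (3 + 1) + 1)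
      (\<lambda>i. if i \<in> set [3..<k] then tape_act (8, MoveRight) (?s2 i) else ?s2 i)"
      by (rule runs_seqs_tapes[where g = "\<lambda>_. tape_act (8, MoveRight)"]) (use 1 in auto)
    ultimately show ?thesis by simp
  qed
  have w4: "runs (Until 0 0 (Seq (seqs (map (\<lambda>i. Seq (Cp i 0) (Mv i MoveRight)) [3..<k])) (Mv 0 MoveRight)))
     (f 0) (?n * ((length [3..<k] * (3 + 1) + 1) + 1 + 1 + 1) + 1) (f ?n)"
  proof (rule runs_Until)
    fix j assume j: "j < ?n"
    show "tape_read (f j 0) \<noteq> 0" using j nth_letter[OF j] by (simp add: f_def content_nth)
    let ?g = "\<lambda>i. if i \<in> set [3..<k] then tape_act (tape_read (f j 0), MoveRight) (f j i) else f j i"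
    have c: "runs (seqs (map (\<lambda>i. Seq (Cp i 0) (Mv i MoveRight)) [3..<k])) (f j)
      (length [3..<k] * (3 + 1) + 1) ?g"
      by (rule runs_seqs_tapes[where g = "\<lambda>t. tape_act (tape_read t, MoveRight)"]) (use 2 in auto)
    have "(content (8 # take j w))(int (Suc j) := w ! j) = content (8 # take (Suc j) w)"
      using content_snoc[of "8 # take j w" "w ! j"] j by (simp add: take_Suc_conv_app_nth)
    then have "?g(0 := tape_act (tape_read (?g 0), MoveRight) (?g 0)) = f (Suc j)"
      using j assms by (auto simp: fun_eq_iff f_def content_nth add.commute)
    with runs_Seq[OF c runs_exec[OF exec_Mv[of 0 MoveRight ?g] order_refl]]
    show "runs (Seq (seqs (map (\<lambda>i. Seq (Cp i 0) (Mv i MoveRight)) [3..<k])) (Mv 0 MoveRight)) (f j)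
      ((length [3..<k] * (3 + 1) + 1) + 1 + 1) (f (Suc j))" by simp
  next
    show "tape_read (f ?n 0) = 0" by (simp add: f_def content_nth)
  qed
  \<comment> \<open>Copying leaves the heads of the copies on the first blank, in cell
    \<open>Suc ?n\<close> because of the marker.\<close>
  define P where "P = (\<lambda>i. if i = 0 then ?n else if i < 3 then 0 else if i < k then Suc ?n else 0)"
  have fn: "f ?n = tapes {} P"
    using assms by (auto simp: fun_eq_iff f_def tapes_def P_def content_8)
  have rewind: "distinct is \<Longrightarrow> \<forall>i \<in> set is. 0 < i \<and> P i \<le> Suc ?n \<Longrightarrow>
    runs (seqs (map (\<lambda>i. drain i []) is)) (tapes {} P) (length is * (4 * ?n + 6) + 1)
      (tapes {} (\<lambda>i. if i \<in> set is then 0 else P i))" for "is" P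
  proof (induction "is" arbitrary: P)
    case Nil
    show ?case using runs_Skip by simp
  next
    case (Cons i "is")
    then have rest: "runs (seqs (map (\<lambda>i. drain i []) is)) (tapes {} (P(i := 0))) (length is * (4 * ?n + 6) + 1)
      (tapes {} (\<lambda>j. if j \<in> set is then 0 else (P(i := 0)) j))" by auto
    from Cons.prems have "0 < i" "P i \<le> Suc ?n" by auto
    from runs_Seq[OF runs_rewind[OF this(1)] rest] show ?case
      unfolding list.map seqs.simps
      by (rule runs_tapes) (use \<open>P i \<le> Suc ?n\<close> in \<open>auto simp: fun_eq_iff\<close>)
  qed
  have w5: "runs (seqs (map (\<lambda>i. drain i []) [3..<k])) (f ?n) (length [3..<k] * (4 * ?n + 6) + 1)
    (tapes {} (\<lambda>i. if i = 0 then ?n else 0))"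
    unfolding fn by (rule runs_tapes[OF rewind]) (auto simp: P_def fun_eq_iff)
  show ?thesis
    unfolding init_def seqs.simps
  proof (rule runs_mono[OF runs_Seq[OF w1 runs_Seq[OF w2 runs_Seq[OF w3 runs_Seq[OF w4
              runs_Seq[OF w5 runs_Skip]]]]]])
    have "length [3..<k] \<le> k" by simp
    then have "?n * ((length [3..<k] * (3 + 1) + 1) + 1 + 1 + 1) \<le> ?n * (k * 4 + 5)"
      "length [3..<k] * (4 * ?n + 6) \<le> k * (4 * ?n + 6)" "length [3..<k] * (3 + 1) \<le> k * 4"
      by (intro mult_le_mono; simp)+
    then show "1 + (1 + (length [3..<k] * (3 + 1) + 1 + (?n * ((length [3..<k] * (3 + 1) + 1) + 1 + 1 + 1) + 1 +
      (length [3..<k] * (4 * ?n + 6) + 1 + 1 + 1) + 1) + 1) + 1) + 1 \<le> init_time k ?n"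
      unfolding init_time_def by linarith
  qed
qed

end

section \<open>The decision program and its polynomial running time\<close>

context datalog
begin

definition bound :: "nat \<Rightarrow> nat" where "bound n = Suc R * (n + 2) ^ ar"

text \<open>The final rewind brings the head of tape 1 back, as \<open>runs_nest\<close> requires of
  a loop body.\<close>

definition body :: com where
  "body = Seq (seqs (map (rule_com e) rs)) (drain 1 [])"

definition body_time :: "nat \<Rightarrow> nat" where
  "body_time n = sum_list (map (rule_time (seek_time (bound n) R ar n)) rs) + length rs + 1 +
     (4 * bound n + 1) + 1"

definition loops :: nat where "loops = V + (Suc R + 2 * ar)"

text \<open>After the loops all variable heads are on the marker, so the arguments
  \<open>(0, 0)\<close> denote position 0 and the head of tape 1 ends on the cell of the
  goal.\<close>

definition decide :: "'p \<Rightarrow> com" where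
  "decide goal = Seq (init (4 + loops)) (Seq (nest body loops) (seek (e goal) (replicate ar (0, 0))))"

definition decide_time :: "nat \<Rightarrow> nat" where
  "decide_time n = init_time (4 + loops) n +
     (nest_time (body_time n) n loops + seek_time (bound n) R ar n + 1) + 1"

text \<open>Rules and nesting depth do not depend on the input, so each of a fixed number of loops
  contributes a factor linear in \<open>n\<close>.\<close>

lemma poly_bounded_decide_time: "poly_bounded decide_time"
proof -
  have b: "poly_bounded bound" unfolding bound_def by (intro poly_bounded_intros)
  have s: "poly_bounded (\<lambda>n. seek_time (bound n) R ar n)"
    unfolding seek_time_def by (intro poly_bounded_intros b)
  have "poly_bounded (\<lambda>n. sum_list (map (rule_time (seek_time (bound n) R ar n)) rs'))"
    for rs' :: "'p rule list"
    by (induction rs') (simp_all add: rule_time_def poly_bounded_intros s)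
  then have bt: "poly_bounded body_time"
    unfolding body_time_def by (intro poly_bounded_intros b)
  have "poly_bounded (\<lambda>n. nest_time (body_time n) n j)" for j
    by (induction j) (simp_all only: nest_time.simps poly_bounded_intros bt)
  then show ?thesis unfolding decide_time_def init_time_def by (intro poly_bounded_intros s)
qed

lemma wf_seek:
  assumes "\<forall>(i, d) \<in> set args. 4 + i < k" "4 \<le> k"
  shows "wf_com k 9 (seek p args)"
  using assms
  by (auto simp: seek_def drain_def incs_def wf_seqs push_digit_def mul_base_def add_var_def)

lemma wf_check_body:
  "\<forall>b \<in> set bs. \<forall>(i, d) \<in> set (snd b). 4 + i < k \<Longrightarrow> 4 \<le> k \<Longrightarrow> wf_com k 9 c \<Longrightarrow>
     wf_com k 9 (check_body e bs c)"
  by (induction bs) (auto intro!: wf_seek)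

lemma wf_check_conds:
  "\<forall>(i, s) \<in> set cs. 4 + i < k \<Longrightarrow> wf_com k 9 c \<Longrightarrow> wf_com k 9 (check_conds cs c)"
  by (induction cs) auto

lemma wf_rule_com:
  assumes "r \<in> set rs" "4 + V \<le> k"
  shows "wf_com k 9 (rule_com e r)"
proof -
  obtain cs bs a where r: "r = (cs, bs, a)" by (cases r)
  have all: "\<forall>(i, d) \<in> set (snd b). 4 + i < k" if "b \<in> set (a # bs)" for b
    using wf_atoms[of cs bs a b] that assms r by fastforce
  have "\<forall>b \<in> set bs. \<forall>(i, d) \<in> set (snd b). 4 + i < k"
    by (rule ballI, rule all) (rule list.set_intros)
  moreover have "\<forall>(i, d) \<in> set (snd a). 4 + i < k" by (rule all) (rule list.set_intros)
  moreover have "\<forall>(i, s) \<in> set cs. 4 + i < k"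
    using wf_conds[of cs bs a] assms r by fastforce
  ultimately show ?thesis unfolding rule_com_def r prod.case using assms(2)
    by (intro wf_check_conds wf_check_body) (simp_all add: wf_seek)
qed

lemma wf_nest: "wf_com k 9 c \<Longrightarrow> 4 + j \<le> k \<Longrightarrow> wf_com k 9 (nest c j)"
  by (induction j) (auto simp: drain_def incs_def)

lemma wf_decide: "wf_com (4 + loops) 9 (decide goal)"
proof -
  have "wf_com (4 + loops) 9 (init (4 + loops))"
    by (auto simp: init_def wf_seqs drain_def incs_def)
  moreover have "wf_com (4 + loops) 9 body"
    by (auto simp: body_def wf_seqs drain_def incs_def loops_def intro!: wf_rule_com)
  moreover have "wf_com (4 + loops) 9 (seek (e goal) (replicate ar (0, 0)))"
    by (rule wf_seek) (auto simp: loops_def)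
  ultimately show ?thesis by (simp add: decide_def wf_nest)
qed

end

section \<open>Correctness of the decision program\<close>

locale datalog_machine = datalog_word rs e Ps V ar R w + input_word w
  for rs :: "'p rule list" and e :: "'p \<Rightarrow> nat" and Ps :: "'p set" and V ar R :: nat
    and w :: "nat list"
begin

abbreviation "B \<equiv> bound n"
abbreviation "T_seek \<equiv> seek_time B R ar n"

definition ok :: "'p atm \<Rightarrow> bool" where
  "ok b \<longleftrightarrow> fst b \<in> Ps \<and> length (snd b) = ar \<and> (\<forall>(i, d) \<in> set (snd b). d \<le> 1)"

text \<open>The head of tape 1 is left wherever the last lookup ended; hence the bound instead of 0,
  and the existential \<open>v\<close> in the lemmas on rules. \<open>seek\<close> starts by
  rewinding it.\<close>

definition home :: "(nat \<Rightarrow> nat) \<Rightarrow> bool" where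
  "home P \<longleftrightarrow> P 1 \<le> B \<and> P 2 = 0 \<and> P 3 = 0 \<and> (\<forall>i. P (4 + i) \<le> n)"

abbreviation vars :: "(nat \<Rightarrow> nat) \<Rightarrow> nat \<Rightarrow> nat" where
  "vars P \<equiv> \<lambda>i. P (4 + i)"

lemma home_upd: "home P \<Longrightarrow> v \<le> B \<Longrightarrow> home (P(1 := v))"
  by (auto simp: home_def)

lemma vars_upd: "vars (P(1 := v)) = vars P"
  by auto

lemma runs_seek:
  assumes "home P" "ok b"
  shows "runs (seek (e (fst b)) (snd b)) (tapes F P) T_seek (tapes F (P(1 := \<iota> (inst (vars P) b))))"
proof -
  have e: "e (fst b) < R" using assms(2) e_less by (auto simp: ok_def)
  let ?P = "(P(1 := 0))(1 := (P(1 := 0)) 1 + Suc (e (fst b)))"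
  have digits: "runs (seqs (map push_digit (snd b))) (tapes F ?P)
    (length (snd b) * (B * (8 * length w + 22) + 14 * length w + 12) + 1)
    (tapes F (?P(1 := foldl (\<lambda>v d. v * (length w + 2) + d) (?P 1) (map (\<lambda>(i, d). ?P (4 + i) + d) (snd b)))))"
    by (rule runs_push_digits[where c = "Suc R"])
      (use assms e in \<open>auto simp: bound_def n_def home_def ok_def\<close>)
  show ?thesis unfolding seek_def
    by (rule runs_tapes[OF runs_Seq[OF runs_rewind runs_Seq[OF runs_incr digits]]])
      (use assms e in \<open>auto simp: seek_time_def n_def \<iota>_def pos_def inst_def fun_eq_iff home_def ok_def\<close>)
qed

lemma \<iota>_bounds:
  assumes "home P" "ok b"
  shows "0 < \<iota> (inst (vars P) b)" "\<iota> (inst (vars P) b) \<le> B"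
proof -
  show "0 < \<iota> (inst (vars P) b)"
    unfolding \<iota>_def pos_def by (rule foldl_base_pos) auto
  have "valid (n + 2) (inst (vars P) b)"
  proof -
    have "P (4 + i) + d < n + 2" if "(i, d) \<in> set (snd b)" for i d
    proof -
      have "d \<le> 1" "P (4 + i) \<le> n" using that assms by (auto simp: ok_def home_def)
      then show ?thesis by linarith
    qed
    with assms(2) show ?thesis unfolding valid_def inst_def ok_def by auto
  qed
  from pos_less[OF this] show "\<iota> (inst (vars P) b) \<le> B" by (simp add: \<iota>_def bound_def)
qed

lemma runs_ex:
  "v \<le> B \<Longrightarrow> runs c \<sigma> T (tapes F (P(1 := v))) \<Longrightarrow> T \<le> T' \<Longrightarrow> F = F' \<Longrightarrow>
     \<exists>v \<le> B. runs c \<sigma> T' (tapes F' (P(1 := v)))"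
  using runs_mono by blast

lemma runs_check_body:
  assumes "home P" "\<forall>b \<in> set bs. ok b" "ok a"
  shows "\<exists>v \<le> B. runs (check_body e bs (Seq (seek (e (fst a)) (snd a)) (Wr 1 1))) (tapes F P)
    (length bs * (T_seek + 2) + T_seek + 2)
    (tapes (if \<forall>b \<in> set bs. \<iota> (inst (vars P) b) \<in> F then insert (\<iota> (inst (vars P) a)) F else F)
      (P(1 := v)))"
  using assms
proof (induction bs arbitrary: P)
  case Nil
  let ?v = "\<iota> (inst (vars P) a)"
  have "runs (Wr 1 1) (tapes F (P(1 := ?v))) 1 (tapes (insert ?v F) (P(1 := ?v)))"
    using \<iota>_bounds[OF Nil(1,3)] runs_set[of "P(1 := ?v)" F] by simp
  from runs_Seq[OF runs_seek[OF Nil(1,3)] this] show ?case unfolding check_body.simps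
    by (rule runs_ex[OF \<iota>_bounds(2)[OF Nil(1,3)]]) simp_all
next
  case (Cons b bs)
  let ?v = "\<iota> (inst (vars P) b)" and ?c = "check_body e bs (Seq (seek (e (fst a)) (snd a)) (Wr 1 1))"
  have ok: "ok b" using Cons.prems by simp
  note v = \<iota>_bounds[OF Cons.prems(1) ok]
  let ?s = "tapes F (P(1 := ?v))"
  have read: "tape_read (?s 1) = 1 \<longleftrightarrow> ?v \<in> F"
    using v(1) by (subst read_table) auto
  show ?case
  proof (cases "?v \<in> F")
    case True
    have "\<forall>b \<in> set bs. ok b" using Cons.prems(2) by simp
    from Cons.IH[OF home_upd[OF Cons.prems(1) v(2)] this Cons.prems(3)]
    obtain v' where v': "v' \<le> B" "runs ?c ?s (length bs * (T_seek + 2) + T_seek + 2)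
      (tapes (if \<forall>b \<in> set bs. \<iota> (inst (vars P) b) \<in> F then insert (\<iota> (inst (vars P) a)) F else F)
        (P(1 := v')))" unfolding vars_upd fun_upd_upd by blast
    from runs_IfT[where \<sigma> = ?s and i = 1, OF read[THEN iffD2, OF True] v'(2)]
    have "runs (IfS 1 1 ?c Skip) ?s (length bs * (T_seek + 2) + T_seek + 2 + 1)
      (tapes (if \<forall>b \<in> set bs. \<iota> (inst (vars P) b) \<in> F then insert (\<iota> (inst (vars P) a)) F else F)
        (P(1 := v')))" .
    from runs_Seq[OF runs_seek[OF Cons.prems(1) ok] this]
    show ?thesis unfolding check_body.simps by (rule runs_ex[OF v'(1)]) (use True in auto)
  next
    case False
    with read have "tape_read (?s 1) \<noteq> 1" by simp
    from runs_Seq[OF runs_seek[OF Cons.prems(1) ok]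
        runs_IfF[where \<sigma> = ?s and i = 1, OF this runs_Skip]]
    show ?thesis unfolding check_body.simps by (rule runs_ex[OF v(2)]) (use False in auto)
  qed
qed

lemma runs_check_conds:
  assumes "runs c (tapes F P) T (tapes F' P')" "home P" "1 \<le> T"
  shows "runs (check_conds cs c) (tapes F P) (length cs + T)
    (if \<forall>(i, s) \<in> set cs. u ! vars P i = s then tapes F' P' else tapes F P)"
proof (induction cs)
  case Nil
  show ?case using assms(1) by simp
next
  case (Cons a cs)
  obtain i s where a: "a = (i, s)" by (cases a)
  have read: "tape_read (tapes F P (4 + i)) = u ! vars P i"
    unfolding u_def using assms(2) by (intro read_letter) (auto simp: home_def n_def)
  show ?case
  proof (cases "u ! vars P i = s")
    case True
    with runs_IfT[of "tapes F P" "4 + i" s, OF _ Cons] read show ?thesis by (simp add: a)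
  next
    case False
    with read have "tape_read (tapes F P (4 + i)) \<noteq> s" by simp
    from runs_IfF[where \<sigma> = "tapes F P" and i = "4 + i" and a = "check_conds cs c",
        OF this runs_Skip] False assms(3) show ?thesis
      by (auto simp: a elim!: runs_mono)
  qed
qed

lemma wf_rule_ok: "(cs, bs, a) \<in> set rs \<Longrightarrow> b \<in> set (a # bs) \<Longrightarrow> ok b"
  using wf_atoms[of cs bs a b] by (auto simp: ok_def)

lemma runs_rule:
  assumes "home P" "r \<in> set rs"
  shows "\<exists>v \<le> B. runs (rule_com e r) (tapes F P) (rule_time T_seek r)
    (tapes (apply_rule u \<iota> (vars P) r F) (P(1 := v)))"
proof -
  obtain cs bs a where r: "r = (cs, bs, a)" by (cases r)
  have "\<forall>b \<in> set bs. ok b" "ok a" using wf_rule_ok assms(2) r by auto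
  from runs_check_body[OF assms(1) this, of F] obtain v where v: "v \<le> B"
    "runs (check_body e bs (Seq (seek (e (fst a)) (snd a)) (Wr 1 1))) (tapes F P)
      (length bs * (T_seek + 2) + T_seek + 2)
      (tapes (if \<forall>b \<in> set bs. \<iota> (inst (vars P) b) \<in> F then insert (\<iota> (inst (vars P) a)) F else F)
        (P(1 := v)))" by blast
  define v' where "v' = (if \<forall>(i, s) \<in> set cs. u ! vars P i = s then v else P 1)"
  have "v' \<le> B" using v(1) assms(1) by (simp add: v'_def home_def)
  moreover have "runs (rule_com e r) (tapes F P) (rule_time T_seek r)
    (tapes (apply_rule u \<iota> (vars P) r F) (P(1 := v')))"
    using runs_check_conds[OF v(2) assms(1), of cs]
    by (auto simp: r rule_com_def v'_def apply_rule_def fires_def rule_time_def add.assoc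
        split: if_splits)
  ultimately show ?thesis by blast
qed

lemma runs_rules:
  "home P \<Longrightarrow> set rs' \<subseteq> set rs \<Longrightarrow> \<exists>v \<le> B. runs (seqs (map (rule_com e) rs')) (tapes F P)
    (sum_list (map (rule_time T_seek) rs') + length rs' + 1)
    (tapes (fold (apply_rule u \<iota> (vars P)) rs' F) (P(1 := v)))"
proof (induction rs' arbitrary: F P)
  case Nil
  then show ?case using runs_Skip by (intro exI[of _ "P 1"]) (simp add: home_def)
next
  case (Cons r rs')
  then have "r \<in> set rs" by simp
  from runs_rule[OF Cons.prems(1) this, of F]
  obtain v where v: "v \<le> B" "runs (rule_com e r) (tapes F P) (rule_time T_seek r)
    (tapes (apply_rule u \<iota> (vars P) r F) (P(1 := v)))" by blast
  have "set rs' \<subseteq> set rs" using Cons.prems(2) by simp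
  from Cons.IH[OF home_upd[OF Cons.prems(1) v(1)] this, of "apply_rule u \<iota> (vars P) r F"]
  obtain v' where v': "v' \<le> B" "runs (seqs (map (rule_com e) rs'))
    (tapes (apply_rule u \<iota> (vars P) r F) (P(1 := v)))
    (sum_list (map (rule_time T_seek) rs') + length rs' + 1)
    (tapes (fold (apply_rule u \<iota> (vars P)) rs' (apply_rule u \<iota> (vars P) r F)) (P(1 := v')))"
    unfolding vars_upd fun_upd_upd by blast
  from runs_Seq[OF v(2) v'(2)] show ?case unfolding list.map seqs.simps
    by (rule runs_ex[OF v'(1)]) simp_all
qed

lemma runs_body:
  assumes "home P" "P 1 = 0"
  shows "runs body (tapes F P) (body_time n) (tapes (apply_all u (vars P) F) P)"
proof -
  from runs_rules[OF assms(1) order_refl, of F] obtain v where v: "v \<le> B"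
    "runs (seqs (map (rule_com e) rs)) (tapes F P)
      (sum_list (map (rule_time T_seek) rs) + length rs + 1)
      (tapes (apply_all u (vars P) F) (P(1 := v)))"
    unfolding apply_all_fold by blast
  from runs_Seq[OF v(2) runs_rewind] show ?thesis
    unfolding body_def by (rule runs_tapes) (use v(1) assms(2) in \<open>auto simp: body_time_def\<close>)
qed

lemma runs_decide:
  assumes "goal \<in> Ps" "w \<noteq> []"
  shows "\<exists>\<sigma>. runs (decide goal) (start_tapes (4 + loops) w) (decide_time n) \<sigma> \<and>
    (tape_read (\<sigma> 1) = 1 \<longleftrightarrow> (goal, replicate ar 0) \<in> derives (set rs) u)"
proof -
  let ?P = "\<lambda>i. if i = 0 then length w else 0"
  let ?g = "(goal, replicate ar (0, 0))"
  have home: "home ?P" by (simp add: home_def)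
  have g: "ok ?g" using assms(1) by (auto simp: ok_def)
  have inst: "inst (vars ?P) ?g = (goal, replicate ar 0)" by (simp add: inst_def)
  have loop_body: "runs body (tapes F P) (body_time n) (tapes (apply_all u (vars P) F) P)"
    if "P 1 = 0" "P 2 = 0" "P 3 = 0" "\<forall>i. P (4 + i) \<le> length w" for F P
    using that by (intro runs_body) (simp_all add: home_def n_def)
  have "runs (nest body loops) (tapes {} ?P) (nest_time (body_time n) (length w) loops)
     (tapes (sweep (apply_all u) (length w) loops (vars ?P) {}) ?P)"
    by (rule runs_nest[OF loop_body]) auto
  \<comment> \<open>A nonempty input makes \<open>n\<close> at least 1, as the count of the sweeps
    requires.\<close>
  moreover have "sweep (apply_all u) (length w) loops (vars ?P) {} = W"
    using sweep_eq_W[of "vars ?P"] assms(2) by (simp add: loops_def n_def Suc_le_eq)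
  ultimately have nest: "runs (nest body loops) (tapes {} ?P) (nest_time (body_time n) n loops)
     (tapes W ?P)" by (simp add: n_def)
  have "runs (seek (e goal) (replicate ar (0, 0))) (tapes W ?P) T_seek
      (tapes W (?P(1 := \<iota> (goal, replicate ar 0))))" (is "runs _ _ _ ?\<sigma>")
    using runs_seek[OF home g, of W] unfolding inst fst_conv snd_conv .
  from runs_Seq[OF runs_init[of "4 + loops"] runs_Seq[OF nest this]]
  have "runs (decide goal) (start_tapes (4 + loops) w) (decide_time n) ?\<sigma>"
    unfolding decide_def decide_time_def by (auto simp: n_def elim!: runs_mono)
  moreover have "tape_read (?\<sigma> 1) = 1 \<longleftrightarrow> (goal, replicate ar 0) \<in> derives (set rs) u"
  proof -
    have "tape_read (?\<sigma> 1) = 1 \<longleftrightarrow> \<iota> (goal, replicate ar 0) \<in> W"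
      using \<iota>_bounds(1)[OF home g] unfolding inst by (subst read_table) auto
    moreover have "valid (n + 2) (goal, replicate ar 0)" using assms(1) by (simp add: valid_def)
    ultimately show ?thesis using pos_inj derives_valid by (fastforce simp: \<iota>_def)
  qed
  ultimately show ?thesis by blast
qed

end

text \<open>Tape 1 is the output tape: its head ends on the table cell of the goal, and a 1 found
  there rejects.\<close>

theorem (in datalog) decidable:
  assumes "goal \<in> Ps"
  shows "\<exists>M c d. turing_machine M \<and> tm_symbols M = 9 \<and>
    (\<forall>w. w \<noteq> [] \<longrightarrow> set w \<subseteq> {0<..<8} \<longrightarrow> (\<exists>t \<le> c * length w ^ d + c.
       fst ((tm_step M ^^ t) (tm_init M w)) =
         (if (goal, replicate ar 0) \<in> derives (set rs) (8 # w) then tm_reject M else tm_accept M)))"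
proof -
  have "finite (insert [] (conts (decide goal) []))" using finite_conts by simp
  from ex_bij_betw_finite_nat[OF this] obtain h
    where h: "bij_betw h (insert [] (conts (decide goal) [])) {0..<card (insert [] (conts (decide goal) []))}"
    by blast
  interpret program "decide goal" "4 + loops" 9 1 h
    using h wf_decide by unfold_locales auto
  from poly_bounded_iff_monom[OF poly_bounded_Suc[OF poly_bounded_decide_time]] obtain c d
    where cd: "\<And>n. Suc (decide_time n) \<le> c * n ^ d + c" by blast
  have "\<exists>t \<le> c * length w ^ d + c. fst ((tm_step machine ^^ t) (tm_init machine w)) =
    (if (goal, replicate ar 0) \<in> derives (set rs) (8 # w) then tm_reject machine else tm_accept machine)"
    if w: "w \<noteq> []" "set w \<subseteq> {0<..<8}" for w
  proof -
    interpret w: datalog_machine rs e Ps V ar R w using w(2) by unfold_locales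
    let ?\<sigma> = "start_tapes (4 + loops) w"
    from w.runs_decide[OF assms w(1)] obtain \<sigma> t where t: "exec (decide goal) ?\<sigma> t \<sigma>"
      "t \<le> decide_time (length w)"
      "tape_read (\<sigma> 1) = 1 \<longleftrightarrow> (goal, replicate ar 0) \<in> derives (set rs) (8 # w)"
      unfolding runs_def w.u_def w.n_def by blast
    have "tm_init machine w = (h [decide goal], map ?\<sigma> [0..<4 + loops])"
      unfolding tm_init_def machine_def
      by (auto simp: start_tapes_def nth_Cons' simp del: upt_Suc intro!: nth_equalityI)
    with run[OF t(1)] t(3) have "fst ((tm_step machine ^^ Suc t) (tm_init machine w)) =
      (if (goal, replicate ar 0) \<in> derives (set rs) (8 # w) then tm_reject machine else tm_accept machine)"
      by simp
    moreover have "Suc t \<le> c * length w ^ d + c" using t(2) cd[of "length w"] by simp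
    ultimately show ?thesis by blast
  qed
  moreover have "turing_machine machine" by (rule turing_machine) simp
  moreover have "tm_symbols machine = 9" unfolding machine_def by simp
  ultimately show ?thesis by blast
qed


section \<open>A Datalog program for pumpability\<close>

text \<open>
  States and stack symbols are represented by positions at which their names start. A goal
  \<open>None\<close> is represented by position 0, that is, by the end marker.
\<close>

datatype pred = NextWord | SameWord | InSection nat | TransAt
  | EpsTr bool bool bool | PushTr bool bool bool | PopTr bool bool bool
  | InitialAt | AcceptAt | GenP bool bool bool
  | EdgeP bool bool bool bool bool | ReachP bool bool bool bool bool | Goal

text \<open>Addresses are numerals with a fixed number of digits, so all atoms get four arguments;
  missing ones repeat the first.\<close>

definition at1 :: "pred \<Rightarrow> nat \<times> nat \<Rightarrow> pred atm" where "at1 p a = (p, [a, a, a, a])"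
definition at2 :: "pred \<Rightarrow> nat \<times> nat \<Rightarrow> nat \<times> nat \<Rightarrow> pred atm" where "at2 p a b = (p, [a, b, a, a])"
definition at3 :: "pred \<Rightarrow> nat \<times> nat \<Rightarrow> nat \<times> nat \<Rightarrow> nat \<times> nat \<Rightarrow> pred atm"
  where "at3 p a b c = (p, [a, b, c, a])"
definition at4 :: "pred \<Rightarrow> nat \<times> nat \<Rightarrow> nat \<times> nat \<Rightarrow> nat \<times> nat \<Rightarrow> nat \<times> nat \<Rightarrow> pred atm"
  where "at4 p a b c d = (p, [a, b, c, d])"

lemmas at_defs = at1_def at2_def at3_def at4_def

abbreviation var :: "nat \<Rightarrow> nat \<times> nat" where "var i \<equiv> (i, 0)"
abbreviation succ :: "nat \<Rightarrow> nat \<times> nat" where "succ i \<equiv> (i, 1)"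
abbreviation letter :: "nat \<Rightarrow> letter \<Rightarrow> nat \<times> nat" where "letter i c \<equiv> (i, symbol_of c)"
text \<open>The symbol 8 occurs at position 0 only, so this condition sets the variable to 0, the
  code of \<open>None\<close>.\<close>

abbreviation marker :: "nat \<Rightarrow> nat \<times> nat" where "marker i \<equiv> (i, 8)"

definition word_letters :: "letter set" where "word_letters = - {Comma, Semicolon}"

text \<open>
  A kind \<open>(c, d, b, l)\<close> consists of the flags of the states before and after the transition, its
  mark, and the first letter of its encoded update (followed by a comma).
\<close>
definition kinds :: "(bool \<times> bool \<times> bool \<times> letter) set" where
  "kinds = {(False, False, False, Comma), (True, True, False, Comma), (False, True, True, Digit1),
     (True, True, True, Digit1), (True, True, False, MinusSign)}"

section \<open>Rules that read the encoding\<close>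

definition next_end :: "pred rule" where
  "next_end = ([letter 0 Comma], [], at2 NextWord (var 0) (succ 0))"
definition next_letter :: "letter \<Rightarrow> pred rule" where
  "next_letter c = ([letter 0 c], [at2 NextWord (succ 0) (var 1)], at2 NextWord (var 0) (var 1))"
definition same_end :: "pred rule" where
  "same_end = ([letter 0 Comma, letter 1 Comma], [], at2 SameWord (var 0) (var 1))"
definition same_letter :: "letter \<Rightarrow> pred rule" where
  "same_letter c = ([letter 0 c, letter 1 c], [at2 SameWord (succ 0) (succ 1)],
     at2 SameWord (var 0) (var 1))"
definition section_start :: "pred rule" where
  "section_start = ([marker 0], [], at1 (InSection 0) (succ 0))"
definition section_letter :: "letter \<Rightarrow> nat \<Rightarrow> pred rule" where
  "section_letter c m = ([letter 0 c], [at1 (InSection m) (var 0)], at1 (InSection m) (succ 0))"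
definition section_end :: "nat \<Rightarrow> pred rule" where
  "section_end m = ([letter 0 Semicolon], [at1 (InSection m) (var 0)],
     at1 (InSection (Suc m)) (succ 0))"
definition trans_first :: "pred rule" where
  "trans_first = ([letter 0 Semicolon], [at1 (InSection 1) (var 0)], at1 TransAt (succ 0))"
definition trans_next :: "pred rule" where
  "trans_next = ([], [at1 TransAt (var 0), at2 NextWord (var 0) (var 1),
     at2 NextWord (var 1) (var 2), at2 NextWord (var 2) (var 3), at2 NextWord (var 3) (var 4)],
     at1 TransAt (var 4))"
text \<open>For unit updates the first letter of the third word settles the update, and a comma
  right at the fourth word means an empty stack operation. Variables 4 and 5 are arbitrary
  occurrences of the two names, so that transitions can be joined although each entry spells its
  states anew.\<close>

definition eps_rule :: "bool \<Rightarrow> bool \<Rightarrow> bool \<Rightarrow> letter \<Rightarrow> pred rule" where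
  "eps_rule c d b z = ([letter 2 z, letter 3 Comma], [at1 TransAt (var 0),
     at2 NextWord (var 0) (var 1), at2 NextWord (var 1) (var 2), at2 NextWord (var 2) (var 3),
     at2 SameWord (var 4) (var 0), at2 SameWord (var 5) (var 1)],
     at2 (EpsTr c d b) (var 4) (var 5))"
definition stack_rule ::
  "(bool \<Rightarrow> bool \<Rightarrow> bool \<Rightarrow> pred) \<Rightarrow> letter \<Rightarrow> bool \<Rightarrow> bool \<Rightarrow> bool \<Rightarrow> letter \<Rightarrow> pred rule" where
  "stack_rule p l c d b z = ([letter 2 z, letter 3 l], [at1 TransAt (var 0),
     at2 NextWord (var 0) (var 1), at2 NextWord (var 1) (var 2), at2 NextWord (var 2) (var 3),
     at2 SameWord (var 4) (var 0), at2 SameWord (var 5) (var 1), at2 SameWord (var 6) (succ 3)],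
     at3 (p c d b) (var 4) (var 5) (var 6))"
text \<open>A semicolon with two others before it ends the transitions; the first word behind it is
  the bottom symbol and is skipped.\<close>

definition initial_rule :: "pred rule" where
  "initial_rule = ([letter 0 Semicolon], [at1 (InSection 2) (var 0),
     at2 NextWord (succ 0) (var 1), at2 SameWord (var 2) (var 1)], at1 InitialAt (var 2))"
definition accept_rule :: "pred rule" where
  "accept_rule = ([letter 0 Semicolon], [at1 (InSection 2) (var 0),
     at2 NextWord (succ 0) (var 1), at2 NextWord (var 1) (var 2), at2 SameWord (var 3) (var 2)],
     at1 AcceptAt (var 3))"

section \<open>Rules for the grammar, its graph and the goal\<close>

text \<open>\<open>SameWord\<close> is derivable at positive positions only, so the body excludes
  position 0, which as a goal would mean \<open>None\<close>.\<close>

definition gen_refl_rule :: "bool \<Rightarrow> pred rule" where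
  "gen_refl_rule c = ([], [at2 SameWord (var 0) (var 0)], at2 (GenP False c c) (var 0) (var 0))"
definition gen_fin_rule :: "bool \<Rightarrow> pred rule" where
  "gen_fin_rule c = ([marker 1], [at1 AcceptAt (var 0)], at2 (GenP False c False) (var 0) (var 1))"
definition gen_eps_rule :: "bool \<Rightarrow> bool \<Rightarrow> bool \<Rightarrow> bool \<Rightarrow> bool \<Rightarrow> pred rule" where
  "gen_eps_rule b g c d k = ([], [at2 (EpsTr c d b) (var 0) (var 1), at2 (GenP g d k) (var 1) (var 2)],
     at2 (GenP (b \<or> g) c k) (var 0) (var 2))"
definition gen_push_rule :: "bool \<Rightarrow> bool \<Rightarrow> bool \<Rightarrow> bool \<Rightarrow> bool \<Rightarrow> pred rule" where
  "gen_push_rule b g c d k = ([marker 2],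
     [at3 (PushTr c d b) (var 0) (var 1) (var 3), at2 (GenP g d k) (var 1) (var 2)],
     at2 (GenP (b \<or> g) c k) (var 0) (var 2))"
definition match_body ::
  "bool \<Rightarrow> bool \<Rightarrow> bool \<Rightarrow> bool \<Rightarrow> bool \<Rightarrow> bool \<Rightarrow> bool \<Rightarrow> bool \<Rightarrow> bool \<Rightarrow> pred atm list" where
  "match_body b g b' h c d d' e k = [at3 (PushTr c d b) (var 0) (var 2) (var 4),
     at2 (GenP g d d') (var 2) (var 3), at3 (PopTr d' e b') (var 3) (var 5) (var 4),
     at2 (GenP h e k) (var 5) (var 1)]"
definition gen_match_rule ::
  "bool \<Rightarrow> bool \<Rightarrow> bool \<Rightarrow> bool \<Rightarrow> bool \<Rightarrow> bool \<Rightarrow> bool \<Rightarrow> bool \<Rightarrow> bool \<Rightarrow> pred rule" where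
  "gen_match_rule b g b' h c d d' e k = ([], match_body b g b' h c d d' e k,
     at2 (GenP (b \<or> g \<or> b' \<or> h) c k) (var 0) (var 1))"
definition edge_eps_rule :: "bool \<Rightarrow> bool \<Rightarrow> bool \<Rightarrow> bool \<Rightarrow> bool \<Rightarrow> pred rule" where
  "edge_eps_rule b g c d k = ([], [at2 (EpsTr c d b) (var 0) (var 2), at2 (GenP g d k) (var 2) (var 1)],
     at4 (EdgeP b c k d k) (var 0) (var 1) (var 2) (var 1))"
definition edge_push_rule :: "bool \<Rightarrow> bool \<Rightarrow> bool \<Rightarrow> bool \<Rightarrow> bool \<Rightarrow> pred rule" where
  "edge_push_rule b g c d k = ([marker 1],
     [at3 (PushTr c d b) (var 0) (var 2) (var 3), at2 (GenP g d k) (var 2) (var 1)],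
     at4 (EdgeP b c k d k) (var 0) (var 1) (var 2) (var 1))"
definition edge_inner_rule ::
  "bool \<Rightarrow> bool \<Rightarrow> bool \<Rightarrow> bool \<Rightarrow> bool \<Rightarrow> bool \<Rightarrow> bool \<Rightarrow> bool \<Rightarrow> bool \<Rightarrow> pred rule" where
  "edge_inner_rule b g b' h c d d' e k = ([], match_body b g b' h c d d' e k,
     at4 (EdgeP (b \<or> b' \<or> h) c k d d') (var 0) (var 1) (var 2) (var 3))"
definition edge_after_rule ::
  "bool \<Rightarrow> bool \<Rightarrow> bool \<Rightarrow> bool \<Rightarrow> bool \<Rightarrow> bool \<Rightarrow> bool \<Rightarrow> bool \<Rightarrow> bool \<Rightarrow> pred rule" where
  "edge_after_rule b g b' h c d d' e k = ([], match_body b g b' h c d d' e k,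
     at4 (EdgeP (b \<or> b' \<or> g) c k e k) (var 0) (var 1) (var 5) (var 1))"
text \<open>Head variables range over all positions, so every conceivable node gets its empty
  walk.\<close>

definition reach_refl_rule :: "bool \<Rightarrow> bool \<Rightarrow> pred rule" where
  "reach_refl_rule c k = ([], [], at4 (ReachP False c k c k) (var 0) (var 1) (var 0) (var 1))"
definition reach_step_rule ::
  "bool \<Rightarrow> bool \<Rightarrow> bool \<Rightarrow> bool \<Rightarrow> bool \<Rightarrow> bool \<Rightarrow> bool \<Rightarrow> bool \<Rightarrow> pred rule" where
  "reach_step_rule f g c k d l d' l' = ([],
     [at4 (ReachP f c k d l) (var 0) (var 1) (var 2) (var 3),
      at4 (EdgeP g d l d' l') (var 2) (var 3) (var 4) (var 5)],
     at4 (ReachP (f \<or> g) c k d' l') (var 0) (var 1) (var 4) (var 5))"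
definition goal_rule :: "bool \<Rightarrow> bool \<Rightarrow> bool \<Rightarrow> pred rule" where
  "goal_rule f d l = ([marker 1], [at1 InitialAt (var 0),
     at4 (ReachP f False False d l) (var 0) (var 1) (var 2) (var 3),
     at4 (ReachP True d l d l) (var 2) (var 3) (var 2) (var 3)], at1 Goal (var 1))"

definition prog_words :: "pred rule set" where
  "prog_words = {next_end, same_end, section_start, trans_first, trans_next, initial_rule, accept_rule} \<union>
     (\<Union>c \<in> word_letters. {next_letter c, same_letter c}) \<union>
     (\<Union>c \<in> - {Semicolon}. \<Union>m \<in> {..3}. {section_letter c m}) \<union> (\<Union>m \<in> {..2}. {section_end m})"

definition prog_trans :: "pred rule set" where
  "prog_trans = (\<Union>(c, d, b, z) \<in> kinds. {eps_rule c d b z,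
     stack_rule PushTr PushSign c d b z, stack_rule PopTr PopSign c d b z})"

definition prog_gen :: "pred rule set" where
  "prog_gen = range gen_refl_rule \<union> range gen_fin_rule \<union>
     (\<Union>b g c d k. {gen_eps_rule b g c d k, gen_push_rule b g c d k,
        edge_eps_rule b g c d k, edge_push_rule b g c d k}) \<union>
     (\<Union>b g b' h c d d' e k. {gen_match_rule b g b' h c d d' e k,
        edge_inner_rule b g b' h c d d' e k, edge_after_rule b g b' h c d d' e k})"

definition prog_reach :: "pred rule set" where
  "prog_reach = (\<Union>c k. {reach_refl_rule c k}) \<union>
     (\<Union>f g c k d l d' l'. {reach_step_rule f g c k d l d' l'}) \<union> (\<Union>f d l. {goal_rule f d l})"

definition prog :: "pred rule set" where
  "prog = prog_words \<union> prog_trans \<union> prog_gen \<union> prog_reach"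

lemmas rule_defs = next_end_def next_letter_def same_end_def same_letter_def section_start_def
  section_letter_def section_end_def trans_first_def trans_next_def eps_rule_def stack_rule_def
  initial_rule_def accept_rule_def gen_refl_rule_def gen_fin_rule_def gen_eps_rule_def
  gen_push_rule_def match_body_def gen_match_rule_def edge_eps_rule_def edge_push_rule_def
  edge_inner_rule_def edge_after_rule_def reach_refl_rule_def reach_step_rule_def goal_rule_def

section \<open>The program is finite and well-formed\<close>

lemma finite_letters: "finite (X :: letter set)"
proof -
  have "(UNIV :: letter set) =
    {Digit0, Digit1, MinusSign, PushSign, PopSign, Comma, Semicolon}"
    using letter.exhaust by blast
  then have "finite (UNIV :: letter set)" by (metis finite.emptyI finite.insertI)
  then show ?thesis by (rule finite_subset[OF subset_UNIV])
qed

lemma finite_prog: "finite prog"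
  unfolding prog_def prog_words_def prog_trans_def prog_gen_def prog_reach_def kinds_def
  by (simp add: finite_letters)

definition wf_rule :: "pred rule \<Rightarrow> bool" where
  "wf_rule r \<longleftrightarrow> (\<forall>(i, s) \<in> set (fst r). i < 7) \<and>
     (\<forall>b \<in> set (snd (snd r) # fst (snd r)). length (snd b) = 4 \<and>
        (\<forall>(i, d) \<in> set (snd b). i < 7 \<and> d \<le> 1))"

lemma wf_prog: "r \<in> prog \<Longrightarrow> wf_rule r"
proof -
  have "\<forall>r \<in> prog_words. wf_rule r" "\<forall>r \<in> prog_trans. wf_rule r"
    "\<forall>r \<in> prog_reach. wf_rule r"
    unfolding prog_words_def prog_trans_def prog_reach_def kinds_def
    by (auto simp: wf_rule_def rule_defs at_defs)
  moreover have "\<forall>r \<in> prog_gen. wf_rule r"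
    unfolding prog_gen_def by (auto simp: wf_rule_def rule_defs at_defs)
  ultimately show "r \<in> prog \<Longrightarrow> wf_rule r" unfolding prog_def by blast
qed

lemma pumpable_machine:
  "\<exists>M c d. turing_machine M \<and> tm_symbols M = 9 \<and>
    (\<forall>w. w \<noteq> [] \<longrightarrow> set w \<subseteq> {0<..<8} \<longrightarrow> (\<exists>t \<le> c * length w ^ d + c.
       fst ((tm_step M ^^ t) (tm_init M w)) =
         (if (Goal, [0, 0, 0, 0]) \<in> derives prog (8 # w) then tm_reject M else tm_accept M)))"
proof -
  obtain rs where rs: "set rs = prog" using finite_list[OF finite_prog] by blast
  \<comment> \<open>The type \<open>pred\<close> is infinite because of \<open>InSection\<close>, so
    only the predicates of the program are numbered.\<close>
  define Ps where "Ps = insert Goal (\<Union>r \<in> prog. fst ` set (snd (snd r) # fst (snd r)))"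
  have "finite Ps" using finite_prog by (simp add: Ps_def)
  from finite_imp_inj_to_nat_seg[OF this] obtain e R where e: "e ` Ps = {i. i < (R::nat)}" "inj_on e Ps"
    by blast
  interpret datalog rs e Ps 7 4 R
  proof
    show "i < 7" if "(cs, bs, a) \<in> set rs" "(i, s) \<in> set cs" for cs bs a i s
      using wf_prog[of "(cs, bs, a)"] that rs unfolding wf_rule_def by auto
    show "fst b \<in> Ps \<and> length (snd b) = 4 \<and> (\<forall>(i, d) \<in> set (snd b). i < 7 \<and> d \<le> 1)"
      if "(cs, bs, a) \<in> set rs" "b \<in> set (a # bs)" for cs bs a b
    proof -
      have r: "(cs, bs, a) \<in> prog" using that rs by simp
      then have "fst b \<in> Ps" unfolding Ps_def using that(2) by force
      with wf_prog[OF r] that(2) show ?thesis unfolding wf_rule_def fst_conv snd_conv by blast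
    qed
  qed (use e in auto)
  have "Goal \<in> Ps" by (simp add: Ps_def)
  from decidable[OF this] show ?thesis unfolding rs by (simp add: numeral_eq_Suc)
qed


section \<open>Correctness of the Datalog program\<close>

lemma inj_bin: "inj bin"
proof (rule injI)
  fix m n :: nat
  show "bin m = bin n \<Longrightarrow> m = n"
  proof (induction m arbitrary: n rule: less_induct)
    case (less m)
    show ?case
    proof (cases "m = 0 \<or> n = 0")
      case True
      then show ?thesis using less.prems by (subst (asm) (1 2) bin.simps) (auto split: if_splits)
    next
      case False
      then have "bin (m div 2) = bin (n div 2)" "odd m = odd n"
        using less.prems by (subst (asm) (1 2) bin.simps; auto split: if_splits)+
      with less.IH[of "m div 2" "n div 2"] False have "m div 2 = n div 2" by simp
      with \<open>odd m = odd n\<close> show ?thesis by (metis div_mult_mod_eq odd_iff_mod_2_eq_one even_iff_mod_2_eq_zero)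
    qed
  qed
qed

section \<open>Unique readability of the encoding\<close>

definition word :: "letter list \<Rightarrow> bool" where "word v \<longleftrightarrow> set v \<subseteq> word_letters"

lemma word_bin: "word (bin n)"
proof (induction n rule: less_induct)
  case (less n)
  then show ?case by (subst bin.simps) (auto simp: word_def word_letters_def)
qed

lemma word_enc_int: "word (enc_int z)"
  using word_bin by (auto simp: enc_int_def word_def word_letters_def)

lemma word_enc_op: "word (enc_op op)"
  using word_bin by (cases op) (auto simp: word_def word_letters_def)

lemmas word_intros = word_bin word_enc_int word_enc_op

text \<open>Words contain no comma, so the first comma ends them.\<close>

lemma word_split:
  "word v \<Longrightarrow> word v' \<Longrightarrow> v @ Comma # r = v' @ Comma # r' \<Longrightarrow> v = v' \<and> r = r'"
proof (induction v arbitrary: v')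
  case Nil
  then show ?case by (cases v') (auto simp: word_def word_letters_def)
next
  case (Cons c v)
  then show ?case by (cases v') (auto simp: word_def word_letters_def)
qed

lemma items_Cons: "items (v # vs) = v @ Comma # items vs"
  by (simp add: items_def)

lemma items_Nil: "items [] = []"
  by (simp add: items_def)

lemma items_split: "v \<in> set vs \<Longrightarrow> \<exists>a b. items vs = a @ v @ Comma # b"
proof (induction vs)
  case (Cons x vs)
  show ?case
  proof (cases "v = x")
    case True
    then show ?thesis by (metis append_Nil items_Cons)
  next
    case False
    with Cons obtain a b where "items vs = a @ v @ Comma # b" by auto
    then have "items (x # vs) = (x @ Comma # a) @ v @ Comma # b" by (simp add: items_Cons)
    then show ?thesis by blast
  qed
qed simp

text \<open>A semicolon is identified by the number of those before it, which is how
  \<open>InSection\<close> locates the sections.\<close>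

lemma count_semicolon_split:
  "p @ Semicolon # r = p' @ Semicolon # r' \<Longrightarrow> count_list p Semicolon = count_list p' Semicolon \<Longrightarrow> r = r'"
proof (induction p arbitrary: p')
  case Nil
  then show ?case by (cases p') auto
next
  case (Cons c p)
  then show ?case by (cases p') (auto split: if_splits)
qed

lemma count_word: "word v \<Longrightarrow> count_list v Semicolon = 0"
  by (auto simp: word_def word_letters_def count_list_0_iff)

lemma count_items: "\<forall>v \<in> set vs. word v \<Longrightarrow> count_list (items vs) Semicolon = 0"
  by (induction vs) (auto simp: items_Cons items_Nil count_word)

lemma count_enc_trans: "count_list (enc_trans A x) Semicolon = 0"
  by (auto simp: enc_trans_def count_items word_intros split: prod.split option.split)

lemma count_concat_enc_trans: "count_list (concat (map (enc_trans A) ps)) Semicolon = 0"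
  by (induction ps) (auto simp: count_enc_trans)

lemma inj_symbol_of: "symbol_of c = symbol_of d \<longleftrightarrow> c = d"
  by (cases c; cases d) auto

lemma symbol_of_bounds: "0 < symbol_of c" "symbol_of c < 8"
  by (cases c; simp)+

lemma enc_int_unit: "enc_int 0 = []" "enc_int 1 = [Digit1]" "enc_int (-1) = [MinusSign, Digit1]"
  by (simp_all add: enc_int_def bin.simps)

section \<open>Positions, words and names in the encoding\<close>

locale encoded = unit_c1pvass A for A :: "(nat, nat) c1pvass"
begin

definition L :: "letter list" where "L = encode A"
definition n :: nat where "n = length L"
definition u :: "nat list" where "u = 8 # map symbol_of L"
text \<open>Positions refer to \<open>u\<close>, where the marker shifts the letters by one.
  Subtraction is truncated, so \<open>suf 0\<close> equals \<open>suf 1\<close>; hence the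
  conditions \<open>1 \<le> i\<close> in what follows.\<close>

definition suf :: "nat \<Rightarrow> letter list" where "suf i = drop (i - 1) L"
definition tail :: "letter list" where
  "tail = bin (bottom A) @ Comma # bin (initial A) @ Comma # bin (accepting A) @ [Comma]"
definition sec0 where "sec0 = items (map bin (sorted_list_of_set (states A)))"
definition sec1 where "sec1 = items (map bin (sorted_list_of_set (stack_syms A)))"
definition trans_list where
  "trans_list = List.product (sorted_list_of_set (states A)) (sorted_list_of_set (states A))"
abbreviation enc_list where "enc_list ps \<equiv> concat (map (enc_trans A) ps)"

lemma L_split: "L = sec0 @ Semicolon # sec1 @ Semicolon # enc_list trans_list @ Semicolon # tail"
  by (simp add: L_def encode_def Let_def sec0_def sec1_def trans_list_def tail_def items_Cons items_Nil)

lemma count_secs: "count_list sec0 Semicolon = 0" "count_list sec1 Semicolon = 0"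
  "count_list (enc_list ps) Semicolon = 0"
  by (auto simp: sec0_def sec1_def count_items word_bin count_concat_enc_trans)

lemma length_u: "length u = Suc n"
  by (simp add: u_def n_def)

lemma letter_suf:
  assumes "i \<le> n" "u ! i = symbol_of c"
  shows "1 \<le> i" "suf i = c # suf (Suc i)"
proof -
  from assms(2) symbol_of_bounds(2)[of c] have "i \<noteq> 0" by (auto simp: u_def intro: gr0I)
  then obtain k where k: "i = Suc k" using not0_implies_Suc by blast
  with assms have "L ! k = c" by (simp add: u_def n_def inj_symbol_of)
  with k assms(1) show "1 \<le> i" "suf i = c # suf (Suc i)"
    using Cons_nth_drop_Suc[of k L] by (auto simp: suf_def n_def)
qed

lemma suf_letter:
  assumes "1 \<le> i" "suf i = c # r"
  shows "i \<le> n" "u ! i = symbol_of c" "suf (Suc i) = r"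
proof -
  obtain k where k: "i = Suc k" using assms(1) by (cases i) auto
  then have "k < length L" using assms(2) by (metis diff_Suc_1 drop_all not_le list.discI suf_def)
  with k assms(2) show "i \<le> n" "u ! i = symbol_of c" "suf (Suc i) = r"
    using Cons_nth_drop_Suc[of k L] by (auto simp: suf_def n_def u_def)
qed

lemma marker_iff: "i \<le> n \<Longrightarrow> u ! i = 8 \<longleftrightarrow> i = 0"
  using symbol_of_bounds(2)[of "L ! (i - 1)"] by (cases i) (auto simp: u_def n_def)

lemma suf_add:
  assumes "1 \<le> i" "suf i = v @ r"
  shows "suf (i + length v) = r"
proof -
  from assms(1) obtain k where "i = Suc k" by (cases i) auto
  with arg_cong[OF assms(2), of "drop (length v)"] show ?thesis by (simp add: suf_def add.commute)
qed

lemma suf_append: "L = a @ b \<Longrightarrow> suf (Suc (length a)) = b"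
  by (simp add: suf_def)

lemma take_suf:
  assumes "1 \<le> i" "suf i = c # r"
  shows "take i L = take (i - 1) L @ [c]"
proof -
  from assms(1) obtain k where k: "i = Suc k" by (cases i) auto
  with assms(2) have "k < length L" by (metis diff_Suc_1 drop_all not_le list.discI suf_def)
  moreover from this have "L ! k = c" using assms(2) k Cons_nth_drop_Suc[of k L] by (simp add: suf_def)
  ultimately show ?thesis using k by (simp add: take_Suc_conv_app_nth)
qed

definition first_word :: "nat \<Rightarrow> letter list" where
  "first_word i = takeWhile (\<lambda>c. c \<in> word_letters) (suf i)"

definition name :: "nat \<Rightarrow> nat" where "name i = inv bin (first_word i)"

definition next_word :: "nat \<Rightarrow> nat \<Rightarrow> bool" where
  "next_word i j \<longleftrightarrow> 1 \<le> i \<and> 1 \<le> j \<and> (\<exists>v. word v \<and> suf i = v @ Comma # suf j)"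

definition same_word :: "nat \<Rightarrow> nat \<Rightarrow> bool" where
  "same_word i j \<longleftrightarrow> 1 \<le> i \<and> 1 \<le> j \<and> first_word i = first_word j"

text \<open>The pairs \<open>ps\<close> are arbitrary: every nonempty entry describes a defined
  transition, wherever it stands in the list.\<close>

definition trans_at :: "nat \<Rightarrow> bool" where
  "trans_at i \<longleftrightarrow> 1 \<le> i \<and> (\<exists>ps. suf i = enc_list ps @ Semicolon # tail)"

definition goal_node :: "nat \<Rightarrow> bool \<Rightarrow> (nat \<times> bool) option" where
  "goal_node i c = (if i = 0 then None else Some (name i, c))"

lemma first_word: "word v \<Longrightarrow> suf i = v @ Comma # r \<Longrightarrow> first_word i = v"
  by (auto simp: first_word_def word_def word_letters_def takeWhile_append2 subset_iff takeWhile_tail)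

lemma name_bin: "suf i = bin p @ Comma # r \<Longrightarrow> name i = p"
  unfolding name_def by (subst first_word[OF word_bin]) (auto simp: inj_bin)

lemma next_word_suf: "next_word i j \<Longrightarrow> word v \<Longrightarrow> suf i = v @ Comma # r \<Longrightarrow> suf j = r"
  using word_split unfolding next_word_def by metis

lemma same_word_name: "same_word i j \<Longrightarrow> name i = name j"
  by (simp add: same_word_def name_def)

text \<open>Undefined pairs are encoded by nothing and the section ends with a semicolon, so a word
  followed by a comma can only open the entry of a defined transition.\<close>

lemma enc_list_word:
  "enc_list ps @ Semicolon # t = v @ Comma # r \<Longrightarrow> word v \<Longrightarrow>
    \<exists>p q z op ps'. delta A (p, q) = Some (z, op) \<and>
      enc_list ps @ Semicolon # t = bin p @ Comma # bin q @ Comma # enc_int z @ Comma #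
        enc_op op @ Comma # enc_list ps' @ Semicolon # t"
proof (induction ps)
  case Nil
  then show ?case by (cases v) (auto simp: word_def word_letters_def)
next
  case (Cons x ps)
  obtain p q where x: "x = (p, q)" by (cases x)
  show ?case
  proof (cases "delta A (p, q)")
    case None
    with Cons x show ?thesis by (simp add: enc_trans_def)
  next
    case (Some y)
    obtain z op where "y = (z, op)" by (cases y)
    with Some show ?thesis
      by (intro exI[of _ p] exI[of _ q] exI[of _ z] exI[of _ op] exI[of _ ps])
        (simp add: x enc_trans_def items_Cons items_Nil)
  qed
qed

lemma trans_at_entry:
  assumes "trans_at i0" "next_word i0 i1" "next_word i1 i2" "next_word i2 i3"
  shows "\<exists>p q z op ps. delta A (p, q) = Some (z, op) \<and> name i0 = p \<and> name i1 = q \<and>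
    suf i2 = enc_int z @ Comma # suf i3 \<and> suf i3 = enc_op op @ Comma # enc_list ps @ Semicolon # tail"
proof -
  from assms(1) obtain ps where ps: "suf i0 = enc_list ps @ Semicolon # tail"
    by (auto simp: trans_at_def)
  from assms(2) obtain v where v: "word v" "suf i0 = v @ Comma # suf i1" by (auto simp: next_word_def)
  from enc_list_word[of ps tail v "suf i1"] ps v obtain p q z op ps' where
    pq: "delta A (p, q) = Some (z, op)" "suf i0 = bin p @ Comma # bin q @ Comma # enc_int z @ Comma #
        enc_op op @ Comma # enc_list ps' @ Semicolon # tail" by metis
  note 1 = next_word_suf[OF assms(2) word_bin pq(2)]
  note 2 = next_word_suf[OF assms(3) word_bin 1]
  note 3 = next_word_suf[OF assms(4) word_enc_int 2]
  show ?thesis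
    by (intro exI[of _ p] exI[of _ q] exI[of _ z] exI[of _ op] exI[of _ ps'])
      (simp add: pq(1) name_bin[OF pq(2)] name_bin[OF 1] 2 3)
qed

text \<open>The encodings of 0, 1 and -1 differ in their first letter once the terminating comma is
  counted in.\<close>

lemma kind_ptr:
  assumes "delta A (p, q) = Some (z, op)" "(c, d, b, l) \<in> kinds" "enc_int z @ Comma # r = l # r'"
  shows "ptr A (p, c) (q, d) b op"
  using delta_props(3)[OF assms(1)] assms by (auto simp: kinds_def enc_int_unit)

lemma op_letter:
  assumes "enc_op op @ Comma # r = l # r'"
  shows "l = Comma \<Longrightarrow> op = Eps" "l = PushSign \<Longrightarrow> \<exists>a. op = Push a \<and> r' = bin a @ Comma # r"
    "l = PopSign \<Longrightarrow> \<exists>a. op = Pop a \<and> r' = bin a @ Comma # r"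
  using assms by (cases op; auto)+

subsection \<open>Soundness\<close>

text \<open>The intended meaning in terms of names instead of positions. The lower bounds in the
  transition predicates keep position 0 from being taken for a state, so that
  \<open>goal_node\<close> yields \<open>Some\<close> where a matching pop is used.\<close>

fun sem :: "pred \<Rightarrow> nat list \<Rightarrow> bool" where
  "sem NextWord xs \<longleftrightarrow> next_word (xs ! 0) (xs ! 1)"
| "sem SameWord xs \<longleftrightarrow> same_word (xs ! 0) (xs ! 1)"
| "sem (InSection m) xs \<longleftrightarrow> 1 \<le> xs ! 0 \<and> count_list (take (xs ! 0 - 1) L) Semicolon = m"
| "sem TransAt xs \<longleftrightarrow> trans_at (xs ! 0)"
| "sem (EpsTr c d b) xs \<longleftrightarrow> 1 \<le> xs ! 0 \<and> 1 \<le> xs ! 1 \<and>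
     ptr A (name (xs ! 0), c) (name (xs ! 1), d) b Eps"
| "sem (PushTr c d b) xs \<longleftrightarrow> 1 \<le> xs ! 0 \<and> 1 \<le> xs ! 1 \<and>
     ptr A (name (xs ! 0), c) (name (xs ! 1), d) b (Push (name (xs ! 2)))"
| "sem (PopTr c d b) xs \<longleftrightarrow> 1 \<le> xs ! 0 \<and> 1 \<le> xs ! 1 \<and>
     ptr A (name (xs ! 0), c) (name (xs ! 1), d) b (Pop (name (xs ! 2)))"
| "sem InitialAt xs \<longleftrightarrow> name (xs ! 0) = initial A"
| "sem AcceptAt xs \<longleftrightarrow> name (xs ! 0) = accepting A"
| "sem (GenP g c k) xs \<longleftrightarrow> genb g (name (xs ! 0), c) (goal_node (xs ! 1) k)"
| "sem (EdgeP g c k d l) xs \<longleftrightarrow> edge g ((name (xs ! 0), c), goal_node (xs ! 1) k)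
     ((name (xs ! 2), d), goal_node (xs ! 3) l)"
| "sem (ReachP g c k d l) xs \<longleftrightarrow> reach g ((name (xs ! 0), c), goal_node (xs ! 1) k)
     ((name (xs ! 2), d), goal_node (xs ! 3) l)"
| "sem Goal xs \<longleftrightarrow> pumpable (start, None)"

definition rule_sound :: "pred rule \<Rightarrow> bool" where
  "rule_sound r \<longleftrightarrow> (\<forall>x. (\<forall>i. x i \<le> n) \<longrightarrow> (\<forall>(i, s) \<in> set (fst r). u ! x i = s) \<longrightarrow>
     (\<forall>b \<in> set (fst (snd r)). sem (fst b) (map (\<lambda>(i, d). x i + d) (snd b))) \<longrightarrow>
     sem (fst (snd (snd r))) (map (\<lambda>(i, d). x i + d) (snd (snd (snd r)))))"

lemma rule_soundD:
  assumes "\<And>r. r \<in> prog \<Longrightarrow> rule_sound r"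
  shows "a \<in> derives prog u \<Longrightarrow> sem (fst a) (snd a)"
proof (induction rule: derives.induct)
  case (derives cs bs a x)
  from assms[OF derives(1)] derives(2-4) show ?case
    by (auto simp: rule_sound_def inst_def length_u less_Suc_eq_le)
qed

lemma next_word_Comma:
  assumes "i \<le> n" "u ! i = symbol_of Comma"
  shows "next_word i (Suc i)"
  using letter_suf[OF assms] unfolding next_word_def by (auto simp: word_def intro!: exI[of _ "[]"])

lemma next_word_Cons:
  assumes "i \<le> n" "u ! i = symbol_of c" "c \<in> word_letters" "next_word (Suc i) j"
  shows "next_word i j"
proof -
  from assms(4) obtain v where "word v" "suf (Suc i) = v @ Comma # suf j" "1 \<le> j"
    by (auto simp: next_word_def)
  with letter_suf[OF assms(1,2)] assms(3) show ?thesis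
    unfolding next_word_def by (auto simp: word_def intro!: exI[of _ "c # v"])
qed

lemma first_word_Cons:
  assumes "i \<le> n" "u ! i = symbol_of c"
  shows "first_word i = (if c \<in> word_letters then c # first_word (Suc i) else [])"
  using letter_suf[OF assms] by (simp add: first_word_def)

lemma section_split:
  assumes "i \<le> n" "u ! i = symbol_of c" "1 \<le> i"
  shows "L = take (i - 1) L @ c # suf (Suc i)"
proof -
  have "L = take (i - 1) L @ suf i" by (simp add: suf_def)
  from this[unfolded letter_suf(2)[OF assms(1,2)]] show ?thesis .
qed

lemma section_step:
  assumes "i \<le> n" "u ! i = symbol_of c"
  shows "count_list (take i L) Semicolon =
    count_list (take (i - 1) L) Semicolon + (if c = Semicolon then 1 else 0)"
  using take_suf[of i c "suf (Suc i)"] letter_suf[OF assms] by simp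

lemma trans_at_first:
  assumes "i \<le> n" "u ! i = symbol_of Semicolon" "1 \<le> i" "count_list (take (i - 1) L) Semicolon = 1"
  shows "trans_at (Suc i)"
proof -
  have "take (i - 1) L @ Semicolon # suf (Suc i) =
    (sec0 @ Semicolon # sec1) @ Semicolon # enc_list trans_list @ Semicolon # tail"
    using section_split[OF assms(1-3), symmetric] by (rule trans) (simp add: L_split)
  then have "suf (Suc i) = enc_list trans_list @ Semicolon # tail"
    by (rule count_semicolon_split) (simp add: assms(4)[simplified] count_secs)
  then show ?thesis by (auto simp: trans_at_def)
qed

lemma tail_first:
  assumes "i \<le> n" "u ! i = symbol_of Semicolon" "1 \<le> i" "count_list (take (i - 1) L) Semicolon = 2"
  shows "suf (Suc i) = tail"
proof -
  have "take (i - 1) L @ Semicolon # suf (Suc i) =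
    (sec0 @ Semicolon # sec1 @ Semicolon # enc_list trans_list) @ Semicolon # tail"
    using section_split[OF assms(1-3), symmetric] by (rule trans) (simp add: L_split)
  then show ?thesis
    by (rule count_semicolon_split) (simp add: assms(4)[simplified] count_secs)
qed

context
  notes symbol_of.simps [simp del]
begin

lemma sound_words: "r \<in> prog_words \<Longrightarrow> rule_sound r"
proof -
  have "rule_sound next_end"
    by (simp add: rule_sound_def next_end_def at_defs next_word_Comma)
  moreover have "rule_sound (next_letter c)" if "c \<in> word_letters" for c
    using that by (auto simp: rule_sound_def next_letter_def at_defs intro: next_word_Cons)
  moreover have "rule_sound same_end"
    by (auto simp: rule_sound_def same_end_def at_defs same_word_def first_word_Cons word_letters_def
        dest: letter_suf(1)[rotated])
  moreover have "rule_sound (same_letter c)" if "c \<in> word_letters" for c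
    using that by (auto simp: rule_sound_def same_letter_def at_defs same_word_def first_word_Cons
        dest: letter_suf(1)[rotated])
  moreover have "rule_sound section_start"
    by (auto simp: rule_sound_def section_start_def at_defs marker_iff)
  moreover have "rule_sound (section_letter c m)" if "c \<noteq> Semicolon" for c m
    using that by (auto simp: rule_sound_def section_letter_def at_defs section_step)
  moreover have "rule_sound (section_end m)" for m
    by (auto simp: rule_sound_def section_end_def at_defs section_step)
  moreover have "rule_sound trans_first"
    by (auto simp: rule_sound_def trans_first_def at_defs intro: trans_at_first)
  moreover have "rule_sound trans_next"
  proof -
    have "trans_at i4" if "trans_at i0" "next_word i0 i1" "next_word i1 i2" "next_word i2 i3"
      "next_word i3 i4" for i0 i1 i2 i3 i4
    proof -
      from trans_at_entry[OF that(1-4)] obtain op ps where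
        "suf i3 = enc_op op @ Comma # enc_list ps @ Semicolon # tail" by blast
      from next_word_suf[OF that(5) word_enc_op this] that(5) show ?thesis
        by (auto simp: trans_at_def next_word_def)
    qed
    then show ?thesis by (auto simp: rule_sound_def trans_next_def at_defs)
  qed
  moreover have "rule_sound initial_rule"
  proof -
    have "name k = initial A" if "i \<le> n" "u ! i = symbol_of Semicolon" "1 \<le> i"
      "count_list (take (i - 1) L) Semicolon = 2" "next_word (Suc i) j" "same_word k j" for i j k
    proof -
      have "suf j = bin (initial A) @ Comma # bin (accepting A) @ [Comma]"
        using next_word_suf[OF that(5) word_bin] tail_first[OF that(1-4)] by (simp add: tail_def)
      from name_bin[OF this] same_word_name[OF that(6)] show ?thesis by simp
    qed
    then show ?thesis by (simp add: rule_sound_def initial_rule_def at_defs) blast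
  qed
  moreover have "rule_sound accept_rule"
  proof -
    have "name k = accepting A" if "i \<le> n" "u ! i = symbol_of Semicolon" "1 \<le> i"
      "count_list (take (i - 1) L) Semicolon = 2" "next_word (Suc i) j" "next_word j j'"
      "same_word k j'" for i j j' k
    proof -
      have "suf j = bin (initial A) @ Comma # bin (accepting A) @ [Comma]"
        using next_word_suf[OF that(5) word_bin] tail_first[OF that(1-4)] by (simp add: tail_def)
      from next_word_suf[OF that(6) word_bin this] have "suf j' = bin (accepting A) @ Comma # []" .
      from name_bin[OF this] same_word_name[OF that(7)] show ?thesis by simp
    qed
    then show ?thesis by (simp add: rule_sound_def accept_rule_def at_defs) blast
  qed
  ultimately show "r \<in> prog_words \<Longrightarrow> rule_sound r" unfolding prog_words_def by blast
qed

lemma sound_trans: "r \<in> prog_trans \<Longrightarrow> rule_sound r"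
proof -
  \<comment> \<open>Shared by all stack operations: the names are read off at \<open>i0\<close> and
    \<open>i1\<close> and transferred to any positions with the same words.\<close>
  have entry: "\<exists>op r. ptr A (name i4, c) (name i5, d) b op \<and> suf i3 = enc_op op @ Comma # r"
    if "(c, d, b, l) \<in> kinds" "i2 \<le> n" "u ! i2 = symbol_of l" "trans_at i0" "next_word i0 i1"
      "next_word i1 i2" "next_word i2 i3" "same_word i4 i0" "same_word i5 i1"
    for c d b l i0 i1 i2 i3 i4 i5
  proof -
    from trans_at_entry[OF that(4-7)] obtain z op ps where e:
      "delta A (name i0, name i1) = Some (z, op)" "suf i2 = enc_int z @ Comma # suf i3"
      "suf i3 = enc_op op @ Comma # enc_list ps @ Semicolon # tail" by blast
    from kind_ptr[OF e(1) that(1)] letter_suf(2)[OF that(2,3)] e(2)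
    have "ptr A (name i0, c) (name i1, d) b op" by metis
    with e(3) same_word_name[OF that(8)] same_word_name[OF that(9)] show ?thesis by auto
  qed
  have "rule_sound (eps_rule c d b l)" if k: "(c, d, b, l) \<in> kinds" for c d b l
  proof -
    have "ptr A (name i4, c) (name i5, d) b Eps"
      if "i2 \<le> n" "u ! i2 = symbol_of l" "trans_at i0" "next_word i0 i1"
      "next_word i1 i2" "next_word i2 i3" "same_word i4 i0" "same_word i5 i1" "i3 \<le> n"
      "u ! i3 = symbol_of Comma" for i0 i1 i2 i3 i4 i5
      using entry[OF k that(1-8)] letter_suf(2)[OF that(9,10)] op_letter(1) by metis
    then show ?thesis by (simp add: rule_sound_def eps_rule_def at_defs same_word_def) blast
  qed
  moreover have "rule_sound (stack_rule P m c d b l)"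
    if k: "(c, d, b, l) \<in> kinds" and P: "(P, m) = (PushTr, PushSign) \<or> (P, m) = (PopTr, PopSign)"
    for P m c d b l
  proof -
    let ?op = "if m = PushSign then Push else Pop"
    have "ptr A (name i4, c) (name i5, d) b (?op (name i6))"
      if "i2 \<le> n" "u ! i2 = symbol_of l" "trans_at i0" "next_word i0 i1"
      "next_word i1 i2" "next_word i2 i3" "same_word i4 i0" "same_word i5 i1" "i3 \<le> n"
      "u ! i3 = symbol_of m" "same_word i6 (Suc i3)" for i0 i1 i2 i3 i4 i5 i6
    proof -
      from entry[OF k that(1-8)] obtain op r where
        e: "ptr A (name i4, c) (name i5, d) b op" "suf i3 = enc_op op @ Comma # r" by blast
      with letter_suf(2)[OF that(9,10)] have "enc_op op @ Comma # r = m # suf (Suc i3)" by simp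
      from op_letter(2,3)[OF this] P
      obtain a where "op = ?op a" "suf (Suc i3) = bin a @ Comma # r" by auto
      with e(1) name_bin same_word_name[OF that(11)] show ?thesis by metis
    qed
    with P show ?thesis by (auto simp: rule_sound_def stack_rule_def at_defs same_word_def) blast+
  qed
  ultimately show "r \<in> prog_trans \<Longrightarrow> rule_sound r" unfolding prog_trans_def by blast
qed

lemma goal_node_simps: "goal_node 0 c = None" "1 \<le> i \<Longrightarrow> goal_node i c = Some (name i, c)"
  by (auto simp: goal_node_def)

lemma sound_gen: "r \<in> prog_gen \<Longrightarrow> rule_sound r"
proof -
  have "rule_sound (gen_refl_rule c)" for c
    by (auto simp: rule_sound_def gen_refl_rule_def at_defs goal_node_simps same_word_def genb_refl)
  moreover have "rule_sound (gen_fin_rule c)" for c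
    by (auto simp: rule_sound_def gen_fin_rule_def at_defs marker_iff goal_node_simps genb_fin)
  moreover have "rule_sound (gen_eps_rule b g c d k)" for b g c d k
    by (auto simp: rule_sound_def gen_eps_rule_def at_defs simp del: ptr.simps intro: genb_eps)
  moreover have "rule_sound (gen_push_rule b g c d k)" for b g c d k
    by (auto simp: rule_sound_def gen_push_rule_def at_defs marker_iff goal_node_simps
        simp del: ptr.simps intro: genb_push)
  moreover have "rule_sound (gen_match_rule b g b' h c d d' e k)" for b g b' h c d d' e k
    by (auto simp: rule_sound_def gen_match_rule_def match_body_def at_defs goal_node_simps
        simp del: ptr.simps intro: genb_match)
  moreover have "rule_sound (edge_eps_rule b g c d k)" for b g c d k
    by (auto simp: rule_sound_def edge_eps_rule_def at_defs simp del: ptr.simps intro: edge_eps)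
  moreover have "rule_sound (edge_push_rule b g c d k)" for b g c d k
    by (auto simp: rule_sound_def edge_push_rule_def at_defs marker_iff goal_node_simps
        simp del: ptr.simps intro: edge_push)
  moreover have "rule_sound (edge_inner_rule b g b' h c d d' e k)" for b g b' h c d d' e k
    by (auto simp: rule_sound_def edge_inner_rule_def match_body_def at_defs goal_node_simps
        simp del: ptr.simps intro: edge_inner)
  moreover have "rule_sound (edge_after_rule b g b' h c d d' e k)" for b g b' h c d d' e k
    by (auto simp: rule_sound_def edge_after_rule_def match_body_def at_defs goal_node_simps
        simp del: ptr.simps intro: edge_after)
  ultimately show "r \<in> prog_gen \<Longrightarrow> rule_sound r" unfolding prog_gen_def by auto
qed

lemma sound_reach: "r \<in> prog_reach \<Longrightarrow> rule_sound r"
proof -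
  have "rule_sound (reach_refl_rule c k)" for c k
    by (auto simp: rule_sound_def reach_refl_rule_def at_defs reach_refl)
  moreover have "rule_sound (reach_step_rule f g c k d l d' l')" for f g c k d l d' l'
    by (auto simp: rule_sound_def reach_step_rule_def at_defs intro: reach_step)
  moreover have "rule_sound (goal_rule f d l)" for f d l
    by (auto simp: rule_sound_def goal_rule_def at_defs marker_iff goal_node_simps pumpable_def start_def) blast
  ultimately show "r \<in> prog_reach \<Longrightarrow> rule_sound r" unfolding prog_reach_def by blast
qed

end

lemma sound: "(Goal, xs) \<in> derives prog u \<Longrightarrow> pumpable (start, None)"
proof -
  assume "(Goal, xs) \<in> derives prog u"
  moreover have "rule_sound r" if "r \<in> prog" for r
    using that sound_words sound_trans sound_gen sound_reach unfolding prog_def by blast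
  ultimately show "pumpable (start, None)" using rule_soundD[of "(Goal, xs)"] by simp
qed

end


context encoded
begin

subsection \<open>Completeness\<close>

abbreviation D :: "(pred \<times> nat list) set" where "D \<equiv> derives prog u"

text \<open>Rules are instantiated by lists; the remaining variables become 0, which is always a
  position.\<close>

definition asg :: "nat list \<Rightarrow> nat \<Rightarrow> nat" where
  "asg xs i = (if i < length xs then xs ! i else 0)"

definition fact1 where "fact1 p i \<longleftrightarrow> (p, [i, i, i, i]) \<in> D"
definition fact2 where "fact2 p i j \<longleftrightarrow> (p, [i, j, i, i]) \<in> D"
definition fact3 where "fact3 p i j k \<longleftrightarrow> (p, [i, j, k, i]) \<in> D"
definition fact4 where "fact4 p i j k l \<longleftrightarrow> (p, [i, j, k, l]) \<in> D"

lemmas fact_defs = fact1_def fact2_def fact3_def fact4_def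

lemma fires_D:
  assumes "r \<in> prog" "set xs \<subseteq> {..n}" "\<forall>(i, s) \<in> set (fst r). u ! asg xs i = s"
    "\<forall>b \<in> set (fst (snd r)). inst (asg xs) b \<in> D"
  shows "inst (asg xs) (snd (snd r)) \<in> D"
proof (rule derives[of "fst r" "fst (snd r)"])
  show "(fst r, fst (snd r), snd (snd r)) \<in> prog" using assms(1) by simp
  show "\<forall>i. asg xs i < length u"
  proof
    fix i
    have "xs ! i \<le> n" if "i < length xs" using assms(2) nth_mem[OF that] by auto
    then show "asg xs i < length u" by (simp add: asg_def length_u less_Suc_eq_le)
  qed
qed (use assms in auto)

lemma in_prog:
  "next_end \<in> prog" "same_end \<in> prog" "section_start \<in> prog" "trans_first \<in> prog"
  "trans_next \<in> prog" "initial_rule \<in> prog" "accept_rule \<in> prog"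
  "c \<in> word_letters \<Longrightarrow> next_letter c \<in> prog" "c \<in> word_letters \<Longrightarrow> same_letter c \<in> prog"
  "c \<noteq> Semicolon \<Longrightarrow> m \<le> 3 \<Longrightarrow> section_letter c m \<in> prog" "m \<le> 2 \<Longrightarrow> section_end m \<in> prog"
  unfolding prog_def prog_words_def by auto

lemma in_prog_trans:
  assumes "(c, d, b, l) \<in> kinds"
  shows "eps_rule c d b l \<in> prog" "stack_rule PushTr PushSign c d b l \<in> prog"
    "stack_rule PopTr PopSign c d b l \<in> prog"
  using assms unfolding prog_def prog_trans_def by auto

lemma in_prog_gen:
  "gen_refl_rule c \<in> prog" "gen_fin_rule c \<in> prog"
  unfolding prog_def prog_gen_def by blast+

lemma in_prog_gen5:
  "gen_eps_rule b g c d k \<in> prog" "gen_push_rule b g c d k \<in> prog"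
  "edge_eps_rule b g c d k \<in> prog" "edge_push_rule b g c d k \<in> prog"
  unfolding prog_def prog_gen_def Un_iff
  by (rule disjI1, rule disjI2, rule disjI1, rule disjI2, (rule UN_I[OF UNIV_I])+,
      (rule insertI1 | rule insertI2)+)+

lemma in_prog_match:
  "gen_match_rule b g b' h c d d' e k \<in> prog" "edge_inner_rule b g b' h c d d' e k \<in> prog"
  "edge_after_rule b g b' h c d d' e k \<in> prog"
  unfolding prog_def prog_gen_def Un_iff
  by (rule disjI1, rule disjI2, rule disjI2, (rule UN_I[OF UNIV_I])+,
      (rule insertI1 | rule insertI2)+)+

lemma in_prog_reach:
  "reach_refl_rule c k \<in> prog" "reach_step_rule f g c k d l d' l' \<in> prog" "goal_rule f d l \<in> prog"
  unfolding prog_def prog_reach_def Un_iff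
  by (rule disjI2, rule disjI1, rule disjI1, (rule UN_I[OF UNIV_I])+, rule singletonI)
    (rule disjI2, rule disjI1, rule disjI2, (rule UN_I[OF UNIV_I])+, rule singletonI,
      rule disjI2, rule disjI2, (rule UN_I[OF UNIV_I])+, rule singletonI)

context
  notes symbol_of.simps [simp del] and at_defs [simp] inst_def [simp] asg_def [simp] fact_defs [simp]
begin

lemma D_next_end: "i \<le> n \<Longrightarrow> u ! i = symbol_of Comma \<Longrightarrow> fact2 NextWord i (Suc i)"
  using fires_D[where r = "next_end" and xs = "[i]", OF in_prog(1)] by (simp add: next_end_def)

lemma D_next_letter:
  "i \<le> n \<Longrightarrow> j \<le> n \<Longrightarrow> u ! i = symbol_of c \<Longrightarrow> c \<in> word_letters \<Longrightarrow> fact2 NextWord (Suc i) j \<Longrightarrow>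
    fact2 NextWord i j"
  using fires_D[where r = "next_letter c" and xs = "[i, j]", OF in_prog(8)] by (simp add: next_letter_def)

lemma D_same_end:
  "i \<le> n \<Longrightarrow> j \<le> n \<Longrightarrow> u ! i = symbol_of Comma \<Longrightarrow> u ! j = symbol_of Comma \<Longrightarrow> fact2 SameWord i j"
  using fires_D[where r = "same_end" and xs = "[i, j]", OF in_prog(2)] by (simp add: same_end_def)

lemma D_same_letter:
  "i \<le> n \<Longrightarrow> j \<le> n \<Longrightarrow> u ! i = symbol_of c \<Longrightarrow> u ! j = symbol_of c \<Longrightarrow> c \<in> word_letters \<Longrightarrow>
    fact2 SameWord (Suc i) (Suc j) \<Longrightarrow> fact2 SameWord i j"
  using fires_D[where r = "same_letter c" and xs = "[i, j]", OF in_prog(9)] by (simp add: same_letter_def)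

lemma D_section_start: "fact1 (InSection 0) 1"
  using fires_D[where r = "section_start" and xs = "[0]", OF in_prog(3)] by (simp add: section_start_def u_def)

lemma D_section_letter:
  "i \<le> n \<Longrightarrow> u ! i = symbol_of c \<Longrightarrow> c \<noteq> Semicolon \<Longrightarrow> m \<le> 3 \<Longrightarrow> fact1 (InSection m) i \<Longrightarrow>
    fact1 (InSection m) (Suc i)"
  using fires_D[where r = "section_letter c m" and xs = "[i]", OF in_prog(10)] by (simp add: section_letter_def)

lemma D_section_end:
  "i \<le> n \<Longrightarrow> u ! i = symbol_of Semicolon \<Longrightarrow> m \<le> 2 \<Longrightarrow> fact1 (InSection m) i \<Longrightarrow>
    fact1 (InSection (Suc m)) (Suc i)"
  using fires_D[where r = "section_end m" and xs = "[i]", OF in_prog(11)] by (simp add: section_end_def)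

lemma D_trans_first:
  "i \<le> n \<Longrightarrow> u ! i = symbol_of Semicolon \<Longrightarrow> fact1 (InSection 1) i \<Longrightarrow> fact1 TransAt (Suc i)"
  using fires_D[where r = "trans_first" and xs = "[i]", OF in_prog(4)] by (simp add: trans_first_def)

lemma D_trans_next:
  "{i0, i1, i2, i3, i4} \<subseteq> {..n} \<Longrightarrow> fact1 TransAt i0 \<Longrightarrow> fact2 NextWord i0 i1 \<Longrightarrow>
    fact2 NextWord i1 i2 \<Longrightarrow> fact2 NextWord i2 i3 \<Longrightarrow> fact2 NextWord i3 i4 \<Longrightarrow> fact1 TransAt i4"
  using fires_D[where r = "trans_next" and xs = "[i0, i1, i2, i3, i4]", OF in_prog(5)] by (simp add: trans_next_def)

lemma D_eps:
  "{i0, i1, i2, i3, i4, i5} \<subseteq> {..n} \<Longrightarrow> (c, d, b, l) \<in> kinds \<Longrightarrow> u ! i2 = symbol_of l \<Longrightarrow>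
    u ! i3 = symbol_of Comma \<Longrightarrow> fact1 TransAt i0 \<Longrightarrow> fact2 NextWord i0 i1 \<Longrightarrow>
    fact2 NextWord i1 i2 \<Longrightarrow> fact2 NextWord i2 i3 \<Longrightarrow> fact2 SameWord i4 i0 \<Longrightarrow>
    fact2 SameWord i5 i1 \<Longrightarrow> fact2 (EpsTr c d b) i4 i5"
  using fires_D[where r = "eps_rule c d b l" and xs = "[i0, i1, i2, i3, i4, i5]", OF in_prog_trans(1)] by (simp add: eps_rule_def)

lemma D_stack:
  "{i0, i1, i2, i3, i4, i5, i6} \<subseteq> {..n} \<Longrightarrow> (c, d, b, l) \<in> kinds \<Longrightarrow> u ! i2 = symbol_of l \<Longrightarrow>
    u ! i3 = symbol_of l' \<Longrightarrow> (p, l') \<in> {(PushTr, PushSign), (PopTr, PopSign)} \<Longrightarrow>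
    fact1 TransAt i0 \<Longrightarrow> fact2 NextWord i0 i1 \<Longrightarrow>
    fact2 NextWord i1 i2 \<Longrightarrow> fact2 NextWord i2 i3 \<Longrightarrow> fact2 SameWord i4 i0 \<Longrightarrow>
    fact2 SameWord i5 i1 \<Longrightarrow> fact2 SameWord i6 (Suc i3) \<Longrightarrow> fact3 (p c d b) i4 i5 i6"
  using fires_D[where r = "stack_rule PushTr PushSign c d b l" and xs = "[i0, i1, i2, i3, i4, i5, i6]", OF in_prog_trans(2)]
    fires_D[where r = "stack_rule PopTr PopSign c d b l" and xs = "[i0, i1, i2, i3, i4, i5, i6]", OF in_prog_trans(3)]
  by (auto simp add: stack_rule_def)

lemma D_initial:
  "{i0, i1, i2} \<subseteq> {..n} \<Longrightarrow> u ! i0 = symbol_of Semicolon \<Longrightarrow> fact1 (InSection 2) i0 \<Longrightarrow>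
    fact2 NextWord (Suc i0) i1 \<Longrightarrow> fact2 SameWord i2 i1 \<Longrightarrow> fact1 InitialAt i2"
  using fires_D[where r = "initial_rule" and xs = "[i0, i1, i2]", OF in_prog(6)] by (simp add: initial_rule_def)

lemma D_accept:
  "{i0, i1, i2, i3} \<subseteq> {..n} \<Longrightarrow> u ! i0 = symbol_of Semicolon \<Longrightarrow> fact1 (InSection 2) i0 \<Longrightarrow>
    fact2 NextWord (Suc i0) i1 \<Longrightarrow> fact2 NextWord i1 i2 \<Longrightarrow> fact2 SameWord i3 i2 \<Longrightarrow> fact1 AcceptAt i3"
  using fires_D[where r = "accept_rule" and xs = "[i0, i1, i2, i3]", OF in_prog(7)] by (simp add: accept_rule_def)

lemma D_gen_refl: "i \<le> n \<Longrightarrow> fact2 SameWord i i \<Longrightarrow> fact2 (GenP False c c) i i"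
  using fires_D[where r = "gen_refl_rule c" and xs = "[i]", OF in_prog_gen(1)] by (simp add: gen_refl_rule_def)

lemma D_gen_fin: "i \<le> n \<Longrightarrow> fact1 AcceptAt i \<Longrightarrow> fact2 (GenP False c False) i 0"
  using fires_D[where r = "gen_fin_rule c" and xs = "[i, 0]", OF in_prog_gen(2)] by (simp add: gen_fin_rule_def u_def)

lemma D_gen_eps:
  "{i, j, x} \<subseteq> {..n} \<Longrightarrow> fact2 (EpsTr c d b) i j \<Longrightarrow> fact2 (GenP g d k) j x \<Longrightarrow>
    fact2 (GenP (b \<or> g) c k) i x"
  using fires_D[where r = "gen_eps_rule b g c d k" and xs = "[i, j, x]", OF in_prog_gen5(1)] by (simp add: gen_eps_rule_def)

lemma D_gen_push:
  "{i, j, a} \<subseteq> {..n} \<Longrightarrow> fact3 (PushTr c d b) i j a \<Longrightarrow> fact2 (GenP g d k) j 0 \<Longrightarrow>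
    fact2 (GenP (b \<or> g) c k) i 0"
  using fires_D[where r = "gen_push_rule b g c d k" and xs = "[i, j, 0, a]", OF in_prog_gen5(2)] by (simp add: gen_push_rule_def u_def)

lemma D_match:
  assumes "{p, r, r', s, x, a} \<subseteq> {..n}" "fact3 (PushTr c d b) p r a" "fact2 (GenP g d d') r r'"
    "fact3 (PopTr d' e b') r' s a" "fact2 (GenP h e k) s x"
  shows "fact2 (GenP (b \<or> g \<or> b' \<or> h) c k) p x"
    "fact4 (EdgeP (b \<or> b' \<or> h) c k d d') p x r r'"
    "fact4 (EdgeP (b \<or> b' \<or> g) c k e k) p x s x"
  using assms fires_D[where r = "gen_match_rule b g b' h c d d' e k" and xs = "[p, x, r, r', a, s]", OF in_prog_match(1)]
    fires_D[where r = "edge_inner_rule b g b' h c d d' e k" and xs = "[p, x, r, r', a, s]", OF in_prog_match(2)]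
    fires_D[where r = "edge_after_rule b g b' h c d d' e k" and xs = "[p, x, r, r', a, s]", OF in_prog_match(3)]
  by (simp_all add: gen_match_rule_def edge_inner_rule_def edge_after_rule_def match_body_def)

lemma D_edge_eps:
  "{i, j, x} \<subseteq> {..n} \<Longrightarrow> fact2 (EpsTr c d b) i j \<Longrightarrow> fact2 (GenP g d k) j x \<Longrightarrow>
    fact4 (EdgeP b c k d k) i x j x"
  using fires_D[where r = "edge_eps_rule b g c d k" and xs = "[i, x, j]", OF in_prog_gen5(3)] by (simp add: edge_eps_rule_def)

lemma D_edge_push:
  "{i, j, a} \<subseteq> {..n} \<Longrightarrow> fact3 (PushTr c d b) i j a \<Longrightarrow> fact2 (GenP g d k) j 0 \<Longrightarrow>
    fact4 (EdgeP b c k d k) i 0 j 0"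
  using fires_D[where r = "edge_push_rule b g c d k" and xs = "[i, 0, j, a]", OF in_prog_gen5(4)] by (simp add: edge_push_rule_def u_def)

lemma D_reach_refl: "{i, x} \<subseteq> {..n} \<Longrightarrow> fact4 (ReachP False c k c k) i x i x"
  using fires_D[where r = "reach_refl_rule c k" and xs = "[i, x]", OF in_prog_reach(1)] by (simp add: reach_refl_rule_def)

lemma D_reach_step:
  "{i, x, j, y, j', y'} \<subseteq> {..n} \<Longrightarrow> fact4 (ReachP f c k d l) i x j y \<Longrightarrow>
    fact4 (EdgeP g d l d' l') j y j' y' \<Longrightarrow> fact4 (ReachP (f \<or> g) c k d' l') i x j' y'"
  using fires_D[where r = "reach_step_rule f g c k d l d' l'" and xs = "[i, x, j, y, j', y']", OF in_prog_reach(2)]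
  by (simp add: reach_step_rule_def)

lemma D_goal:
  "{i, j, y} \<subseteq> {..n} \<Longrightarrow> fact1 InitialAt i \<Longrightarrow> fact4 (ReachP f False False d l) i 0 j y \<Longrightarrow>
    fact4 (ReachP True d l d l) j y j y \<Longrightarrow> (Goal, [0, 0, 0, 0]) \<in> D"
  using fires_D[where r = "goal_rule f d l" and xs = "[i, 0, j, y]", OF in_prog_reach(3)] by (simp add: goal_rule_def u_def)

end

text \<open>The condition \<open>r \<noteq> []\<close> ensures that the cell behind the comma is a
  position of \<open>u\<close>, as variables cannot take other values. The last word of the encoding
  thus has no successor.\<close>

lemma D_next_word:
  assumes "word v" "1 \<le> i" "suf i = v @ Comma # r" "r \<noteq> []"
  shows "fact2 NextWord i (i + length v + 1)" "suf (i + length v + 1) = r" "i \<le> n"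
    "i + length v + 1 \<le> n"
proof -
  show s: "suf (i + length v + 1) = r" using suf_add[of i "v @ [Comma]" r] assms by simp
  obtain c r' where "r = c # r'" using assms(4) by (cases r) auto
  then show j: "i + length v + 1 \<le> n" using suf_letter(1)[of "i + length v + 1"] s by simp
  then show "i \<le> n" by simp
  show "fact2 NextWord i (i + length v + 1)" using assms(1-3) j
  proof (induction v arbitrary: i)
    case Nil
    then show ?case using D_next_end suf_letter[of i Comma r] by simp
  next
    case (Cons c v)
    have "fact2 NextWord (Suc i) (Suc i + length v + 1)"
      by (rule Cons.IH) (use Cons.prems suf_letter[of i c] in \<open>auto simp: word_def\<close>)
    with D_next_letter[of i "i + length (c # v) + 1" c] Cons.prems suf_letter[of i c] show ?case
      by (simp add: word_def)
  qed
qed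

lemma D_same_word:
  "word v \<Longrightarrow> 1 \<le> i \<Longrightarrow> 1 \<le> j \<Longrightarrow> suf i = v @ Comma # r \<Longrightarrow> suf j = v @ Comma # r' \<Longrightarrow>
    fact2 SameWord i j"
proof (induction v arbitrary: i j)
  case Nil
  then show ?case using D_same_end suf_letter[of i Comma r] suf_letter[of j Comma r'] by simp
next
  case (Cons c v)
  have "fact2 SameWord (Suc i) (Suc j)"
    by (rule Cons.IH)
      (use Cons.prems suf_letter[of i c] suf_letter[of j c] in \<open>auto simp: word_def\<close>)
  with D_same_letter[of i j c] Cons.prems suf_letter[of i c] suf_letter[of j c] show ?case
    by (simp add: word_def)
qed

lemma D_section:
  "k \<le> n \<Longrightarrow> count_list (take k L) Semicolon \<le> 3 \<Longrightarrow>
    fact1 (InSection (count_list (take k L) Semicolon)) (Suc k)"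
proof (induction k)
  case 0
  then show ?case using D_section_start by simp
next
  case (Suc k)
  let ?c = "L ! k"
  have "k < length L" using Suc.prems by (simp add: n_def)
  then have "take (Suc k) L = take k L @ [?c]" by (simp add: take_Suc_conv_app_nth)
  then have c: "count_list (take (Suc k) L) Semicolon =
    count_list (take k L) Semicolon + (if ?c = Semicolon then 1 else 0)" by simp
  with Suc have IH: "fact1 (InSection (count_list (take k L) Semicolon)) (Suc k)" by (simp split: if_splits)
  have u: "u ! Suc k = symbol_of ?c" using \<open>k < length L\<close> by (simp add: u_def)
  show ?case
  proof (cases "?c = Semicolon")
    case True
    with D_section_end[OF Suc.prems(1) _ _ IH] u c Suc.prems(2) show ?thesis by simp
  next
    case False
    with D_section_letter[OF Suc.prems(1) u _ _ IH] c Suc.prems(2) show ?thesis by simp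
  qed
qed

lemma D_section_at:
  assumes "L = a @ Semicolon # b" "count_list a Semicolon \<le> 3"
  shows "fact1 (InSection (count_list a Semicolon)) (Suc (length a))" "Suc (length a) \<le> n"
    "u ! Suc (length a) = symbol_of Semicolon"
  using D_section[of "length a"] assms suf_letter[of "Suc (length a)"] suf_append[OF assms(1)]
  by (auto simp: n_def)

lemma D_entry:
  assumes "L = a @ enc_trans A (p, q) @ r" "r \<noteq> []" "delta A (p, q) = Some (z, op)"
  obtains i1 i2 i3 where "fact2 NextWord (Suc (length a)) i1" "fact2 NextWord i1 i2"
    "fact2 NextWord i2 i3" "fact2 NextWord i3 (Suc (length (a @ enc_trans A (p, q))))"
    "{Suc (length a), i1, i2, i3, Suc (length (a @ enc_trans A (p, q)))} \<subseteq> {1..n}"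
    "suf (Suc (length a)) = bin p @ Comma # suf i1" "suf i1 = bin q @ Comma # suf i2"
    "suf i2 = enc_int z @ Comma # suf i3" "suf i3 = enc_op op @ Comma # r"
proof -
  let ?i0 = "Suc (length a)"
  have e: "enc_trans A (p, q) = bin p @ Comma # bin q @ Comma # enc_int z @ Comma # enc_op op @ [Comma]"
    using assms(3) by (simp add: enc_trans_def items_Cons items_Nil)
  have "suf ?i0 = bin p @ Comma # bin q @ Comma # enc_int z @ Comma # enc_op op @ Comma # r"
    using suf_append[OF assms(1)] e by simp
  note 0 = this D_next_word[OF word_bin _ this]
  define i1 where "i1 = ?i0 + length (bin p) + 1"
  have s1: "suf i1 = bin q @ Comma # enc_int z @ Comma # enc_op op @ Comma # r"
    using 0(3) by (simp add: i1_def)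
  note 1 = this D_next_word[OF word_bin _ this]
  define i2 where "i2 = i1 + length (bin q) + 1"
  have s2: "suf i2 = enc_int z @ Comma # enc_op op @ Comma # r"
    using 1(3) by (simp add: i2_def i1_def)
  note 2 = this D_next_word[OF word_enc_int _ this]
  define i3 where "i3 = i2 + length (enc_int z) + 1"
  have s3: "suf i3 = enc_op op @ Comma # r"
    using 2(3) by (simp add: i3_def i2_def)
  note 3 = this D_next_word[OF word_enc_op _ this]
  have i4: "Suc (length (a @ enc_trans A (p, q))) = i3 + length (enc_op op) + 1"
    by (simp add: e i3_def i2_def i1_def)
  have ge: "1 \<le> i1" "1 \<le> i2" "1 \<le> i3" by (simp_all add: i1_def i2_def i3_def)
  have "fact2 NextWord ?i0 i1" "?i0 \<le> n" using 0(2,4) by (simp_all add: i1_def)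
  moreover have "fact2 NextWord i1 i2" "i1 \<le> n" using 1(2,4)[OF ge(1)] by (simp_all add: i2_def)
  moreover have "fact2 NextWord i2 i3" "i2 \<le> n" using 2(2,4)[OF ge(2)] by (simp_all add: i3_def)
  moreover have "fact2 NextWord i3 (i3 + length (enc_op op) + 1)" "i3 \<le> n" "i3 + length (enc_op op) + 1 \<le> n"
    using 3(2,4,5)[OF ge(3) assms(2)] by simp_all
  ultimately show ?thesis
    using 0(1) s1 s2 s3 ge by (intro that[of i1 i2 i3, unfolded i4]) simp_all
qed

text \<open>Each defined pair is passed by one application of \<open>trans_next\<close>; an
  undefined pair has an empty encoding, so the position stays the same.\<close>

lemma D_trans_at:
  "L = a @ enc_list (ps @ qs) @ Semicolon # t \<Longrightarrow> fact1 TransAt (Suc (length a)) \<Longrightarrow>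
    fact1 TransAt (Suc (length (a @ enc_list ps)))"
proof (induction ps arbitrary: a)
  case (Cons x ps)
  obtain p q where x: "x = (p, q)" by (cases x)
  have "fact1 TransAt (Suc (length (a @ enc_trans A x)))"
  proof (cases "delta A (p, q)")
    case None
    with Cons.prems(2) show ?thesis by (simp add: x enc_trans_def)
  next
    case (Some y)
    obtain z op where "y = (z, op)" by (cases y)
    with Some have y: "delta A (p, q) = Some (z, op)" by simp
    have L: "L = a @ enc_trans A (p, q) @ enc_list (ps @ qs) @ Semicolon # t"
      using Cons.prems(1) x by simp
    have ne: "enc_list (ps @ qs) @ Semicolon # t \<noteq> []" by simp
    obtain i1 i2 i3 where "fact2 NextWord (Suc (length a)) i1" "fact2 NextWord i1 i2"
      "fact2 NextWord i2 i3" "fact2 NextWord i3 (Suc (length (a @ enc_trans A x)))"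
      "{Suc (length a), i1, i2, i3, Suc (length (a @ enc_trans A x))} \<subseteq> {1..n}"
      unfolding x by (rule D_entry[OF L ne y])
    note facts = this
    show ?thesis
      by (rule D_trans_next[of "Suc (length a)" i1 i2 i3]) (use facts Cons.prems(2) in auto)
  qed
  from Cons.IH[OF _ this] Cons.prems(1) show ?case by simp
qed simp

lemma D_trans:
  assumes "delta A (p, q) = Some (z, op)"
  shows "\<exists>i0 i1 i2 i3 r. {i0, i1, i2, i3} \<subseteq> {1..n} \<and> fact1 TransAt i0 \<and> fact2 NextWord i0 i1 \<and>
    fact2 NextWord i1 i2 \<and> fact2 NextWord i2 i3 \<and>
    suf i0 = bin p @ Comma # suf i1 \<and> suf i1 = bin q @ Comma # suf i2 \<and>
    suf i2 = enc_int z @ Comma # suf i3 \<and> suf i3 = enc_op op @ Comma # r"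
proof -
  let ?a = "sec0 @ Semicolon # sec1"
  have "fact1 (InSection 1) (Suc (length ?a))" "Suc (length ?a) \<le> n"
    "u ! Suc (length ?a) = symbol_of Semicolon"
    using D_section_at[of ?a "enc_list trans_list @ Semicolon # tail"] L_split count_secs by auto
  from D_trans_first[OF this(2,3,1)] have first: "fact1 TransAt (Suc (length (?a @ [Semicolon])))"
    by simp
  have "(p, q) \<in> set trans_list"
    using c1pvass delta_props(1,2)[OF assms] by (simp add: trans_list_def c1pvass_def)
  then obtain ps qs where ps: "trans_list = ps @ (p, q) # qs" by (meson split_list)
  have L: "L = (?a @ [Semicolon]) @ enc_list (ps @ (p, q) # qs) @ Semicolon # tail"
    using L_split ps by simp
  let ?b = "(?a @ [Semicolon]) @ enc_list ps"
  from D_trans_at[OF L first] have at: "fact1 TransAt (Suc (length ?b))" .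
  have "L = ?b @ enc_trans A (p, q) @ enc_list qs @ Semicolon # tail" using L by simp
  note L' = this
  have ne: "enc_list qs @ Semicolon # tail \<noteq> []" by simp
  obtain i1 i2 i3 where "fact2 NextWord (Suc (length ?b)) i1" "fact2 NextWord i1 i2"
    "fact2 NextWord i2 i3"
    "{Suc (length ?b), i1, i2, i3, Suc (length (?b @ enc_trans A (p, q)))} \<subseteq> {1..n}"
    "suf (Suc (length ?b)) = bin p @ Comma # suf i1" "suf i1 = bin q @ Comma # suf i2"
    "suf i2 = enc_int z @ Comma # suf i3"
    "suf i3 = enc_op op @ Comma # enc_list qs @ Semicolon # tail"
    by (rule D_entry[OF L' ne assms])
  with at show ?thesis
    by (intro exI[of _ "Suc (length ?b)"] exI[of _ i1] exI[of _ i2] exI[of _ i3]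
        exI[of _ "enc_list qs @ Semicolon # tail"]) simp
qed

text \<open>A canonical occurrence of each name, since premises of a rule can only be joined at a
  common position. It may lie in the middle of a longer word: only the letters up to the next comma
  count. A state and a stack symbol with the same number share it, which does no harm as they fill
  different argument places.\<close>

definition ptr_of :: "nat \<Rightarrow> nat" where
  "ptr_of p = (SOME i. i \<in> {1..n} \<and> (\<exists>r. suf i = bin p @ Comma # r))"

lemma ptr_of:
  assumes "p \<in> states A \<union> stack_syms A"
  shows "ptr_of p \<in> {1..n}" "\<exists>r. suf (ptr_of p) = bin p @ Comma # r"
proof -
  have "finite (states A)" "finite (stack_syms A)" using c1pvass by (auto simp: c1pvass_def)
  with assms consider "bin p \<in> set (map bin (sorted_list_of_set (states A)))"
    | "bin p \<in> set (map bin (sorted_list_of_set (stack_syms A)))" by auto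
  then obtain a b where L: "L = a @ bin p @ Comma # b"
  proof cases
    case 1
    from items_split[OF this] L_split that show ?thesis unfolding sec0_def by fastforce
  next
    case 2
    from items_split[OF this] obtain x y where "sec1 = x @ bin p @ Comma # y" unfolding sec1_def by blast
    with L_split that[of "sec0 @ Semicolon # x"] show ?thesis by simp
  qed
  have "Suc (length a) \<in> {1..n} \<and> (\<exists>r. suf (Suc (length a)) = bin p @ Comma # r)"
    using suf_append[OF L] L by (auto simp: n_def)
  from someI[of "\<lambda>i. i \<in> {1..n} \<and> (\<exists>r. suf i = bin p @ Comma # r)", OF this]
  show "ptr_of p \<in> {1..n}" "\<exists>r. suf (ptr_of p) = bin p @ Comma # r"
    unfolding ptr_of_def by blast+
qed

lemma D_same_ptr:
  assumes "p \<in> states A \<union> stack_syms A" "1 \<le> i" "suf i = bin p @ Comma # r"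
  shows "fact2 SameWord (ptr_of p) i"
  using ptr_of[OF assms(1)] assms(2,3) D_same_word[OF word_bin] by auto

lemma kind_letter:
  assumes "ptr A (p, c) (q, d) b op"
  shows "\<exists>z l. delta A (p, q) = Some (z, op) \<and> (c, d, b, l) \<in> kinds \<and>
    (\<forall>r. \<exists>r'. enc_int z @ Comma # r = l # r')"
proof -
  from assms obtain z where z: "delta A (p, q) = Some (z, op)"
    "z = 0 \<and> d = c \<and> \<not> b \<or> z = 1 \<and> d \<and> b \<or> z = -1 \<and> c \<and> d \<and> \<not> b" by auto
  let ?l = "if z = 0 then Comma else if z = 1 then Digit1 else MinusSign"
  have "(c, d, b, ?l) \<in> kinds" "\<forall>r. \<exists>r'. enc_int z @ Comma # r = ?l # r'"
    using z(2) by (auto simp: kinds_def enc_int_unit)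
  with z(1) show ?thesis by blast
qed

text \<open>The entry of the transition has its own occurrences of the names;
  \<open>SameWord\<close> moves the fact to the canonical ones.\<close>

lemma D_ptr:
  assumes "ptr A (p, c) (q, d) b op"
  shows "op = Eps \<Longrightarrow> fact2 (EpsTr c d b) (ptr_of p) (ptr_of q)"
    "op = Push a \<Longrightarrow> fact3 (PushTr c d b) (ptr_of p) (ptr_of q) (ptr_of a)"
    "op = Pop a \<Longrightarrow> fact3 (PopTr c d b) (ptr_of p) (ptr_of q) (ptr_of a)"
proof -
  from kind_letter[OF assms] obtain z l where z: "delta A (p, q) = Some (z, op)" "(c, d, b, l) \<in> kinds"
    "\<And>r. \<exists>r'. enc_int z @ Comma # r = l # r'" by blast
  note pq = delta_props(1,2,4)[OF z(1)]
  from D_trans[OF z(1)] obtain i0 i1 i2 i3 r where i: "{i0, i1, i2, i3} \<subseteq> {1..n}"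
    "fact1 TransAt i0" "fact2 NextWord i0 i1" "fact2 NextWord i1 i2" "fact2 NextWord i2 i3"
    "suf i0 = bin p @ Comma # suf i1" "suf i1 = bin q @ Comma # suf i2"
    "suf i2 = enc_int z @ Comma # suf i3" "suf i3 = enc_op op @ Comma # r" by blast
  from z(3) i(8) obtain r' where "suf i2 = l # r'" by metis
  with suf_letter(2) i(1) have l: "u ! i2 = symbol_of l" by auto
  have same: "fact2 SameWord (ptr_of p) i0" "fact2 SameWord (ptr_of q) i1"
    using D_same_ptr[OF _ _ i(6)] D_same_ptr[OF _ _ i(7)] pq i(1) by auto
  have le: "{i0, i1, i2, i3, ptr_of p, ptr_of q} \<subseteq> {..n}"
    using i(1) ptr_of(1)[of p] ptr_of(1)[of q] pq by auto
  show "fact2 (EpsTr c d b) (ptr_of p) (ptr_of q)" if "op = Eps"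
    by (rule D_eps[OF le z(2) l _ i(2-5) same])
      (use suf_letter(2)[of i3] i(1,9) that in auto)
  have stack: "fact3 (P c d b) (ptr_of p) (ptr_of q) (ptr_of a)"
    if a: "a \<in> stack_syms A" "enc_op op = l' # bin a"
      "(P, l') \<in> {(PushTr, PushSign), (PopTr, PopSign)}" for P l'
  proof (rule D_stack[OF _ z(2) l _ a(3) i(2-5) same])
    have i3: "suf i3 = l' # bin a @ Comma # r" using i(9) a(2) by simp
    have "1 \<le> i3" using i(1) by simp
    note s = suf_letter[OF this i3]
    show "{i0, i1, i2, i3, ptr_of p, ptr_of q, ptr_of a} \<subseteq> {..n}"
      using le ptr_of(1)[of a] a(1) by auto
    show "u ! i3 = symbol_of l'" by (rule s(2))
    show "fact2 SameWord (ptr_of a) (Suc i3)"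
      by (rule D_same_ptr[OF _ _ s(3)]) (use a(1) in auto)
  qed
  show "fact3 (PushTr c d b) (ptr_of p) (ptr_of q) (ptr_of a)" if "op = Push a"
    by (rule stack) (use that pq(3) in auto)
  show "fact3 (PopTr c d b) (ptr_of p) (ptr_of q) (ptr_of a)" if "op = Pop a"
    by (rule stack) (use that pq(3) in auto)
qed

lemma D_ends: "fact1 InitialAt (ptr_of (initial A))" "fact1 AcceptAt (ptr_of (accepting A))"
proof -
  let ?a = "sec0 @ Semicolon # sec1 @ Semicolon # enc_list trans_list"
  have L: "L = ?a @ Semicolon # tail" using L_split by simp
  have "count_list ?a Semicolon = 2" by (simp add: count_secs)
  note count = this
  have "(2::nat) \<le> 3" by simp
  note sec = D_section_at[OF L, unfolded count, OF this]
  let ?i = "Suc (Suc (length ?a))"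
  have "suf ?i = tail" using suf_append[of "?a @ [Semicolon]" tail] L by simp
  then have s0: "suf ?i = bin (bottom A) @ Comma # bin (initial A) @ Comma # bin (accepting A) @ [Comma]"
    by (simp add: tail_def)
  define j where "j = ?i + length (bin (bottom A)) + 1"
  from D_next_word[OF word_bin _ s0] have 1: "fact2 NextWord ?i j" "j \<le> n"
    and s1: "suf j = bin (initial A) @ Comma # bin (accepting A) @ [Comma]" by (simp_all add: j_def)
  define j' where "j' = j + length (bin (initial A)) + 1"
  have "1 \<le> j" "1 \<le> j'" by (simp_all add: j_def j'_def)
  from D_next_word[OF word_bin this(1) s1] have 2: "fact2 NextWord j j'" "j' \<le> n"
    and s2: "suf j' = bin (accepting A) @ Comma # []" by (simp_all add: j'_def)
  have st: "initial A \<in> states A \<union> stack_syms A" "accepting A \<in> states A \<union> stack_syms A"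
    using c1pvass by (auto simp: c1pvass_def)
  show "fact1 InitialAt (ptr_of (initial A))"
    by (rule D_initial[OF _ sec(3,1) 1(1) D_same_ptr[OF st(1) \<open>1 \<le> j\<close> s1]])
      (use sec(2) 1(2) ptr_of(1)[OF st(1)] in auto)
  show "fact1 AcceptAt (ptr_of (accepting A))"
    by (rule D_accept[OF _ sec(3,1) 1(1) 2(1) D_same_ptr[OF st(2) \<open>1 \<le> j'\<close> s2]])
      (use sec(2) 1(2) 2(2) ptr_of(1)[OF st(2)] in auto)
qed

definition goal_ptr :: "(nat \<times> bool) option \<Rightarrow> nat" where
  "goal_ptr X = (case X of None \<Rightarrow> 0 | Some (q, c) \<Rightarrow> ptr_of q)"

text \<open>The flag of \<open>None\<close> is normalised to \<open>False\<close>, the value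
  produced by \<open>gen_fin_rule\<close>.\<close>

definition goal_flag :: "(nat \<times> bool) option \<Rightarrow> bool" where
  "goal_flag X = (case X of None \<Rightarrow> False | Some (q, c) \<Rightarrow> c)"

definition goal_ok :: "(nat \<times> bool) option \<Rightarrow> bool" where
  "goal_ok X = (case X of None \<Rightarrow> True | Some (q, c) \<Rightarrow> q \<in> states A)"

lemma goal_simps [simp]:
  "goal_ptr None = 0" "goal_ptr (Some (q, c)) = ptr_of q" "goal_flag None = False"
  "goal_flag (Some (q, c)) = c" "goal_ok None" "goal_ok (Some (q, c)) \<longleftrightarrow> q \<in> states A"
  by (simp_all add: goal_ptr_def goal_flag_def goal_ok_def)

lemma goal_ptr_le: "goal_ok X \<Longrightarrow> goal_ptr X \<le> n"
  using ptr_of(1) by (auto simp: goal_ok_def goal_ptr_def split: option.splits)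

lemma ptr_le: "p \<in> states A \<union> stack_syms A \<Longrightarrow> ptr_of p \<le> n"
  using ptr_of(1) by auto

lemma ptr_states:
  "ptr A (p, c) (q, d) b op \<Longrightarrow> p \<in> states A \<and> q \<in> states A \<and> set_stack_op op \<subseteq> stack_syms A"
  using delta_props by fastforce

text \<open>All facts are derived at canonical positions, so the premises supplied by the induction
  fit together.\<close>

lemma D_gen:
  "genb g p X \<Longrightarrow> fst p \<in> states A \<Longrightarrow> goal_ok X \<Longrightarrow>
    fact2 (GenP g (snd p) (goal_flag X)) (ptr_of (fst p)) (goal_ptr X)"
proof (induction rule: genb.induct)
  case (genb_refl p)
  obtain q c where p: "p = (q, c)" by (cases p)
  have q: "q \<in> states A \<union> stack_syms A" using genb_refl p by simp
  from ptr_of[OF q] obtain r where "ptr_of q \<in> {1..n}" "suf (ptr_of q) = bin q @ Comma # r" by blast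
  with D_gen_refl[of "ptr_of q" c] D_same_ptr[OF q] show ?case by (simp add: p)
next
  case (genb_fin p)
  then show ?case using D_gen_fin[OF ptr_le D_ends(2)] by (cases p) auto
next
  case (genb_eps p r b g X)
  obtain q c q' d where p: "p = (q, c)" "r = (q', d)" by (cases p; cases r)
  from ptr_states genb_eps(1) p have st: "q' \<in> states A" by blast
  then have "fact2 (GenP g d (goal_flag X)) (ptr_of q') (goal_ptr X)" using genb_eps p by simp
  from D_gen_eps[OF _ D_ptr(1)[OF genb_eps(1)[unfolded p] refl] this] show ?case
    using genb_eps(4,5) st ptr_le goal_ptr_le p by simp
next
  case (genb_push p r b a g)
  obtain q c q' d where p: "p = (q, c)" "r = (q', d)" by (cases p; cases r)
  from ptr_states[OF genb_push(1)[unfolded p]] have st: "q' \<in> states A" "a \<in> stack_syms A" by simp_all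
  then have "fact2 (GenP g d False) (ptr_of q') 0" using genb_push p by simp
  from D_gen_push[OF _ D_ptr(2)[OF genb_push(1)[unfolded p] refl] this] show ?case
    using genb_push(4) st ptr_le p by simp
next
  case (genb_match p r b a g r' s b' h X)
  obtain q c q1 d q2 d' q3 e where p: "p = (q, c)" "r = (q1, d)" "r' = (q2, d')" "s = (q3, e)"
    by (cases p; cases r; cases r'; cases s)
  from ptr_states[OF genb_match(1)[unfolded p]] ptr_states[OF genb_match(3)[unfolded p]]
  have st: "q1 \<in> states A" "a \<in> stack_syms A" "q2 \<in> states A" "q3 \<in> states A" by simp_all
  then have "fact2 (GenP g d d') (ptr_of q1) (ptr_of q2)"
    "fact2 (GenP h e (goal_flag X)) (ptr_of q3) (goal_ptr X)" using genb_match p by simp_all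
  from D_match(1)[OF _ D_ptr(2)[OF genb_match(1)[unfolded p] refl] this(1)
      D_ptr(3)[OF genb_match(3)[unfolded p] refl] this(2)] show ?case
    using genb_match(7,8) st ptr_le goal_ptr_le p by simp
qed

definition node_ok :: "(nat \<times> bool) \<times> (nat \<times> bool) option \<Rightarrow> bool" where
  "node_ok N \<longleftrightarrow> fst (fst N) \<in> states A \<and> goal_ok (snd N)"

definition node_fact4 where
  "node_fact4 P N M \<longleftrightarrow> fact4 (P (snd (fst N)) (goal_flag (snd N)) (snd (fst M)) (goal_flag (snd M)))
     (ptr_of (fst (fst N))) (goal_ptr (snd N)) (ptr_of (fst (fst M))) (goal_ptr (snd M))"

lemma D_edge_match:
  assumes "ptr A (p, c) (q, d) b (Push a)" "genb g (q, d) (Some (q', d'))"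
    "ptr A (q', d') (s, e) b' (Pop a)" "genb h (s, e) X" "goal_ok X"
  shows "fact4 (EdgeP (b \<or> b' \<or> h) c (goal_flag X) d d') (ptr_of p) (goal_ptr X) (ptr_of q) (ptr_of q')"
    "fact4 (EdgeP (b \<or> b' \<or> g) c (goal_flag X) e (goal_flag X)) (ptr_of p) (goal_ptr X) (ptr_of s) (goal_ptr X)"
proof -
  note st = ptr_states[OF assms(1)] ptr_states[OF assms(3)]
  then have "fact2 (GenP g d d') (ptr_of q) (ptr_of q')"
    "fact2 (GenP h e (goal_flag X)) (ptr_of s) (goal_ptr X)"
    using D_gen[OF assms(2)] D_gen[OF assms(4)] assms(5) by simp_all
  note D_match(2,3)[OF _ D_ptr(2)[OF assms(1) refl] this(1) D_ptr(3)[OF assms(3) refl] this(2)]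
  then show
    "fact4 (EdgeP (b \<or> b' \<or> h) c (goal_flag X) d d') (ptr_of p) (goal_ptr X) (ptr_of q) (ptr_of q')"
    "fact4 (EdgeP (b \<or> b' \<or> g) c (goal_flag X) e (goal_flag X)) (ptr_of p) (goal_ptr X) (ptr_of s) (goal_ptr X)"
    using st assms(5) ptr_le goal_ptr_le by simp_all
qed

lemma D_edge: "edge g N M \<Longrightarrow> node_ok N \<Longrightarrow> node_ok M \<and> node_fact4 (EdgeP g) N M"
proof (induction rule: edge.induct)
  case (edge_eps p r b g X)
  obtain q c q' d where p: "p = (q, c)" "r = (q', d)" by (cases p; cases r)
  from ptr_states edge_eps(1) p have st: "q' \<in> states A" by blast
  then have "fact2 (GenP g d (goal_flag X)) (ptr_of q') (goal_ptr X)"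
    using D_gen[OF edge_eps(2)] edge_eps(3) p by (simp add: node_ok_def)
  from D_edge_eps[OF _ D_ptr(1)[OF edge_eps(1)[unfolded p] refl] this] show ?case
    using edge_eps(3) st ptr_le goal_ptr_le p by (simp add: node_ok_def node_fact4_def)
next
  case (edge_push p r b a g)
  obtain q c q' d where p: "p = (q, c)" "r = (q', d)" by (cases p; cases r)
  from ptr_states[OF edge_push(1)[unfolded p]] have st: "q' \<in> states A" "a \<in> stack_syms A" by simp_all
  then have "fact2 (GenP g d False) (ptr_of q') 0" using D_gen[OF edge_push(2)] p by simp
  from D_edge_push[OF _ D_ptr(2)[OF edge_push(1)[unfolded p] refl] this] show ?case
    using edge_push(3) st ptr_le p by (simp add: node_ok_def node_fact4_def)
next
  case (edge_inner p r b a g r' s b' h X)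
  obtain q c q1 d q2 d' q3 e where p: "p = (q, c)" "r = (q1, d)" "r' = (q2, d')" "s = (q3, e)"
    by (cases p; cases r; cases r'; cases s)
  from D_edge_match(1)[OF edge_inner(1-4)[unfolded p]] ptr_states edge_inner(1,3,5) p show ?case
    by (fastforce simp: node_ok_def node_fact4_def)
next
  case (edge_after p r b a g r' s b' h X)
  obtain q c q1 d q2 d' q3 e where p: "p = (q, c)" "r = (q1, d)" "r' = (q2, d')" "s = (q3, e)"
    by (cases p; cases r; cases r'; cases s)
  from D_edge_match(2)[OF edge_after(1-4)[unfolded p]] ptr_states edge_after(1,3,5) p show ?case
    by (fastforce simp: node_ok_def node_fact4_def)
qed

lemma D_reach: "reach f N M \<Longrightarrow> node_ok N \<Longrightarrow> node_ok M \<and> node_fact4 (ReachP f) N M"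
proof (induction rule: reach.induct)
  case (reach_refl N)
  then show ?case
    using D_reach_refl ptr_le goal_ptr_le by (simp add: node_ok_def node_fact4_def)
next
  case (reach_step f N M g M')
  then have M: "node_ok M" "node_fact4 (ReachP f) N M" by simp_all
  from D_edge[OF reach_step(2) M(1)] have M': "node_ok M'" "node_fact4 (EdgeP g) M M'" by simp_all
  from D_reach_step[OF _ M(2)[unfolded node_fact4_def] M'(2)[unfolded node_fact4_def]] show ?case
    using reach_step(4) M(1) M'(1) ptr_le goal_ptr_le by (simp add: node_ok_def node_fact4_def)
qed

lemma complete:
  assumes "pumpable (start, None)"
  shows "(Goal, [0, 0, 0, 0]) \<in> D"
proof -
  from assms obtain f M where M: "reach f (start, None) M" "reach True M M"
    unfolding pumpable_def by blast
  have ok: "node_ok (start, None)" using c1pvass by (simp add: node_ok_def start_def c1pvass_def)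
  from D_reach[OF M(1) ok] have 1: "node_ok M" "node_fact4 (ReachP f) (start, None) M" by simp_all
  from D_reach[OF M(2) 1(1)] have 2: "node_fact4 (ReachP True) M M" by simp
  have init: "initial A \<in> states A \<union> stack_syms A" using c1pvass by (simp add: c1pvass_def)
  show ?thesis
    by (rule D_goal[OF _ D_ends(1) _ 2[unfolded node_fact4_def]])
      (use 1 ptr_le[OF init] ptr_le goal_ptr_le in \<open>simp_all add: node_ok_def node_fact4_def start_def\<close>)
qed

lemma is_bounded_iff_derives: "is_bounded A \<longleftrightarrow> (Goal, [0, 0, 0, 0]) \<notin> derives prog (8 # map symbol_of (encode A))"
  using is_bounded_iff sound complete unfolding u_def L_def by blast

end

section \<open>Polynomial-time decidability and the main result\<close>

lemma polytime_decidable_is_bounded: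
  "polytime_decidable {A :: (nat, nat) c1pvass. c1pvass A \<and> unit_updates A}
     (\<lambda>A. map symbol_of (encode A)) is_bounded"
proof -
  from pumpable_machine obtain M c d where M: "turing_machine M" "tm_symbols M = 9"
    "\<And>w. w \<noteq> [] \<Longrightarrow> set w \<subseteq> {0<..<8} \<Longrightarrow> \<exists>t \<le> c * length w ^ d + c.
       fst ((tm_step M ^^ t) (tm_init M w)) =
         (if (Goal, [0, 0, 0, 0]) \<in> derives prog (8 # w) then tm_reject M else tm_accept M)" by blast
  have "set (map symbol_of (encode A)) \<subseteq> {0<..<9} \<and>
    (\<exists>t \<le> c * length (map symbol_of (encode A)) ^ d + c.
      fst ((tm_step M ^^ t) (tm_init M (map symbol_of (encode A)))) =
        (if is_bounded A then tm_accept M else tm_reject M))"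
    if "c1pvass A" "unit_updates A" for A :: "(nat, nat) c1pvass"
  proof -
    interpret encoded A using that by unfold_locales
    let ?w = "map symbol_of (encode A)"
    have "?w \<noteq> []" using L_split unfolding L_def by simp
    moreover have "set ?w \<subseteq> {0<..<8}" using symbol_of_bounds by auto
    ultimately show ?thesis using M(3)[of ?w] unfolding is_bounded_iff_derives
      by (auto split: if_splits)
  qed
  with M(1,2) show ?thesis unfolding polytime_decidable_def
    by (intro exI[of _ M] exI[of _ c] exI[of _ d]) simp
qed

theorem theorem3p8:
  "polytime_decidable
     {A :: (nat, nat) c1pvass. c1pvass A \<and> unit_updates A}
     (\<lambda>A. map symbol_of (encode A)) is_bounded \<and>
   (\<forall>A :: (nat, nat) c1pvass.
     c1pvass A \<longrightarrow> unit_updates A \<longrightarrow> is_bounded A \<longrightarrow>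
     cover_bound A \<le> ereal (2 ^ ((4 * enc_size A) ^ 9)))"
  using polytime_decidable_is_bounded cover_bound_le_enc_size by blast

end
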